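(* For any $1\le l\le k\le n$ and any $1<\delta\le 2$, a $\delta$-balanced $(n,k,l)$-splitter of size $2^{O(k\log l-\log(\delta-1))}\log n$ can be constructed deterministically in time $2^{O(k\log l-\log(\delta-1))}\,n\log n$, where the implied constants are absolute.
   Context: $[n]=\{1,\dots,n\}$, $\binom{[n]}{k}$ is the family of $k$-element subsets of $[n]$, and $k \bmod l$ is the unique $0\le r<l$ with $k=ql+r$ for an integer $q$. For a family (multiset) $H$ of functions from $[n]$ to $[l]$ with $k\ge l$ and $S\in\binom{[n]}{k}$, $split(S)$ is the number of $h\in H$ for which the parts $h^{-1}(j)\cap S$, $j=1,\dots,l$, have sizes $|h^{-1}(j)\cap S|=\lceil k/l\rceil$ for $j\le k\bmod l$ and $\lfloor k/l\rfloor$ for $j>k \bmod l$ (when $l$ divides $k$ this means all parts have size $k/l$; when $k=l$ it means $h$ is one-to-one on $S$). For $\delta\ge1$, $H$ is a $\delta$-balanced $(n,k,l)$-splitter if there is a real $T>0$ with $T/\delta\le split(S)\le\delta T$ for all $S\in\binom{[n]}{k}$. The size of $H$ is its number of functions; constructing it means outputting the list of all its functions. *)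

theory Defs
  imports Complex_Main "HOL-Library.Multiset" "HOL-Library.FuncSet"
begin

section \<open>Balanced splitters\<close>

definition splits :: "nat \<Rightarrow> nat \<Rightarrow> (nat \<Rightarrow> nat) \<Rightarrow> nat set \<Rightarrow> bool" where
  "splits k l h S \<longleftrightarrow>
     (\<forall>j\<in>{1..l}. int (card (h -` {j} \<inter> S)) =
        (if j \<le> k mod l then \<lceil>real k / real l\<rceil> else \<lfloor>real k / real l\<rfloor>))"

definition split_count :: "nat \<Rightarrow> nat \<Rightarrow> (nat \<Rightarrow> nat) multiset \<Rightarrow> nat set \<Rightarrow> nat" where
  "split_count k l H S = size {#h \<in># H. splits k l h S#}"

text \<open>Using the extensional function space makes an element of a family exactly a function
  from \<open>[n]\<close> to \<open>[l]\<close>, with no junk outside \<open>[n]\<close>.\<close>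

definition balanced_splitter ::
    "real \<Rightarrow> nat \<Rightarrow> nat \<Rightarrow> nat \<Rightarrow> (nat \<Rightarrow> nat) multiset \<Rightarrow> bool" where
  "balanced_splitter \<delta> n k l H \<longleftrightarrow>
     set_mset H \<subseteq> ({1..n} \<rightarrow>\<^sub>E {1..l}) \<and>
     (\<exists>T::real. T > 0 \<and>
        (\<forall>S. S \<subseteq> {1..n} \<and> card S = k \<longrightarrow>
           T / \<delta> \<le> real (split_count k l H S) \<and> real (split_count k l H S) \<le> \<delta> * T))"

section \<open>A word RAM\<close>

text \<open>
  Deterministic algorithms are programs of a structured word RAM. A program is a finite text that
  has to work for all inputs. It accesses a fixed number of registers, a memory addressed by words,
  and a write-only output tape. With word length \<open>w\<close>, every value that is computed must be
  less than \<open>2 ^ w\<close>; a program that would exceed this has no execution. Every arithmetic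
  operation, register access, memory access, test and output of one word costs one step.
  Subtraction is truncated at 0; a test succeeds iff its value is nonzero.
\<close>

datatype bop = Plus | Minus | Times | Quot | Rem

datatype expr = Const nat | Reg nat | Mem expr | Bin bop expr expr

datatype prog =
    Skip
  | Assign nat expr
  | Store expr expr
  | Write expr
  | Seq prog prog
  | Cond expr prog prog
  | While expr prog

record state =
  regs :: "nat \<Rightarrow> nat"
  mem :: "nat \<Rightarrow> nat"
  outp :: "nat list"

fun bop_val :: "bop \<Rightarrow> nat \<Rightarrow> nat \<Rightarrow> nat" where
  "bop_val Plus a b = a + b"
| "bop_val Minus a b = a - b"
| "bop_val Times a b = a * b"
| "bop_val Quot a b = a div b"
| "bop_val Rem a b = a mod b"

fun expr_val :: "state \<Rightarrow> expr \<Rightarrow> nat" where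
  "expr_val s (Const c) = c"
| "expr_val s (Reg r) = regs s r"
| "expr_val s (Mem e) = mem s (expr_val s e)"
| "expr_val s (Bin f e1 e2) = bop_val f (expr_val s e1) (expr_val s e2)"

fun expr_fits :: "nat \<Rightarrow> state \<Rightarrow> expr \<Rightarrow> bool" where
  "expr_fits w s (Const c) \<longleftrightarrow> c < 2 ^ w"
| "expr_fits w s (Reg r) \<longleftrightarrow> regs s r < 2 ^ w"
| "expr_fits w s (Mem e) \<longleftrightarrow> expr_fits w s e \<and> mem s (expr_val s e) < 2 ^ w"
| "expr_fits w s (Bin f e1 e2) \<longleftrightarrow>
     expr_fits w s e1 \<and> expr_fits w s e2 \<and> expr_val s (Bin f e1 e2) < 2 ^ w"

fun expr_cost :: "expr \<Rightarrow> nat" where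
  "expr_cost (Const c) = 1"
| "expr_cost (Reg r) = 1"
| "expr_cost (Mem e) = 1 + expr_cost e"
| "expr_cost (Bin f e1 e2) = 1 + expr_cost e1 + expr_cost e2"

text \<open>\<open>exec w P s t s'\<close>: with word length \<open>w\<close>, program \<open>P\<close> started in state \<open>s\<close> halts after
  exactly \<open>t\<close> steps in state \<open>s'\<close>.\<close>

inductive exec :: "nat \<Rightarrow> prog \<Rightarrow> state \<Rightarrow> nat \<Rightarrow> state \<Rightarrow> bool" for w where
  Skip: "exec w Skip s 1 s"
| Assign: "expr_fits w s e \<Longrightarrow>
    exec w (Assign r e) s (1 + expr_cost e) (s\<lparr>regs := (regs s)(r := expr_val s e)\<rparr>)"
| Store: "expr_fits w s a \<Longrightarrow> expr_fits w s e \<Longrightarrow>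
    exec w (Store a e) s (1 + expr_cost a + expr_cost e)
      (s\<lparr>mem := (mem s)(expr_val s a := expr_val s e)\<rparr>)"
| Write: "expr_fits w s e \<Longrightarrow>
    exec w (Write e) s (1 + expr_cost e) (s\<lparr>outp := outp s @ [expr_val s e]\<rparr>)"
| Seq: "exec w P s t s' \<Longrightarrow> exec w Q s' t' s'' \<Longrightarrow> exec w (Seq P Q) s (t + t') s''"
| CondTrue: "expr_fits w s e \<Longrightarrow> expr_val s e \<noteq> 0 \<Longrightarrow> exec w P s t s' \<Longrightarrow>
    exec w (Cond e P Q) s (1 + expr_cost e + t) s'"
| CondFalse: "expr_fits w s e \<Longrightarrow> expr_val s e = 0 \<Longrightarrow> exec w Q s t s' \<Longrightarrow>
    exec w (Cond e P Q) s (1 + expr_cost e + t) s'"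
| WhileFalse: "expr_fits w s e \<Longrightarrow> expr_val s e = 0 \<Longrightarrow>
    exec w (While e P) s (1 + expr_cost e) s"
| WhileTrue: "expr_fits w s e \<Longrightarrow> expr_val s e \<noteq> 0 \<Longrightarrow> exec w P s t s' \<Longrightarrow>
    exec w (While e P) s' t' s'' \<Longrightarrow> exec w (While e P) s (1 + expr_cost e + t + t') s''"

inductive_cases SkipE: "exec w Skip s t s'"
inductive_cases AssignE: "exec w (Assign r e) s t s'"
inductive_cases StoreE: "exec w (Store a e) s t s'"
inductive_cases WriteE: "exec w (Write e) s t s'"
inductive_cases SeqE: "exec w (Seq P Q) s t s'"
inductive_cases CondE: "exec w (Cond e P Q) s t s'"
inductive_cases WhileE: "exec w (While e P) s t s'"

lemma exec_deterministic:
  "exec w P s t s' \<Longrightarrow> exec w P s u s'' \<Longrightarrow> u = t \<and> s'' = s'"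
proof (induction arbitrary: u s'' rule: exec.induct)
  case (Skip s)
  from Skip.prems show ?case by (auto elim: SkipE)
next
  case (Assign s e r)
  from Assign.prems show ?case by (auto elim: AssignE)
next
  case (Store s a e)
  from Store.prems show ?case by (auto elim: StoreE)
next
  case (Write s e)
  from Write.prems show ?case by (auto elim: WriteE)
next
  case (Seq P s t s' Q t' s2)
  from Seq.prems obtain u1 s1 u2 where "exec w P s u1 s1" "exec w Q s1 u2 s''" "u = u1 + u2"
    by (rule SeqE)
  then show ?case using Seq.IH by metis
next
  case (CondTrue s e P t s' Q)
  from CondTrue.prems CondTrue.hyps(2) obtain u1 where "exec w P s u1 s''" "u = 1 + expr_cost e + u1"
    by (auto elim: CondE)
  then show ?case using CondTrue.IH by metis
next
  case (CondFalse s e Q t s' P)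
  from CondFalse.prems CondFalse.hyps(2) obtain u1 where "exec w Q s u1 s''" "u = 1 + expr_cost e + u1"
    by (auto elim: CondE)
  then show ?case using CondFalse.IH by metis
next
  case (WhileFalse s e P)
  from WhileFalse.prems WhileFalse.hyps(2) show ?case by (auto elim: WhileE)
next
  case (WhileTrue s e P t s' t' s2)
  from WhileTrue.prems WhileTrue.hyps(2) obtain u1 s1 u2
    where "exec w P s u1 s1" "exec w (While e P) s1 u2 s''" "u = 1 + expr_cost e + u1 + u2"
    by (auto elim: WhileE)
  then show ?case using WhileTrue.IH by metis
qed

definition init_state :: "nat list \<Rightarrow> state" where
  "init_state xs =
     \<lparr>regs = (\<lambda>r. if r < length xs then xs ! r else 0), mem = (\<lambda>_. 0), outp = []\<rparr>"

section \<open>Input and output formats\<close>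

text \<open>
  A real number \<open>\<delta> > 1\<close> is passed to a program as a fraction \<open>p / q\<close>, given by the two words
  \<open>p\<close> and \<open>q\<close>. A rational \<open>\<delta>\<close> may be passed exactly. To cover irrational \<open>\<delta>\<close>, the
  fraction need only be a lower bound greater than 1 that determines \<open>\<delta> - 1\<close> up to a factor 2.
\<close>

definition presents :: "nat \<Rightarrow> nat \<Rightarrow> real \<Rightarrow> bool" where
  "presents p q \<delta> \<longleftrightarrow>
     0 < q \<and> 1 < real p / real q \<and> real p / real q \<le> \<delta> \<and> \<delta> - 1 \<le> 2 * (real p / real q - 1)"

lemma presents_exact: "0 < q \<Longrightarrow> q < p \<Longrightarrow> presents p q (real p / real q)"
  by (simp add: presents_def field_simps)

text \<open>Every \<open>\<delta>\<close> in range has a presentation by numbers of size \<open>O(1 / (\<delta> - 1))\<close>.\<close>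

lemma presents_exists:
  assumes "1 < \<delta>" "\<delta> \<le> 2"
  shows "\<exists>d. real d \<le> 2 / (\<delta> - 1) \<and> presents (d + 1) d \<delta>"
proof -
  define x where "x = 1 / (\<delta> - 1)"
  have x: "1 \<le> x" "\<delta> - 1 = 1 / x"
    using assms by (simp_all add: x_def)
  define d where "d = nat \<lceil>x\<rceil>"
  have d: "x \<le> real d" "real d \<le> 2 * x" "0 < d"
    using x unfolding d_def by linarith+
  have "1 / real d \<le> 1 / x" "1 / x \<le> 2 / real d"
    using d x by (simp_all add: field_simps)
  moreover have "real (d + 1) / real d = 1 + 1 / real d"
    using d by (simp add: field_simps)
  ultimately have "presents (d + 1) d \<delta>"
    using x d unfolding presents_def by simp
  moreover have "real d \<le> 2 / (\<delta> - 1)"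
    using d(2) by (simp add: x_def)
  ultimately show ?thesis by blast
qed

text \<open>The list of functions \<open>hs\<close> is output as the concatenation of the tables
  \<open>h 1, \<dots>, h n\<close>.\<close>

definition function_tables :: "nat \<Rightarrow> (nat \<Rightarrow> nat) list \<Rightarrow> nat list" where
  "function_tables n hs = concat (map (\<lambda>h. map h [1..<n + 1]) hs)"

section \<open>The bounds\<close>

definition expo :: "nat \<Rightarrow> nat \<Rightarrow> real \<Rightarrow> real" where
  "expo k l \<delta> = real k * log 2 (real l) - log 2 (\<delta> - 1)"

text \<open>This agrees with \<open>log 2 n\<close> except at \<open>n = 1\<close>, where \<open>log 2 n = 0\<close> cannot bound
  the size of a splitter, which is positive.\<close>

definition lg :: "nat \<Rightarrow> real" where
  "lg n = max 1 (log 2 (real n))"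

end

theory Submission
  imports Defs "HOL-Library.Z2" "HOL-Computational_Algebra.Polynomial_Factorial"
begin

text \<open>
  Colour \<open>[n]\<close> by composing three explicit ingredients. A function \<open>h\<close> from \<open>[n]\<close> to \<open>[M]\<close>, with
  \<open>M = l ^ O(k) / (\<delta> - 1) ^ O(1)\<close>, ranges over the \<open>O(M log n)\<close> coordinates of a linear code in
  which two words agree in a fraction of at most \<open>3 / M\<close> of the coordinates, so almost all \<open>h\<close> are
  injective on a given \<open>k\<close>-set. By linearity only the weights of the \<open>n\<close> code words matter, not their
  pairs: a greedy choice of the coordinates, one bit position of the argument after the other, costs
  \<open>O(n)\<close> per coordinate.

  The points of \<open>[M]\<close> then read consecutive \<open>\<beta>\<close>-bit words, \<open>2 ^ \<beta> \<ge> l\<close>, from the output of a linear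
  feedback shift register modulo an irreducible polynomial \<open>f\<close> of degree \<open>r\<close> over the field with two
  elements, where \<open>2 ^ r = M ^ 2\<close>. For a uniform initial state the \<open>k * \<beta>\<close> bits read by a \<open>k\<close>-set are
  exactly uniform unless \<open>f\<close> divides one of the \<open>2 ^ (k * \<beta>)\<close> polynomials supported on their positions,
  which excludes few \<open>f\<close>. Finally the words are reduced modulo \<open>l\<close>. The colours need not be uniform:
  as a splitting fixes the size of every colour class, independent identically distributed colours
  split all \<open>k\<close>-sets with the same probability, which is at least \<open>2 ^ (- k * \<beta>)\<close>.
\<close>

text \<open>The bounds tolerate any power of \<open>M\<close>, which depends on \<open>k\<close>,
  \<open>l\<close> and \<open>\<delta>\<close> only, but just one factor \<open>n\<close> and one
  factor \<open>log n\<close>. So everything that lives on \<open>[M]\<close>, namely all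
  polynomials, all initial states and all tables, is enumerated exhaustively, and only the code has
  to be economical in \<open>n\<close>. The choice \<open>2 ^ r = M ^ 2\<close> comes from a count:
  at least \<open>2 ^ r / (2 * r)\<close> polynomials of degree \<open>r\<close> are irreducible,
  while a \<open>k\<close>-set excludes at most \<open>K * M * \<beta> / r\<close> of them, where
  \<open>K = 2 ^ (k * \<beta>)\<close>. The excluded fraction is then at most
  \<open>2 * K * \<beta> / M\<close>. This error and that of the non-injective \<open>h\<close> must
  be small against \<open>(\<delta> - 1) / K\<close>, since the splitting probability may be as
  small as \<open>1 / K\<close>; hence \<open>M\<close> contains the factor \<open>K ^ 2\<close>.
  The machine lacks bitwise operations. Exclusive ors are therefore looked up in a table whose size
  is a power of \<open>M\<close>, and irreducible polynomials are found by a sieve over all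
  products.\<close>

unbundle bit_operations_syntax

declare add_bit_eq_xor [simp del] mult_bit_eq_and [simp del]

section \<open>Polynomials over the field with two elements\<close>

text \<open>Words stand for polynomials: exclusive or becomes addition and doubling becomes
  multiplication by the indeterminate. The range \<open>i < x\<close> is wide enough because a set
  bit of \<open>x\<close> has a position below \<open>x\<close>.\<close>

definition bpoly :: "nat \<Rightarrow> bit poly" where
  "bpoly x = (\<Sum>i<x. monom (of_bool (bit x i)) i)"

lemma bit_nat_imp_less: "bit (x::nat) i \<Longrightarrow> i < x"
  by (metis bit_iff_odd div_less even_zero less_exp not_less order_less_le_trans)

lemma coeff_bpoly: "coeff (bpoly x) i = of_bool (bit x i)"
proof (cases "i < x")
  case True
  then show ?thesis by (simp add: bpoly_def coeff_sum if_distrib sum.delta cong: if_cong)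
next
  case False
  then have "\<not> bit x i" using bit_nat_imp_less by blast
  then show ?thesis using False by (simp add: bpoly_def coeff_sum if_distrib sum.delta cong: if_cong)
qed

lemma bit_add_self [simp]: "(a::bit) + a = 0"
  by (cases a) simp_all

lemma bit_poly_add_self [simp]: "(p::bit poly) + p = 0"
  by (rule poly_eqI) (simp only: coeff_add bit_add_self coeff_0)

lemma bpoly_xor: "bpoly (x XOR y) = bpoly x + bpoly y"
  by (rule poly_eqI) (auto simp: coeff_bpoly bit_xor_iff add_bit_eq_xor)

lemma bpoly_double: "bpoly (2 * x) = pCons 0 (bpoly x)"
  by (rule poly_eqI) (auto simp: coeff_bpoly bit_double_iff coeff_pCons split: nat.splits)

lemma bpoly_0 [simp]: "bpoly 0 = 0"
  by (rule poly_eqI) (simp add: coeff_bpoly)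

lemma bpoly_1 [simp]: "bpoly (Suc 0) = 1"
  by (rule poly_eqI) (auto simp add: coeff_bpoly bit_Suc_0_iff coeff_1)

lemma inj_bpoly: "inj bpoly"
proof (rule injI)
  fix x y assume "bpoly x = bpoly y"
  then have "bit x i = bit y i" for i
    using coeff_bpoly[of x i] coeff_bpoly[of y i] by (auto split: if_splits)
  then show "x = y" by (simp add: bit_eq_iff)
qed

lemma bpoly_eq_iff: "bpoly x = bpoly y \<longleftrightarrow> x = y"
  using inj_bpoly by (auto dest: injD)

lemma bpoly_eq_0_iff [simp]: "bpoly x = 0 \<longleftrightarrow> x = 0"
  using bpoly_eq_iff[of x 0] by simp

lemma surj_bpoly: "\<exists>x. bpoly x = p"
proof (induction p)
  case 0
  have "bpoly 0 = 0" by simp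
  then show ?case by blast
next
  case (pCons a p)
  then obtain x where x: "bpoly x = p" by blast
  have "bpoly ((2 * x) XOR of_bool (a = 1)) = pCons a p"
    using x by (cases a) (simp_all add: bpoly_xor bpoly_double one_pCons)
  then show ?case by blast
qed

lemma degree_bpoly: "x \<noteq> 0 \<Longrightarrow> degree (bpoly x) < r \<longleftrightarrow> x < 2 ^ r"
proof
  assume x: "x \<noteq> 0" and "degree (bpoly x) < r"
  then have "\<not> bit x i" if "r \<le> i" for i
    using that coeff_eq_0[of "bpoly x" i] by (auto simp: coeff_bpoly split: if_splits)
  then have "take_bit r x = x"
    by (intro bit_eqI) (auto simp: bit_take_bit_iff not_le[symmetric])
  then show "x < 2 ^ r" by (simp add: take_bit_nat_eq_self_iff)
next
  assume x: "x \<noteq> 0" and "x < 2 ^ r"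
  then have "take_bit r x = x" by (simp add: take_bit_nat_eq_self_iff)
  then have "bit x i \<Longrightarrow> i < r" for i by (metis bit_take_bit_iff)
  moreover have "bit x (degree (bpoly x))"
    using x leading_coeff_neq_0[of "bpoly x"] by (simp add: coeff_bpoly del: leading_coeff_neq_0 leading_coeff_0_iff split: if_splits)
  ultimately show "degree (bpoly x) < r" by blast
qed

lemma degree_bpoly_eq: "x \<noteq> 0 \<Longrightarrow> degree (bpoly x) = r \<longleftrightarrow> 2 ^ r \<le> x \<and> x < 2 ^ Suc r"
  using degree_bpoly[of x r] degree_bpoly[of x "Suc r"] by (auto simp: less_Suc_eq not_less)

definition polys_of_degree :: "nat \<Rightarrow> bit poly set" where
  "polys_of_degree r = {p. p \<noteq> 0 \<and> degree p = r}"

lemma polys_of_degree_bpoly: "polys_of_degree r = bpoly ` {2 ^ r..<2 ^ Suc r}"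
proof (intro equalityI subsetI)
  fix p assume "p \<in> polys_of_degree r"
  moreover obtain x where "p = bpoly x" using surj_bpoly by metis
  ultimately show "p \<in> bpoly ` {2 ^ r..<2 ^ Suc r}"
    using degree_bpoly_eq[of x r] by (auto simp: polys_of_degree_def)
next
  fix p assume "p \<in> bpoly ` {2 ^ r..<2 ^ Suc r}"
  then obtain x where x: "p = bpoly x" "2 ^ r \<le> x" "x < 2 ^ Suc r" by auto
  then have "x \<noteq> 0" by (metis le_zero_eq power_eq_0_iff zero_neq_numeral)
  then show "p \<in> polys_of_degree r"
    using degree_bpoly_eq[of x r] x by (simp add: polys_of_degree_def)
qed

lemma card_polys_of_degree: "card (polys_of_degree r) = 2 ^ r"
  unfolding polys_of_degree_bpoly by (subst card_image) (auto intro: inj_on_subset[OF inj_bpoly])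

lemma finite_polys_of_degree [simp]: "finite (polys_of_degree r)"
  unfolding polys_of_degree_bpoly by simp

lemma bit_poly_degree_0: "(p::bit poly) \<noteq> 0 \<Longrightarrow> degree p = 0 \<Longrightarrow> p = 1"
  by (erule degree_eq_zeroE) (simp add: one_pCons)

lemma bit_poly_is_unit: "is_unit (p::bit poly) \<longleftrightarrow> p = 1"
  by (metis bit_poly_degree_0 is_unit_iff_degree dvd_refl not_is_unit_0)

text \<open>As \<open>1\<close> is the only unit, a trivial factor is the same as a constant one.
  This form speaks of degrees only, so a sieve over products can decide it.\<close>

lemma irreducible_bit_poly_iff:
  fixes p :: "bit poly"
  assumes "0 < degree p"
  shows "irreducible p \<longleftrightarrow> (\<forall>a b. p = a * b \<longrightarrow> degree a = 0 \<or> degree b = 0)"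
proof
  assume irr: "irreducible p"
  show "\<forall>a b. p = a * b \<longrightarrow> degree a = 0 \<or> degree b = 0"
    using irreducibleD[OF irr] by (metis bit_poly_is_unit degree_1)
next
  assume *: "\<forall>a b. p = a * b \<longrightarrow> degree a = 0 \<or> degree b = 0"
  show "irreducible p"
  proof (rule irreducibleI)
    show "p \<noteq> 0" "\<not> is_unit p" using assms by (auto simp: bit_poly_is_unit)
    fix a b assume ab: "p = a * b"
    with assms have "a \<noteq> 0" "b \<noteq> 0" by auto
    with * ab show "is_unit a \<or> is_unit b" using bit_poly_degree_0 bit_poly_is_unit by blast
  qed
qed

lemma irreducible_bit_poly_degree: "irreducible (p::bit poly) \<Longrightarrow> 0 < degree p"
  by (metis bit_poly_degree_0 bit_poly_is_unit gr0I irreducible_def)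

text \<open>A divisor of least positive degree cannot be a product of two non-constant
  factors.\<close>

lemma exists_irreducible_divisor:
  fixes h :: "bit poly"
  assumes "0 < degree h"
  shows "\<exists>f. irreducible f \<and> f dvd h"
proof -
  obtain f where f: "f dvd h" "0 < degree f"
    and min: "\<And>g. g dvd h \<Longrightarrow> 0 < degree g \<Longrightarrow> degree f \<le> degree g"
    using ex_has_least_nat[of "\<lambda>f. f dvd h \<and> 0 < degree f" h degree] assms by auto
  have "degree a = 0 \<or> degree b = 0" if ab: "f = a * b" for a b
  proof (rule ccontr)
    assume *: "\<not> (degree a = 0 \<or> degree b = 0)"
    then have "a \<noteq> 0" "b \<noteq> 0" by auto
    then have "degree f = degree a + degree b" using ab by (simp add: degree_mult_eq)
    moreover have "degree f \<le> degree a" using min[of a] f(1) ab * by (meson dvd_mult_left gr0I)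
    ultimately show False using * by simp
  qed
  with f show ?thesis using irreducible_bit_poly_iff by blast
qed

section \<open>The number of irreducible polynomials of a given degree\<close>

definition irreducibles :: "nat \<Rightarrow> bit poly set" where
  "irreducibles r = {f. irreducible f \<and> degree f = r}"

lemma irreducibles_subset: "irreducibles r \<subseteq> polys_of_degree r"
  unfolding irreducibles_def polys_of_degree_def by auto

lemma finite_irreducibles [simp]: "finite (irreducibles r)"
  using finite_subset[OF irreducibles_subset] by simp

text \<open>The library notion \<open>multiplicity\<close> is not available for \<open>bit poly\<close>, since the type \<open>bit\<close> is not
  an instance of the class \<open>factorial_ring_gcd\<close>.\<close>

definition mlt :: "bit poly \<Rightarrow> bit poly \<Rightarrow> nat" where
  "mlt f h = card {j. 1 \<le> j \<and> f ^ j dvd h}"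

lemma power_dvd_bounded:
  fixes f h :: "bit poly"
  assumes "0 < degree f" "h \<noteq> 0"
  shows "{j. 1 \<le> j \<and> f ^ j dvd h} \<subseteq> {1..degree h}"
proof
  fix j assume "j \<in> {j. 1 \<le> j \<and> f ^ j dvd h}"
  then have j: "1 \<le> j" "f ^ j dvd h" by auto
  then have "degree (f ^ j) \<le> degree h" using assms dvd_imp_degree_le by blast
  moreover have "degree (f ^ j) = j * degree f" using assms by (subst degree_power_eq) auto
  moreover have "j \<le> j * degree f" using assms by simp
  ultimately have "j \<le> degree h" by linarith
  then show "j \<in> {1..degree h}" using j by simp
qed

lemma mlt_1: "irreducible f \<Longrightarrow> mlt f 1 = 0"
  using power_dvd_bounded[of f 1] irreducible_bit_poly_degree[of f]
  by (simp add: mlt_def card_eq_0_iff)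

lemma mlt_mult_same:
  assumes "irreducible f" "g \<noteq> 0"
  shows "mlt f (f * g) = Suc (mlt f g)"
proof -
  have d: "0 < degree f" "f \<noteq> 0" using assms irreducible_bit_poly_degree by auto
  have fin: "finite {j. 1 \<le> j \<and> f ^ j dvd g}"
    using power_dvd_bounded[OF d(1) assms(2)] finite_subset by blast
  have "{j. 1 \<le> j \<and> f ^ j dvd f * g} = Suc ` {j. f ^ j dvd g}"
  proof (intro equalityI subsetI)
    fix j assume "j \<in> {j. 1 \<le> j \<and> f ^ j dvd f * g}"
    moreover then obtain i where "j = Suc i" by (cases j) auto
    ultimately show "j \<in> Suc ` {j. f ^ j dvd g}" using d by auto
  next
    fix j assume "j \<in> Suc ` {j. f ^ j dvd g}"
    then show "j \<in> {j. 1 \<le> j \<and> f ^ j dvd f * g}" by (auto intro: mult_dvd_mono)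
  qed
  also have "{j. f ^ j dvd g} = insert 0 {j. 1 \<le> j \<and> f ^ j dvd g}"
    by (auto simp: Suc_le_eq intro!: gr0I)
  finally show ?thesis unfolding mlt_def using fin
    by (simp add: card_image card_insert_if image_iff)
qed

text \<open>The irreducible \<open>e\<close> is prime and does not divide the different irreducible
  \<open>f\<close>, so every factor \<open>e\<close> of a power that divides \<open>f * g\<close> is
  taken from \<open>g\<close>.\<close>

lemma mlt_mult_other:
  assumes e: "irreducible e" and f: "irreducible f" and "e \<noteq> f"
  shows "mlt e (f * g) = mlt e g"
proof -
  have pe: "prime_elem e" using e by (rule field_poly_irreducible_imp_prime)
  have nd: "\<not> e dvd f"
  proof
    assume "e dvd f"
    then obtain c where c: "f = e * c" by blast
    then have "is_unit c" using irreducibleD[OF f c] e by (simp add: irreducible_def)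
    with c \<open>e \<noteq> f\<close> show False by (simp add: bit_poly_is_unit)
  qed
  have "e ^ j dvd f * g \<longleftrightarrow> e ^ j dvd g" for j
  proof
    assume "e ^ j dvd f * g"
    then show "e ^ j dvd g"
    proof (induction j)
      case (Suc j)
      then have "e ^ j dvd g" by (metis dvd_mult_right power_Suc mult.commute dvd_trans dvd_triv_left)
      then obtain g' where g': "g = e ^ j * g'" by blast
      with Suc.prems have "e ^ j * e dvd e ^ j * (f * g')" by (simp add: mult_ac)
      moreover have "e ^ j \<noteq> 0" using pe by (simp add: prime_elem_def)
      ultimately have "e dvd f * g'" using dvd_mult_cancel_left by blast
      then have "e dvd g'" using pe nd prime_elem_dvd_multD by blast
      then show ?case using g' by (simp add: mult_dvd_mono mult.commute)
    qed simp
  qed simp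
  then show ?thesis by (simp add: mlt_def)
qed

text \<open>Unique factorisation seen through degrees: splitting off an irreducible factor
  \<open>f\<close> lowers one multiplicity by 1 and the degree by \<open>degree f\<close>. The bound
  \<open>R\<close> does not depend on \<open>h\<close>, so sums over many \<open>h\<close> can later
  be interchanged with those over the irreducibles.\<close>

lemma degree_eq_sum_mlt:
  fixes h :: "bit poly"
  assumes "h \<noteq> 0" "degree h \<le> R"
  shows "degree h = (\<Sum>d\<in>{1..R}. \<Sum>f\<in>irreducibles d. d * mlt f h)"
  using assms
proof (induction "degree h" arbitrary: h rule: less_induct)
  case less
  show ?case
  proof (cases "degree h = 0")
    case True
    then have "h = 1" using less.prems bit_poly_degree_0 by blast
    then show ?thesis by (simp add: mlt_1 irreducibles_def)
  next
    case False
    then obtain f where f: "irreducible f" "f dvd h" using exists_irreducible_divisor by blast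
    then obtain g where g: "h = f * g" by blast
    have nz: "f \<noteq> 0" "g \<noteq> 0" using less.prems g by auto
    have df: "0 < degree f" using irreducible_bit_poly_degree f by blast
    have dh: "degree h = degree f + degree g" using nz g by (simp add: degree_mult_eq)
    have IH: "degree g = (\<Sum>d\<in>{1..R}. \<Sum>f\<in>irreducibles d. d * mlt f g)"
      using less.hyps[of g] dh df nz less.prems by simp
    have m: "mlt e h = mlt e g + of_bool (e = f)" if e: "irreducible e" for e
      using mlt_mult_same[OF e nz(2)] mlt_mult_other[OF e f(1), of g] g by auto
    have "(\<Sum>d\<in>{1..R}. \<Sum>e\<in>irreducibles d. d * mlt e h)
        = (\<Sum>d\<in>{1..R}. \<Sum>e\<in>irreducibles d. d * mlt e g)
         + (\<Sum>d\<in>{1..R}. \<Sum>e\<in>irreducibles d. d * of_bool (e = f))"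
      unfolding sum.distrib[symmetric]
      by (intro sum.cong refl) (simp add: m irreducibles_def algebra_simps)
    also have "(\<Sum>d\<in>{1..R}. \<Sum>e\<in>irreducibles d. d * of_bool (e = f))
        = (\<Sum>d\<in>{1..R}. d * of_bool (d = degree f))"
    proof (intro sum.cong refl)
      fix d
      have "(\<Sum>e\<in>irreducibles d. d * of_bool (e = f)) = (\<Sum>e\<in>irreducibles d. if e = f then d else 0)"
        by (intro sum.cong) auto
      also have "\<dots> = (if f \<in> irreducibles d then d else 0)"
        by simp
      also have "\<dots> = d * of_bool (d = degree f)" using f by (auto simp: irreducibles_def)
      finally show "(\<Sum>e\<in>irreducibles d. d * of_bool (e = f)) = d * of_bool (d = degree f)" .
    qed
    also have "\<dots> = (\<Sum>d\<in>{1..R}. if d = degree f then d else 0)" by (intro sum.cong) auto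
    also have "\<dots> = degree f" using df dh less.prems by simp
    finally show ?thesis using IH dh by simp
  qed
qed

lemma card_multiples:
  fixes g :: "bit poly"
  assumes "g \<noteq> 0" "degree g \<le> r"
  shows "card {h \<in> polys_of_degree r. g dvd h} = 2 ^ (r - degree g)"
proof -
  have "{h \<in> polys_of_degree r. g dvd h} = (*) g ` polys_of_degree (r - degree g)"
    using assms by (auto simp: polys_of_degree_def degree_mult_eq elim!: dvdE)
  then show ?thesis using assms
    by (simp add: card_image inj_on_def card_polys_of_degree)
qed

text \<open>Double counting of the pairs of \<open>h\<close> and \<open>j\<close> with
  \<open>f ^ j dvd h\<close>: such an \<open>h\<close> is determined by its cofactor, which has
  degree \<open>r - j * d\<close>.\<close>

lemma sum_mlt:
  assumes f: "irreducible f" "degree f = d"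
  shows "(\<Sum>h\<in>polys_of_degree r. mlt f h) = (\<Sum>j | j \<in> {1..r} \<and> j * d \<le> r. 2 ^ (r - j * d))"
proof -
  have d: "0 < d" using f irreducible_bit_poly_degree by blast
  have f0: "f \<noteq> 0" using f by (auto simp: irreducible_def)
  have deg: "degree (f ^ j) = j * d" for j using f f0 by (simp add: degree_power_eq)
  have "mlt f h = (\<Sum>j\<in>{1..r}. of_bool (f ^ j dvd h))" if h: "h \<in> polys_of_degree r" for h
  proof -
    have h0: "h \<noteq> 0" "degree h = r" using h by (auto simp: polys_of_degree_def)
    have "{j. 1 \<le> j \<and> f ^ j dvd h} = {1..r} \<inter> {j. f ^ j dvd h}"
      using power_dvd_bounded[of f h] d f h0 by auto
    then show ?thesis by (simp add: mlt_def)
  qed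
  then have "(\<Sum>h\<in>polys_of_degree r. mlt f h)
      = (\<Sum>j\<in>{1..r}. \<Sum>h\<in>polys_of_degree r. of_bool (f ^ j dvd h))"
    by (subst sum.swap) simp
  also have "\<dots> = (\<Sum>j\<in>{1..r}. if j * d \<le> r then 2 ^ (r - j * d) else 0)"
  proof (intro sum.cong refl)
    fix j
    have "(\<Sum>h\<in>polys_of_degree r. of_bool (f ^ j dvd h) :: nat) = card {h \<in> polys_of_degree r. f ^ j dvd h}"
      by (simp add: Int_def)
    also have "\<dots> = (if j * d \<le> r then 2 ^ (r - j * d) else 0 :: nat)"
    proof (cases "j * d \<le> r")
      case True
      then show ?thesis using card_multiples[of "f ^ j" r] f0 deg by simp
    next
      case False
      then have "{h \<in> polys_of_degree r. f ^ j dvd h} = {}"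
        using deg dvd_imp_degree_le[of "f ^ j"] by (auto simp: polys_of_degree_def)
      then show ?thesis using False by (simp only: card.empty) simp
    qed
    finally show "(\<Sum>h\<in>polys_of_degree r. of_bool (f ^ j dvd h) :: nat) = (if j * d \<le> r then 2 ^ (r - j * d) else 0)" .
  qed
  also have "\<dots> = (\<Sum>j | j \<in> {1..r} \<and> j * d \<le> r. 2 ^ (r - j * d))"
    by (subst sum.inter_filter[symmetric]) simp_all
  finally show ?thesis .
qed

text \<open>Dividing the total degree of all polynomials of degree \<open>r\<close> by \<open>2 ^ r\<close> yields a sum whose
  increment from \<open>r\<close> to \<open>r + 1\<close> consists of the powers of irreducibles of degree exactly \<open>r + 1\<close>.\<close>

definition weight_sum :: "nat \<Rightarrow> real" where
  "weight_sum r = (\<Sum>d\<in>{1..r}. real d * real (card (irreducibles d)) *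
     (\<Sum>j | j \<in> {1..r} \<and> j * d \<le> r. 1 / 2 ^ (j * d)))"

text \<open>The total degree of all polynomials of degree \<open>r\<close>, computed twice: directly
  it is \<open>r * 2 ^ r\<close>, by factorisation it is
  \<open>2 ^ r * weight_sum r\<close>.\<close>

lemma weight_sum: "weight_sum r = real r"
proof -
  have "r * 2 ^ r = (\<Sum>h\<in>polys_of_degree r. degree h)"
  proof -
    have "(\<Sum>h\<in>polys_of_degree r. degree h) = (\<Sum>h\<in>polys_of_degree r. r)"
      by (intro sum.cong refl) (simp add: polys_of_degree_def)
    then show ?thesis by (simp add: card_polys_of_degree)
  qed
  also have "\<dots> = (\<Sum>h\<in>polys_of_degree r. \<Sum>d\<in>{1..r}. \<Sum>f\<in>irreducibles d. d * mlt f h)"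
    by (intro sum.cong refl degree_eq_sum_mlt) (auto simp: polys_of_degree_def)
  also have "\<dots> = (\<Sum>d\<in>{1..r}. \<Sum>f\<in>irreducibles d. d * (\<Sum>h\<in>polys_of_degree r. mlt f h))"
    unfolding sum_distrib_left
    by (rule trans[OF sum.swap], rule sum.cong[OF refl], rule sum.swap)
  also have "\<dots> = (\<Sum>d\<in>{1..r}. d * card (irreducibles d) * (\<Sum>j | j \<in> {1..r} \<and> j * d \<le> r. 2 ^ (r - j * d)))"
  proof (intro sum.cong refl)
    fix d
    have "(\<Sum>f\<in>irreducibles d. d * (\<Sum>h\<in>polys_of_degree r. mlt f h))
      = (\<Sum>f\<in>irreducibles d. d * (\<Sum>j | j \<in> {1..r} \<and> j * d \<le> r. 2 ^ (r - j * d)))"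
      by (intro sum.cong refl arg_cong[of _ _ "(*) d"] sum_mlt) (auto simp: irreducibles_def)
    then show "(\<Sum>f\<in>irreducibles d. d * (\<Sum>h\<in>polys_of_degree r. mlt f h))
      = d * card (irreducibles d) * (\<Sum>j | j \<in> {1..r} \<and> j * d \<le> r. 2 ^ (r - j * d))" by simp
  qed
  finally have "real (r * 2 ^ r) = real \<dots>" by (rule arg_cong)
  also have "\<dots> = (\<Sum>d\<in>{1..r}. real d * real (card (irreducibles d)) *
     (\<Sum>j | j \<in> {1..r} \<and> j * d \<le> r. 2 ^ (r - j * d)))" by simp
  also have "\<dots> = (\<Sum>d\<in>{1..r}. real d * real (card (irreducibles d)) *
     (\<Sum>j | j \<in> {1..r} \<and> j * d \<le> r. 2 ^ r * (1 / 2 ^ (j * d))))"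
    by (intro sum.cong refl arg_cong2[of _ _ _ _ "(*)"]) (auto simp: power_diff)
  also have "\<dots> = 2 ^ r * weight_sum r"
    unfolding weight_sum_def by (simp add: sum_distrib_left mult_ac)
  finally show ?thesis by simp
qed

text \<open>Gauss's formula, obtained without constructing a finite field: \<open>weight_sum\<close>
  grows by 1 from \<open>m\<close> to \<open>r = Suc m\<close>, and the new terms are those with
  \<open>j * d = r\<close>, one for each divisor \<open>d\<close> and each with the power
  \<open>1 / 2 ^ r\<close>.\<close>

lemma sum_irreducibles:
  assumes "0 < r"
  shows "(\<Sum>d | d dvd r. d * card (irreducibles d)) = 2 ^ r"
proof -
  obtain m where r: "r = Suc m" using assms by (cases r) auto
  define g where "g d = real d * real (card (irreducibles d))" for d
  have split: "(\<Sum>j | j \<in> {1..r} \<and> j * d \<le> r. 1 / 2 ^ (j * d))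
      = (\<Sum>j | j \<in> {1..m} \<and> j * d \<le> m. 1 / 2 ^ (j * d)) + of_bool (d dvd r) / (2 ^ r :: real)"
    if d: "d \<in> {1..r}" for d
  proof -
    have "{j. j \<in> {1..r} \<and> j * d \<le> r} = {j. j \<in> {1..m} \<and> j * d \<le> m} \<union> {j. j * d = r}"
    proof (intro equalityI subsetI)
      fix j assume "j \<in> {j. j \<in> {1..r} \<and> j * d \<le> r}"
      then have j: "1 \<le> j" "j * d \<le> r" by auto
      moreover have "j * 1 \<le> j * d" using d by (intro mult_le_mono) auto
      then have "j \<le> j * d" by simp
      ultimately show "j \<in> {j. j \<in> {1..m} \<and> j * d \<le> m} \<union> {j. j * d = r}"
      proof (cases "j * d = r")
        case False
        with j r \<open>j \<le> j * d\<close> have "j * d \<le> m" "j \<le> m" by linarith+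
        with j show ?thesis by simp
      qed simp
    next
      fix j assume "j \<in> {j. j \<in> {1..m} \<and> j * d \<le> m} \<union> {j. j * d = r}"
      moreover have "j \<le> j * d" using d by simp
      moreover have "j * d = r \<Longrightarrow> 1 \<le> j" using r by (cases j) auto
      moreover have "j * 1 \<le> j * d" using d by (intro mult_le_mono) auto
      then have "j * d = r \<Longrightarrow> j \<le> r" by linarith
      ultimately show "j \<in> {j. j \<in> {1..r} \<and> j * d \<le> r}" using r by auto
    qed
    moreover have fin: "finite {j. j \<in> {1..m} \<and> j * d \<le> m}" by simp
    moreover have J: "{j. j * d = r} = (if d dvd r then {r div d} else {})"
    proof (cases "d dvd r")
      case True
      then obtain c where "r = d * c" by blast
      then show ?thesis using d by auto
    next
      case False
      then have "j * d \<noteq> r" for j by auto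
      then show ?thesis using False by auto
    qed
    moreover have "{j. j \<in> {1..m} \<and> j * d \<le> m} \<inter> {j. j * d = r} = {}" using r by auto
    ultimately have "(\<Sum>j | j \<in> {1..r} \<and> j * d \<le> r. 1 / 2 ^ (j * d))
      = (\<Sum>j | j \<in> {1..m} \<and> j * d \<le> m. 1 / 2 ^ (j * d)) + (\<Sum>j | j * d = r. 1 / (2 ^ (j * d) :: real))"
      by (simp only:) (rule sum.union_disjoint, simp_all)
    also have "(\<Sum>j | j * d = r. 1 / (2 ^ (j * d) :: real)) = of_bool (d dvd r) / 2 ^ r"
      unfolding J using d by auto
    finally show ?thesis .
  qed
  \<comment> \<open>\<open>weight_sum m\<close> ends at \<open>d = m\<close>; the extra summand for
    \<open>d = r\<close> has an empty inner sum.\<close>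
  have zero: "{j. j \<in> {1..m} \<and> j * r \<le> m} = {}"
  proof -
    have "\<not> j * r \<le> m" if "1 \<le> j" for j using mult_le_mono1[OF that, of r] r by simp
    then show ?thesis by auto
  qed
  have "weight_sum r = (\<Sum>d\<in>{1..r}. g d * ((\<Sum>j | j \<in> {1..m} \<and> j * d \<le> m. 1 / 2 ^ (j * d))
      + of_bool (d dvd r) / 2 ^ r))"
    unfolding weight_sum_def g_def by (intro sum.cong refl) (simp only: split)
  also have "\<dots> = (\<Sum>d\<in>{1..r}. g d * (\<Sum>j | j \<in> {1..m} \<and> j * d \<le> m. 1 / 2 ^ (j * d)))
      + (\<Sum>d\<in>{1..r}. g d * of_bool (d dvd r)) / 2 ^ r"
    by (simp only: distrib_left sum.distrib sum_divide_distrib times_divide_eq_right)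
  also have "(\<Sum>d\<in>{1..r}. g d * (\<Sum>j | j \<in> {1..m} \<and> j * d \<le> m. 1 / 2 ^ (j * d))) = weight_sum m"
  proof -
    have "{1..r} = insert r {1..m}" "r \<notin> {1..m}" using r by auto
    then show ?thesis unfolding weight_sum_def g_def[symmetric]
      by (simp only: simp_thms sum.insert finite_atLeastAtMost zero sum.empty mult_zero_right add_0_left)
  qed
  also have "(\<Sum>d\<in>{1..r}. g d * of_bool (d dvd r)) = (\<Sum>d | d dvd r. g d)"
    using assms by (intro sum.mono_neutral_cong_right) (auto dest: dvd_imp_le intro: Suc_leI gr0I)
  finally have "(\<Sum>d | d dvd r. g d) / 2 ^ r = real r - real m" unfolding weight_sum by simp
  also have "\<dots> = 1" using r by simp
  finally have "(\<Sum>d | d dvd r. g d) = 2 ^ r" by (simp only: divide_eq_1_iff)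
  then have "real (\<Sum>d | d dvd r. d * card (irreducibles d)) = real (2 ^ r)" by (simp add: g_def)
  then show ?thesis by (simp only: of_nat_eq_iff)
qed

text \<open>A proper divisor \<open>d\<close> of \<open>r\<close> is at most \<open>r div 2\<close>
  and contributes at most \<open>2 ^ d\<close> to Gauss's formula. Together these are at most
  \<open>2 ^ (r - 1)\<close>, so at least half of the sum is left for \<open>d = r\<close>.\<close>

lemma many_irreducibles:
  assumes "4 \<le> r"
  shows "2 ^ r \<le> 2 * r * card (irreducibles r)"
proof -
  define g where "g d = d * card (irreducibles d)" for d
  have up: "g d \<le> 2 ^ d" if "0 < d" for d
    using sum_irreducibles[OF that] member_le_sum[of d "{e. e dvd d}" g] that
    by (auto simp: g_def)
  have fin: "finite {d. d dvd r}" using assms by simp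
  have sub: "{d. d dvd r} - {r} \<subseteq> {1..r div 2}"
  proof
    fix d assume "d \<in> {d. d dvd r} - {r}"
    then obtain c where c: "r = d * c" "d \<noteq> r" by (auto elim: dvdE)
    have "c \<noteq> 0" "d \<noteq> 0" using c assms by (auto intro!: gr0I)
    moreover have "c \<noteq> 1" using c by auto
    ultimately have "2 \<le> c" by linarith
    then have "d * 2 \<le> r" using c by simp
    then show "d \<in> {1..r div 2}" using \<open>d \<noteq> 0\<close> by auto
  qed
  have "2 ^ r = (\<Sum>d | d dvd r. g d)" using sum_irreducibles[of r] assms by (simp add: g_def)
  also have "\<dots> = g r + sum g ({d. d dvd r} - {r})" using fin by (subst sum.remove[of _ r]) auto
  also have "sum g ({d. d dvd r} - {r}) \<le> sum g {1..r div 2}" using sub by (intro sum_mono2) auto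
  also have "\<dots> \<le> (\<Sum>d\<in>{1..r div 2}. 2 ^ d)" by (intro sum_mono up) auto
  also have "\<dots> \<le> (\<Sum>d<Suc (r div 2). 2 ^ d)" by (intro sum_mono2) auto
  also have "\<dots> \<le> 2 ^ Suc (r div 2)" using mask_eq_sum_exp_nat[of "Suc (r div 2)"]
    by (simp add: lessThan_def)
  also have "\<dots> \<le> 2 ^ (r - 1)" using assms by (intro power_increasing) auto
  finally have "2 ^ r \<le> g r + 2 ^ (r - 1)" by simp
  moreover have "(2::nat) ^ r = 2 * 2 ^ (r - 1)" using assms by (cases r) auto
  ultimately show ?thesis by (simp add: g_def)
qed

section \<open>Linear feedback shift registers\<close>

lemma bit_poly_of_top:
  assumes "2 ^ r \<le> (x::nat)" "x < 2 ^ Suc r" "r \<le> i"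
  shows "bit x i \<longleftrightarrow> i = r"
proof -
  have "x div 2 ^ r = 1" using assms by (simp add: div_nat_eqI)
  then have "bit x (r + j) = bit (1::nat) j" for j
    by (metis bit_drop_bit_eq comp_apply drop_bit_eq_div)
  from this[of "i - r"] show ?thesis using assms(3) by (auto simp: bit_Suc_0_iff)
qed

lemma less_power_of_bits:
  assumes "\<And>i. r \<le> i \<Longrightarrow> \<not> bit (x::nat) i"
  shows "x < 2 ^ r"
proof -
  have "take_bit r x = x"
    using assms by (intro bit_eqI) (auto simp: bit_take_bit_iff not_le[symmetric])
  then show ?thesis by (simp add: take_bit_nat_eq_self_iff)
qed

lemma not_bit_of_less: "(x::nat) < 2 ^ r \<Longrightarrow> r \<le> i \<Longrightarrow> \<not> bit x i"
  by (metis bit_take_bit_iff not_less take_bit_nat_eq_self)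

lemma xor_less_power: "(x::nat) < 2 ^ r \<Longrightarrow> y < 2 ^ r \<Longrightarrow> x XOR y < 2 ^ r"
  by (rule less_power_of_bits) (simp add: bit_xor_iff not_bit_of_less)

lemma xor_eq_0_iff: "(x :: nat) XOR y = 0 \<longleftrightarrow> x = y"
proof
  assume "x XOR y = 0"
  then have "(x XOR y) XOR y = y" by simp
  then show "x = y" by (simp add: xor.assoc)
qed simp

text \<open>Multiplication by the indeterminate modulo the polynomial \<open>f\<close> of degree
  \<open>r\<close>, for \<open>W = 2 ^ r\<close>: the test tells whether the product has reached
  degree \<open>r\<close> and must be reduced.\<close>

definition lfsr_step :: "nat \<Rightarrow> nat \<Rightarrow> nat \<Rightarrow> nat" where
  "lfsr_step W f y = (if W \<le> 2 * y then (2 * y) XOR f else 2 * y)"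

definition lfsr :: "nat \<Rightarrow> nat \<Rightarrow> nat \<Rightarrow> nat \<Rightarrow> nat" where
  "lfsr W f i y = (lfsr_step W f ^^ i) y"

lemma lfsr_0 [simp]: "lfsr W f 0 y = y"
  by (simp add: lfsr_def)

lemma lfsr_Suc: "lfsr W f (Suc i) y = lfsr_step W f (lfsr W f i y)"
  by (simp add: lfsr_def)

lemma lfsr_step_less:
  assumes "W = 2 ^ r" "W \<le> f" "f < 2 * W" "y < W"
  shows "lfsr_step W f y < W"
proof (cases "W \<le> 2 * y")
  case True
  have "2 * y < 2 ^ Suc r" "f < 2 ^ Suc r" using assms by auto
  then have "2 * y XOR f < 2 ^ r"
    using True assms by (intro less_power_of_bits) (simp add: bit_xor_iff bit_poly_of_top)
  then show ?thesis using True assms by (simp add: lfsr_step_def)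
qed (simp add: lfsr_step_def)

lemma lfsr_less:
  assumes "W = 2 ^ r" "W \<le> f" "f < 2 * W" "y < W"
  shows "lfsr W f i y < W"
  by (induction i) (simp_all add: assms(4) lfsr_Suc lfsr_step_less[OF assms(1,2,3)])

lemma bpoly_lfsr_step: "bpoly f dvd bpoly (lfsr_step W f y) + pCons 0 (bpoly y)"
proof -
  have "pCons 0 (bpoly y) + bpoly f + pCons 0 (bpoly y) = bpoly f + (pCons 0 (bpoly y) + pCons 0 (bpoly y))"
    by (simp only: add_ac)
  then show ?thesis
    by (simp only: lfsr_step_def bpoly_xor bpoly_double bit_poly_add_self split: if_splits) simp
qed

lemma pCons_0_mult: "pCons 0 q = [:0, 1:] * (q :: bit poly)"
  by simp

text \<open>In characteristic two a sum is a difference, so divisibility of a sum expresses a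
  congruence: after \<open>i\<close> steps the register holds \<open>y\<close> times the
  \<open>i\<close>-th power of the indeterminate, modulo \<open>f\<close>.\<close>

lemma bpoly_lfsr: "bpoly f dvd bpoly (lfsr W f i y) + monom 1 i * bpoly y"
proof (induction i)
  case (Suc i)
  have "bpoly f dvd pCons 0 (bpoly (lfsr W f i y) + monom 1 i * bpoly y)"
    by (subst pCons_0_mult) (rule dvd_mult[OF Suc])
  also have "pCons 0 (bpoly (lfsr W f i y) + monom 1 i * bpoly y)
      = pCons 0 (bpoly (lfsr W f i y)) + monom 1 (Suc i) * bpoly y"
    by (simp add: monom_Suc)
  finally have "bpoly f dvd pCons 0 (bpoly (lfsr W f i y)) + monom 1 (Suc i) * bpoly y" .
  from dvd_add[OF bpoly_lfsr_step[of f W "lfsr W f i y"] this]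
  have "bpoly f dvd bpoly (lfsr W f (Suc i) y) + (pCons 0 (bpoly (lfsr W f i y))
     + pCons 0 (bpoly (lfsr W f i y))) + monom 1 (Suc i) * bpoly y"
    by (simp only: lfsr_Suc add.assoc)
  then show ?case by (simp only: bit_poly_add_self add_0_right)
qed simp

section \<open>Joint distribution of the output bits over all initial states\<close>

locale lfsr_irreducible =
  fixes W r f :: nat
  assumes W: "W = 2 ^ r" and f: "W \<le> f" "f < 2 * W" and irr: "irreducible (bpoly f)"
begin

lemma degree_f: "degree (bpoly f) = r"
proof -
  have "f \<noteq> 0" using W f by (metis le_zero_eq power_eq_0_iff zero_neq_numeral)
  then show ?thesis using degree_bpoly_eq[of f r] W f by simp
qed

lemma prime_f: "prime_elem (bpoly f)"
  using irr by (rule field_poly_irreducible_imp_prime)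

lemma dvd_bpoly_less: "y < W \<Longrightarrow> bpoly f dvd bpoly y \<Longrightarrow> y = 0"
proof (rule ccontr)
  assume y: "y < W" "bpoly f dvd bpoly y" "y \<noteq> 0"
  then have "degree (bpoly f) \<le> degree (bpoly y)" by (intro dvd_imp_degree_le) simp_all
  then show False using y degree_bpoly[of y r] W degree_f by simp
qed

lemma congruent_eq:
  assumes "x < W" "y < W" "bpoly f dvd bpoly x + bpoly y"
  shows "x = y"
proof -
  have "x XOR y = 0"
    using assms W by (intro dvd_bpoly_less) (simp_all add: xor_less_power bpoly_xor)
  then show ?thesis by (simp only: xor_eq_0_iff)
qed

text \<open>Both sides are reduced and congruent to the same product modulo \<open>f\<close>, hence
  equal.\<close>

lemma lfsr_xor:
  assumes "x < W" "y < W"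
  shows "lfsr W f i (x XOR y) = lfsr W f i x XOR lfsr W f i y"
proof (rule congruent_eq)
  show "lfsr W f i (x XOR y) < W" "lfsr W f i x XOR lfsr W f i y < W"
    using assms W f lfsr_less[OF W f] xor_less_power by auto
  have "bpoly f dvd (bpoly (lfsr W f i x) + monom 1 i * bpoly x)
      + (bpoly (lfsr W f i y) + monom 1 i * bpoly y)
      + (bpoly (lfsr W f i (x XOR y)) + monom 1 i * bpoly (x XOR y))"
    by (intro dvd_add bpoly_lfsr)
  also have "\<dots> = bpoly (lfsr W f i (x XOR y)) + bpoly (lfsr W f i x XOR lfsr W f i y)
    + (monom 1 i * bpoly x + monom 1 i * bpoly x) + (monom 1 i * bpoly y + monom 1 i * bpoly y)"
    by (simp only: bpoly_xor distrib_left add_ac)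
  finally show "bpoly f dvd bpoly (lfsr W f i (x XOR y)) + bpoly (lfsr W f i x XOR lfsr W f i y)"
    by (simp only: bit_poly_add_self add_0_right)
qed

text \<open>The output bit is the constant coefficient of the register. Written as a sign, it is a
  character of the group of states under exclusive or.\<close>

definition sgn_bit :: "nat \<Rightarrow> nat \<Rightarrow> int" where
  "sgn_bit i y = (if odd (lfsr W f i y) then - 1 else 1)"

lemma sgn_bit_xor: "x < W \<Longrightarrow> y < W \<Longrightarrow> sgn_bit i (x XOR y) = sgn_bit i x * sgn_bit i y"
  by (auto simp: sgn_bit_def lfsr_xor even_xor_iff)

lemma sum_congruent:
  assumes "finite J"
  shows "bpoly f dvd (\<Sum>i\<in>J. bpoly (lfsr W f i y)) + (\<Sum>i\<in>J. monom 1 i) * bpoly y"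
proof -
  have "bpoly f dvd (\<Sum>i\<in>J. bpoly (lfsr W f i y) + monom 1 i * bpoly y)"
    by (intro dvd_sum bpoly_lfsr)
  then show ?thesis by (simp add: sum.distrib sum_distrib_right)
qed

lemma sum_bpoly_xor: "finite J \<Longrightarrow> (\<And>i. i \<in> J \<Longrightarrow> g i < W) \<Longrightarrow> \<exists>x<W. (\<Sum>i\<in>J. bpoly (g i)) = bpoly x"
proof (induction J rule: finite_induct)
  case empty
  then show ?case using W by (intro exI[of _ 0]) simp
next
  case (insert i J)
  then obtain x where "x < W" "(\<Sum>i\<in>J. bpoly (g i)) = bpoly x" by auto
  then show ?case using insert W
    by (intro exI[of _ "g i XOR x"]) (simp add: bpoly_xor xor_less_power)
qed

text \<open>On residues modulo \<open>f\<close>, multiplication by the sum of the monomials in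
  \<open>J\<close> is injective because \<open>f\<close> is prime and does not divide that sum. On a
  finite set it is therefore onto and attains \<open>1\<close>, and at such a state the product of
  the signs over \<open>J\<close> is \<open>- 1\<close>.\<close>

lemma exists_state:
  assumes J: "finite J" and nd: "\<not> bpoly f dvd (\<Sum>i\<in>J. monom 1 i)"
  shows "\<exists>y<W. (\<Sum>i\<in>J. bpoly (lfsr W f i y)) = 1"
proof -
  \<comment> \<open>\<open>T y\<close> is the word representing \<open>y\<close> times the sum of
    monomials, reduced modulo \<open>f\<close>.\<close>
  define T where "T y = (THE x. bpoly x = (\<Sum>i\<in>J. bpoly (lfsr W f i y)))" for y
  have T: "T y < W \<and> bpoly (T y) = (\<Sum>i\<in>J. bpoly (lfsr W f i y))" if y: "y < W" for y
  proof -
    obtain x where x: "x < W" "(\<Sum>i\<in>J. bpoly (lfsr W f i y)) = bpoly x"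
      using sum_bpoly_xor[OF J, of "\<lambda>i. lfsr W f i y"] lfsr_less[OF W f y] by auto
    then have "T y = x" unfolding T_def by (intro the_equality) (simp_all add: bpoly_eq_iff)
    with x show ?thesis by simp
  qed
  have "inj_on T {..<W}"
  proof (rule inj_onI)
    fix x y assume xy: "x \<in> {..<W}" "y \<in> {..<W}" "T x = T y"
    let ?g = "\<Sum>i\<in>J. monom (1::bit) i"
    have Tx: "(\<Sum>i\<in>J. bpoly (lfsr W f i x)) = bpoly (T x)"
      and Ty: "(\<Sum>i\<in>J. bpoly (lfsr W f i y)) = bpoly (T y)"
      using T[of x] T[of y] xy by auto
    have "bpoly f dvd ((\<Sum>i\<in>J. bpoly (lfsr W f i x)) + ?g * bpoly x)
        + ((\<Sum>i\<in>J. bpoly (lfsr W f i y)) + ?g * bpoly y)"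
      by (intro dvd_add sum_congruent J)
    also have "\<dots> = (bpoly (T x) + bpoly (T y)) + ?g * (bpoly x + bpoly y)"
      by (simp only: Tx Ty distrib_left add_ac)
    also have "bpoly (T x) + bpoly (T y) = 0" unfolding xy(3) by (rule bit_poly_add_self)
    finally have "bpoly f dvd ?g * (bpoly x + bpoly y)" by simp
    then have "bpoly f dvd bpoly x + bpoly y" using nd prime_f prime_elem_dvd_multD by blast
    then show "x = y" using xy congruent_eq by simp
  qed
  moreover have "T ` {..<W} \<subseteq> {..<W}" using T by auto
  ultimately have "T ` {..<W} = {..<W}" by (intro endo_inj_surj) auto
  moreover have "1 < W"
  proof -
    have "0 < r" using irreducible_bit_poly_degree[OF irr] degree_f by simp
    then show ?thesis using W one_less_power[of "2::nat" r] by simp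
  qed
  ultimately obtain y where "y < W" "T y = 1" by (metis imageE lessThan_iff)
  then show ?thesis using T[of y] by (auto intro!: exI[of _ y])
qed

lemma prod_sgn_bit:
  assumes "finite J"
  shows "(\<Prod>i\<in>J. sgn_bit i y) = (if coeff (\<Sum>i\<in>J. bpoly (lfsr W f i y)) 0 = 1 then - 1 else 1)"
  using assms
proof (induction J rule: finite_induct)
  case (insert j J)
  have b: "a + b = 1 \<longleftrightarrow> (a = 1) \<noteq> (b = 1)" for a b :: bit
    by (cases a; cases b) simp_all
  show ?case using insert
    by (auto simp: b coeff_bpoly sgn_bit_def bit_0)
qed simp

text \<open>Adding to every state a fixed state at which the product of the signs is \<open>- 1\<close> negates the sum.\<close>

lemma sum_prod_sgn_bit:
  assumes J: "finite J" and nd: "\<not> bpoly f dvd (\<Sum>i\<in>J. monom 1 i)"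
  shows "(\<Sum>y<W. \<Prod>i\<in>J. sgn_bit i y) = 0"
proof -
  obtain z where z: "z < W" "(\<Sum>i\<in>J. bpoly (lfsr W f i z)) = 1"
    using exists_state[OF assms] by blast
  have zz: "(y XOR z) XOR z = y" for y by (simp add: xor.assoc)
  have lt: "y < W \<Longrightarrow> y XOR z < W" for y using z W by (simp add: xor_less_power)
  have "(\<Sum>y<W. \<Prod>i\<in>J. sgn_bit i y) = (\<Sum>y<W. \<Prod>i\<in>J. sgn_bit i (y XOR z))"
    by (rule sum.reindex_bij_witness[of _ "\<lambda>y. y XOR z" "\<lambda>y. y XOR z"]) (use lt zz in auto)
  also have "\<dots> = (\<Sum>y<W. (\<Prod>i\<in>J. sgn_bit i y) * (\<Prod>i\<in>J. sgn_bit i z))"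
    using z by (intro sum.cong refl) (simp add: sgn_bit_xor prod.distrib)
  also have "\<dots> = - (\<Sum>y<W. \<Prod>i\<in>J. sgn_bit i y)"
    unfolding prod_sgn_bit[OF J, of z] z(2) by (simp add: sum_negf)
  finally show ?thesis by simp
qed

text \<open>Fourier expansion: the product of \<open>sgn_bit i y * e i + 1\<close> over
  \<open>I\<close> is \<open>2 ^ card I\<close> at the states that produce the prescribed bits and 0
  at all others. Expanded over the subsets \<open>J\<close> of \<open>I\<close> and summed over
  \<open>y\<close>, only the term of \<open>J = {}\<close> survives.\<close>

lemma lfsr_bits_uniform:
  assumes I: "finite I"
    and nd: "\<And>J. J \<subseteq> I \<Longrightarrow> J \<noteq> {} \<Longrightarrow> \<not> bpoly f dvd (\<Sum>i\<in>J. monom 1 i)"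
  shows "2 ^ card I * card {y. y < W \<and> (\<forall>i\<in>I. odd (lfsr W f i y) = b i)} = W"
proof -
  define e :: "nat \<Rightarrow> int" where "e i = (if b i then - 1 else 1)" for i
  let ?A = "{y. y < W \<and> (\<forall>i\<in>I. odd (lfsr W f i y) = b i)}"
  have "(\<Sum>y<W. \<Prod>i\<in>I. sgn_bit i y * e i + 1) = (\<Sum>y<W. if y \<in> ?A then 2 ^ card I else 0)"
  proof (intro sum.cong refl)
    fix y assume y: "y \<in> {..<W}"
    show "(\<Prod>i\<in>I. sgn_bit i y * e i + 1) = (if y \<in> ?A then 2 ^ card I else 0)"
    proof (cases "y \<in> ?A")
      case True
      then have "(\<Prod>i\<in>I. sgn_bit i y * e i + 1) = (\<Prod>i\<in>I. 2)"
        by (intro prod.cong) (auto simp: sgn_bit_def e_def)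
      then show ?thesis using True by simp
    next
      case False
      then obtain i where "i \<in> I" "odd (lfsr W f i y) \<noteq> b i" using y by auto
      then have "\<exists>i\<in>I. sgn_bit i y * e i + 1 = 0"
        by (intro bexI[of _ i]) (auto simp: sgn_bit_def e_def)
      then show ?thesis using False I by (simp add: prod_zero)
    qed
  qed
  also have "\<dots> = (\<Sum>y\<in>?A. 2 ^ card I)"
    by (intro sum.mono_neutral_cong_right) auto
  finally have 1: "(\<Sum>y<W. \<Prod>i\<in>I. sgn_bit i y * e i + 1) = 2 ^ card I * int (card ?A)"
    by (simp add: mult.commute)
  have "(\<Sum>y<W. \<Prod>i\<in>I. sgn_bit i y * e i + 1)
      = (\<Sum>y<W. \<Sum>J\<in>Pow I. (\<Prod>i\<in>J. sgn_bit i y) * (\<Prod>i\<in>J. e i))"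
    by (intro sum.cong refl) (simp add: prod_add[OF I] prod.distrib)
  also have "\<dots> = (\<Sum>J\<in>Pow I. (\<Prod>i\<in>J. e i) * (\<Sum>y<W. \<Prod>i\<in>J. sgn_bit i y))"
    by (subst sum.swap) (simp add: sum_distrib_left mult.commute)
  also have "\<dots> = (\<Sum>J\<in>Pow I. if J = {} then int W else 0)"
  proof (intro sum.cong refl)
    fix J assume J: "J \<in> Pow I"
    show "(\<Prod>i\<in>J. e i) * (\<Sum>y<W. \<Prod>i\<in>J. sgn_bit i y) = (if J = {} then int W else 0)"
      using J sum_prod_sgn_bit[of J] nd[of J] finite_subset[of J I] I by auto
  qed
  also have "\<dots> = int W" using I by simp
  finally have "int (2 ^ card I * card ?A) = int W" using 1 by simp
  then show ?thesis by (simp only: of_nat_eq_iff)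
qed

end

section \<open>Irreducible polynomials that are degenerate on given positions\<close>

lemma prime_elem_dvd_prod:
  assumes pf: "prime_elem f" and "finite G" "f dvd \<Prod>G"
  shows "\<exists>e\<in>G. f dvd (e :: bit poly)"
  using assms(2,3)
proof (induction G rule: finite_induct)
  case empty
  then have "f dvd 1" by (simp only: prod.empty)
  then show ?case using pf unfolding prime_elem_def by blast
next
  case (insert e G)
  then have "f dvd e * \<Prod>G" by simp
  then show ?case using insert.IH prime_elem_dvd_multD[OF pf] by blast
qed

lemma prod_irreducibles_dvd:
  assumes "finite G" "\<And>f. f \<in> G \<Longrightarrow> irreducible f \<and> f dvd (g :: bit poly)"
  shows "\<Prod>G dvd g"
  using assms
proof (induction G rule: finite_induct)
  case (insert f G)
  then obtain c where c: "g = \<Prod>G * c" by (metis dvdE insertCI)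
  have pf: "prime_elem f" using insert.prems by (intro field_poly_irreducible_imp_prime) auto
  have "\<not> f dvd \<Prod>G"
  proof
    assume "f dvd \<Prod>G"
    then have "\<exists>e\<in>G. f dvd e" using insert(1) prime_elem_dvd_prod[OF pf] by blast
    then obtain e where e: "e \<in> G" "f dvd e" by blast
    then obtain a where a: "e = f * a" by blast
    have "irreducible e" using insert.prems e by blast
    then have "is_unit f \<or> is_unit a" using a by (rule irreducibleD)
    then have "is_unit a" using pf unfolding prime_elem_def by blast
    then have "e = f" using a by (simp add: bit_poly_is_unit)
    then show False using e insert by simp
  qed
  moreover have "f dvd \<Prod>G * c" using c insert.prems by auto
  ultimately have "f dvd c" using pf prime_elem_dvd_multD by blast
  then show ?case using c insert by (simp add: mult_dvd_mono mult.commute)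
qed simp

lemma few_irreducible_divisors:
  assumes g: "g \<noteq> 0" "degree g < D"
  shows "r * card {f \<in> irreducibles r. f dvd g} \<le> D"
proof -
  let ?G = "{f \<in> irreducibles r. f dvd g}"
  have fin: "finite ?G" by simp
  have "\<Prod>?G dvd g" using fin by (rule prod_irreducibles_dvd) (simp add: irreducibles_def)
  then have "degree (\<Prod>?G) \<le> degree g" using g dvd_imp_degree_le by blast
  moreover have "degree (\<Prod>?G) = (\<Sum>f\<in>?G. degree f)"
    using fin by (intro degree_prod_eq_sum_degree) (auto simp: irreducibles_def)
  moreover have "\<dots> = (\<Sum>f\<in>?G. r)" by (intro sum.cong) (auto simp: irreducibles_def)
  ultimately show ?thesis using g by (simp add: mult.commute)
qed

text \<open>Union bound over the nonempty subsets \<open>J\<close>: each gives a nonzero polynomial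
  of degree below \<open>D\<close>, whose distinct irreducible divisors of degree \<open>r\<close>
  have total degree at most \<open>D\<close>.\<close>

lemma few_degenerate_irreducibles:
  assumes I: "I \<subseteq> {..<D}"
  shows "r * card {f \<in> irreducibles r. \<exists>J\<subseteq>I. J \<noteq> {} \<and> f dvd (\<Sum>i\<in>J. monom 1 i)} \<le> 2 ^ card I * D"
proof -
  have fin: "finite I" using I finite_subset by blast
  have "{f \<in> irreducibles r. \<exists>J\<subseteq>I. J \<noteq> {} \<and> f dvd (\<Sum>i\<in>J. monom 1 i)}
      = (\<Union>J\<in>Pow I - {{}}. {f \<in> irreducibles r. f dvd (\<Sum>i\<in>J. monom 1 i)})" by blast
  also have "card \<dots> \<le> (\<Sum>J\<in>Pow I - {{}}. card {f \<in> irreducibles r. f dvd (\<Sum>i\<in>J. monom 1 i)})"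
    using fin by (intro card_UN_le) auto
  finally have "r * card {f \<in> irreducibles r. \<exists>J\<subseteq>I. J \<noteq> {} \<and> f dvd (\<Sum>i\<in>J. monom 1 i)}
      \<le> (\<Sum>J\<in>Pow I - {{}}. r * card {f \<in> irreducibles r. f dvd (\<Sum>i\<in>J. monom 1 i)})"
    by (simp flip: sum_distrib_left)
  also have "\<dots> \<le> (\<Sum>J\<in>Pow I - {{}}. D)"
  proof (rule sum_mono)
    fix J assume J: "J \<in> Pow I - {{}}"
    then have fJ: "finite J" using fin finite_subset by auto
    have c: "coeff (\<Sum>i\<in>J. monom (1::bit) i) j = of_bool (j \<in> J)" for j
      using fJ by (simp add: coeff_sum)
    obtain j where "j \<in> J" using J by auto
    then have "coeff (\<Sum>i\<in>J. monom (1::bit) i) j \<noteq> coeff 0 j" unfolding c by simp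
    then have "(\<Sum>i\<in>J. monom (1::bit) i) \<noteq> 0" by metis
    moreover have "degree (\<Sum>i\<in>J. monom (1::bit) i) < D"
    proof -
      have "D \<noteq> 0" using J I by auto
      moreover have "degree (\<Sum>i\<in>J. monom (1::bit) i) \<le> D - 1"
        using J I by (intro degree_le) (auto simp: c)
      ultimately show ?thesis by simp
    qed
    ultimately show "r * card {f \<in> irreducibles r. f dvd (\<Sum>i\<in>J. monom 1 i)} \<le> D"
      by (rule few_irreducible_divisors)
  qed
  also have "\<dots> = card (Pow I - {{}}) * D" by simp
  also have "\<dots> \<le> 2 ^ card I * D"
    using card_Diff1_le[of "Pow I" "{}"] fin by (intro mult_le_mono) (auto simp: card_Pow)
  finally show ?thesis .
qed

section \<open>Splitting colourings\<close>

lemma splits_cong: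
  assumes "\<And>x. x \<in> S \<Longrightarrow> g x = h x"
  shows "splits k l g S \<longleftrightarrow> splits k l h S"
proof -
  have "g -` {j} \<inter> S = h -` {j} \<inter> S" for j using assms by auto
  then show ?thesis by (simp add: splits_def)
qed

text \<open>Counted are assignments of words below \<open>B\<close>, which will be uniform, rather
  than of colours, which are not unless \<open>l\<close> divides \<open>B\<close>.\<close>

definition split_patterns :: "nat \<Rightarrow> nat \<Rightarrow> nat \<Rightarrow> nat set \<Rightarrow> (nat \<Rightarrow> nat) set" where
  "split_patterns k l B S = {u \<in> S \<rightarrow>\<^sub>E {..<B}. splits k l (\<lambda>x. u x mod l + 1) S}"

lemma finite_split_patterns: "finite S \<Longrightarrow> finite (split_patterns k l B S)"
  unfolding split_patterns_def by (rule finite_subset[of _ "S \<rightarrow>\<^sub>E {..<B}"]) (auto intro: finite_PiE)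

lemma card_split_patterns_le_power:
  "finite S \<Longrightarrow> card (split_patterns k l B S) \<le> B ^ card S"
proof -
  assume S: "finite S"
  have "card (split_patterns k l B S) \<le> card (S \<rightarrow>\<^sub>E {..<B})"
    unfolding split_patterns_def using S by (intro card_mono finite_PiE) auto
  then show ?thesis using S by (simp add: card_PiE)
qed

text \<open>Splitting is invariant under bijections of the domain, so patterns can be pulled back
  along \<open>g\<close>. Used in both directions, this makes their number depend on
  \<open>card S\<close> only.\<close>

lemma card_split_patterns_mono:
  assumes S: "finite S" "finite S'" "card S = card S'"
  shows "card (split_patterns k l B S') \<le> card (split_patterns k l B S)"
proof -
  obtain g where g: "bij_betw g S S'" using S finite_same_card_bij by blast
  have inS': "g x \<in> S'" if "x \<in> S" for x using g that by (auto simp: bij_betw_def)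
  have sur: "\<exists>x\<in>S. y = g x" if "y \<in> S'" for y using g that by (auto simp: bij_betw_def)
  let ?F = "\<lambda>u. restrict (u \<circ> g) S"
  have "inj_on ?F (split_patterns k l B S')"
  proof (rule inj_onI)
    fix u v assume uv: "u \<in> split_patterns k l B S'" "v \<in> split_patterns k l B S'" "?F u = ?F v"
    have "u y = v y" if y: "y \<in> S'" for y
    proof -
      obtain x where "x \<in> S" "y = g x" using sur[OF y] by blast
      then show ?thesis using fun_cong[OF uv(3), of x] by simp
    qed
    then show "u = v" using uv by (intro PiE_ext[of u S' "\<lambda>_. {..<B}" v]) (auto simp: split_patterns_def)
  qed
  moreover have "?F ` split_patterns k l B S' \<subseteq> split_patterns k l B S"
  proof clarify
    fix u assume u: "u \<in> split_patterns k l B S'"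
    have c: "card ((\<lambda>x. u (g x) mod l + 1) -` {j} \<inter> S) = card ((\<lambda>x. u x mod l + 1) -` {j} \<inter> S')" for j
    proof -
      have "bij_betw g ((\<lambda>x. u (g x) mod l + 1) -` {j} \<inter> S) ((\<lambda>x. u x mod l + 1) -` {j} \<inter> S')"
        using g by (auto simp: bij_betw_def inj_on_def)
      then show ?thesis by (rule bij_betw_same_card)
    qed
    have "splits k l (\<lambda>x. u (g x) mod l + 1) S"
      using u c by (simp add: split_patterns_def splits_def)
    then have "splits k l (\<lambda>x. ?F u x mod l + 1) S"
      by (subst splits_cong[where h = "\<lambda>x. u (g x) mod l + 1"]) auto
    then show "?F u \<in> split_patterns k l B S"
      using u inS' by (auto simp: split_patterns_def)
  qed
  ultimately show ?thesis using S finite_split_patterns by (intro card_inj_on_le[of ?F]) auto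
qed

lemma card_residue_class:
  assumes "j < l"
  shows "card {i. i < k \<and> i mod l = j} = k div l + of_bool (j < k mod l)"
proof (induction k)
  case (Suc k)
  have "{i. i < Suc k \<and> i mod l = j} = {i. i < k \<and> i mod l = j} \<union> (if k mod l = j then {k} else {})"
    by (auto simp: less_Suc_eq)
  then have "card {i. i < Suc k \<and> i mod l = j} = card {i. i < k \<and> i mod l = j} + of_bool (k mod l = j)"
    by simp
  also have "\<dots> = Suc k div l + of_bool (j < Suc k mod l)"
    using Suc assms by (auto simp: div_Suc mod_Suc)
  finally show ?case .
qed simp

text \<open>Reduction of \<open>0, ..., k - 1\<close> modulo \<open>l\<close> is a witness: the
  residues below \<open>k mod l\<close> occur once more often than the others.\<close>

lemma exists_split_pattern:
  assumes "0 < l" "l \<le> B"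
  shows "split_patterns k l B {..<k} \<noteq> {}"
proof -
  let ?u = "\<lambda>i\<in>{..<k}. i mod l"
  have "splits k l (\<lambda>x. ?u x mod l + 1) {..<k}"
    unfolding splits_def
  proof
    fix j assume j: "j \<in> {1..l}"
    then obtain j' where j': "j = Suc j'" "j' < l" by (cases j) auto
    have "(\<lambda>x. ?u x mod l + 1) -` {j} \<inter> {..<k} = {i. i < k \<and> i mod l = j'}"
      unfolding j'(1) by auto
    then have "card ((\<lambda>x. ?u x mod l + 1) -` {j} \<inter> {..<k}) = k div l + of_bool (j \<le> k mod l)"
      using card_residue_class[OF j'(2), of k] j'(1) by (simp add: Suc_le_eq)
    moreover have "\<lfloor>real k / real l\<rfloor> = int (k div l)" by (simp add: floor_divide_of_nat_eq)
    \<comment> \<open>The ceiling matters only for \<open>1 \<le> j \<le> k mod l\<close>; then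
      \<open>l\<close> does not divide \<open>k\<close>, and the ceiling is the floor plus
      1.\<close>
    moreover have "\<lceil>real k / real l\<rceil> = int (k div l) + 1" if "j \<le> k mod l"
    proof (rule ceiling_unique)
      have k: "real k = real l * real (k div l) + real (k mod l)"
        by (metis mult_div_mod_eq of_nat_add of_nat_mult)
      have "0 < k mod l" "k mod l < l" using that j assms by auto
      then show "of_int (int (k div l) + 1) - 1 < real k / real l"
        "real k / real l \<le> of_int (int (k div l) + 1)"
        using assms unfolding k by (simp_all add: field_simps)
    qed
    ultimately show "int (card ((\<lambda>x. ?u x mod l + 1) -` {j} \<inter> {..<k}))
        = (if j \<le> k mod l then \<lceil>real k / real l\<rceil> else \<lfloor>real k / real l\<rfloor>)" by simp
  qed
  moreover have "?u \<in> {..<k} \<rightarrow>\<^sub>E {..<B}" using assms by (auto intro: order_less_le_trans[of _ l])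
  ultimately have "?u \<in> split_patterns k l B {..<k}" by (simp add: split_patterns_def)
  then show ?thesis by blast
qed

definition pattern_count :: "nat \<Rightarrow> nat \<Rightarrow> nat \<Rightarrow> nat" where
  "pattern_count k l B = card (split_patterns k l B {..<k})"

lemma card_split_patterns: "finite S \<Longrightarrow> card S = k \<Longrightarrow> card (split_patterns k l B S) = pattern_count k l B"
  unfolding pattern_count_def by (intro antisym card_split_patterns_mono) auto

lemma pattern_count_pos: "0 < l \<Longrightarrow> l \<le> B \<Longrightarrow> 0 < pattern_count k l B"
  unfolding pattern_count_def using exists_split_pattern finite_split_patterns by (simp add: card_gt_0_iff)

lemma pattern_count_le: "pattern_count k l B \<le> B ^ k"
  unfolding pattern_count_def using card_split_patterns_le_power[of "{..<k}" k l B] by simp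

section \<open>Colours from shift register bits\<close>

text \<open>The bit read first becomes the most significant one; this is the origin of the index
  \<open>\<beta> - 1 - t\<close> below.\<close>

fun bits_val :: "(nat \<Rightarrow> bool) \<Rightarrow> nat \<Rightarrow> nat" where
  "bits_val b 0 = 0"
| "bits_val b (Suc t) = 2 * bits_val b t + of_bool (b t)"

lemma bits_val_less: "bits_val b t < 2 ^ t"
  by (induction t) (auto split: if_splits)

lemma bits_val_eq_iff: "u < 2 ^ \<beta> \<Longrightarrow> bits_val b \<beta> = u \<longleftrightarrow> (\<forall>t<\<beta>. b t \<longleftrightarrow> bit u (\<beta> - 1 - t))"
proof (induction \<beta> arbitrary: u)
  case (Suc \<beta>)
  have "bits_val b (Suc \<beta>) = u \<longleftrightarrow> bits_val b \<beta> = u div 2 \<and> b \<beta> = odd u"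
    by (auto simp: of_bool_def split: if_splits)
  also have "\<dots> \<longleftrightarrow> (\<forall>t<\<beta>. b t \<longleftrightarrow> bit (u div 2) (\<beta> - 1 - t)) \<and> b \<beta> = odd u"
    using Suc by auto
  also have "\<dots> \<longleftrightarrow> (\<forall>t<Suc \<beta>. b t \<longleftrightarrow> bit u (Suc \<beta> - 1 - t))"
    by (auto simp: less_Suc_eq bit_0 bit_Suc[symmetric] Suc_diff_Suc)
  finally show ?case .
qed simp

definition lfsr_word :: "nat \<Rightarrow> nat \<Rightarrow> nat \<Rightarrow> nat \<Rightarrow> nat \<Rightarrow> nat" where
  "lfsr_word W f y \<beta> v = bits_val (\<lambda>t. odd (lfsr W f (v * \<beta> + t) y)) \<beta>"

definition lfsr_colour :: "nat \<Rightarrow> nat \<Rightarrow> nat \<Rightarrow> nat \<Rightarrow> nat \<Rightarrow> nat \<Rightarrow> nat" where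
  "lfsr_colour W f y \<beta> l v = lfsr_word W f y \<beta> v mod l + 1"

text \<open>The positions in the register sequence that are read by the points of \<open>V\<close>.
  Different points read disjoint intervals of length \<open>\<beta>\<close>.\<close>

definition window :: "nat \<Rightarrow> nat set \<Rightarrow> nat set" where
  "window \<beta> V = (\<lambda>(v, t). v * \<beta> + t) ` (V \<times> {..<\<beta>})"

lemma card_window: "0 < \<beta> \<Longrightarrow> card (window \<beta> V) = card V * \<beta>"
proof -
  assume b: "0 < \<beta>"
  have "inj_on (\<lambda>(v, t). v * \<beta> + t) (V \<times> {..<\<beta>})"
  proof (rule inj_onI, clarify)
    fix v t v' t' :: nat assume *: "t < \<beta>" "t' < \<beta>" "v * \<beta> + t = v' * \<beta> + t'"
    have "(v * \<beta> + t) div \<beta> = v" "(v' * \<beta> + t') div \<beta> = v'" using *(1,2) b by simp_all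
    then have "v = v'" unfolding *(3) by simp
    then show "v = v' \<and> t = t'" using *(3) by simp
  qed
  then show ?thesis by (simp add: window_def card_image card_cartesian_product)
qed

lemma window_subset: "V \<subseteq> {..<M} \<Longrightarrow> window \<beta> V \<subseteq> {..<M * \<beta>}"
proof
  fix i assume "V \<subseteq> {..<M}" "i \<in> window \<beta> V"
  then obtain v t where vt: "v < M" "t < \<beta>" "i = v * \<beta> + t" by (auto simp: window_def)
  have "i < Suc v * \<beta>" using vt by simp
  also have "\<dots> \<le> M * \<beta>" using vt by (intro mult_le_mono) auto
  finally show "i \<in> {..<M * \<beta>}" by simp
qed

context lfsr_irreducible
begin

definition nondegenerate :: "nat set \<Rightarrow> bool" where
  "nondegenerate I \<longleftrightarrow> (\<forall>J\<subseteq>I. J \<noteq> {} \<longrightarrow> \<not> bpoly f dvd (\<Sum>i\<in>J. monom 1 i))"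

lemma lfsr_words_uniform:
  assumes S: "finite S" and h: "inj_on h S" and \<beta>: "0 < \<beta>"
    and nd: "nondegenerate (window \<beta> (h ` S))"
    and u: "\<And>x. x \<in> S \<Longrightarrow> u x < 2 ^ \<beta>"
  shows "(2 ^ \<beta>) ^ card S * card {y. y < W \<and> (\<forall>x\<in>S. lfsr_word W f y \<beta> (h x) = u x)} = W"
proof -
  let ?I = "window \<beta> (h ` S)"
  have fin: "finite ?I" using S by (simp add: window_def)
  have cI: "card ?I = card S * \<beta>" using card_window[OF \<beta>] card_image[OF h] by simp
  \<comment> \<open>The bit prescribed at position \<open>i\<close> belongs to the point whose image
    under \<open>h\<close> is \<open>i div \<beta>\<close>, which is unique because \<open>h\<close>
    is injective on \<open>S\<close>.\<close>
  define b where "b i = bit (u (inv_into S h (i div \<beta>))) (\<beta> - 1 - i mod \<beta>)" for i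
  have b: "b (h x * \<beta> + t) = bit (u x) (\<beta> - 1 - t)" if "x \<in> S" "t < \<beta>" for x t
    using that h by (simp add: b_def)
  have "(\<forall>x\<in>S. lfsr_word W f y \<beta> (h x) = u x) \<longleftrightarrow> (\<forall>i\<in>?I. odd (lfsr W f i y) = b i)" for y
  proof -
    have "(\<forall>x\<in>S. lfsr_word W f y \<beta> (h x) = u x)
      \<longleftrightarrow> (\<forall>x\<in>S. \<forall>t<\<beta>. odd (lfsr W f (h x * \<beta> + t) y) = bit (u x) (\<beta> - 1 - t))"
      using u by (simp add: lfsr_word_def bits_val_eq_iff)
    also have "\<dots> \<longleftrightarrow> (\<forall>x\<in>S. \<forall>t<\<beta>. odd (lfsr W f (h x * \<beta> + t) y) = b (h x * \<beta> + t))"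
      using b by simp
    also have "\<dots> \<longleftrightarrow> (\<forall>i\<in>?I. odd (lfsr W f i y) = b i)"
      by (auto simp: window_def)
    finally show ?thesis .
  qed
  moreover have "2 ^ card ?I * card {y. y < W \<and> (\<forall>i\<in>?I. odd (lfsr W f i y) = b i)} = W"
    using nd by (intro lfsr_bits_uniform fin) (auto simp: nondegenerate_def)
  moreover have "((2::nat) ^ \<beta>) ^ card S = 2 ^ card ?I"
    by (simp add: cI power_mult[symmetric] mult.commute)
  ultimately show ?thesis by simp
qed

text \<open>The splitting states form a disjoint union over the split patterns, each of which occurs
  at a fraction \<open>1 / (2 ^ \<beta>) ^ k\<close> of the states. Hence the count depends neither
  on \<open>S\<close> and \<open>h\<close> nor on \<open>f\<close>, apart from
  \<open>W\<close>.\<close>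

lemma splitting_states:
  assumes S: "finite S" "card S = k" and h: "inj_on h S" and \<beta>: "0 < \<beta>"
    and nd: "nondegenerate (window \<beta> (h ` S))"
  shows "(2 ^ \<beta>) ^ k * card {y. y < W \<and> splits k l (\<lambda>x. lfsr_colour W f y \<beta> l (h x)) S}
    = pattern_count k l (2 ^ \<beta>) * W"
proof -
  let ?Z = "split_patterns k l (2 ^ \<beta>) S"
  let ?A = "\<lambda>u. {y. y < W \<and> (\<forall>x\<in>S. lfsr_word W f y \<beta> (h x) = u x)}"
  have eq: "{y. y < W \<and> splits k l (\<lambda>x. lfsr_colour W f y \<beta> l (h x)) S} = (\<Union>u\<in>?Z. ?A u)"
  proof (intro equalityI subsetI)
    fix y assume y: "y \<in> {y. y < W \<and> splits k l (\<lambda>x. lfsr_colour W f y \<beta> l (h x)) S}"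
    let ?u = "\<lambda>x\<in>S. lfsr_word W f y \<beta> (h x)"
    have "splits k l (\<lambda>x. ?u x mod l + 1) S"
      using y by (subst splits_cong[where h = "\<lambda>x. lfsr_colour W f y \<beta> l (h x)"]) (auto simp: lfsr_colour_def)
    then have "?u \<in> ?Z" by (auto simp: split_patterns_def lfsr_word_def bits_val_less)
    moreover have "y \<in> ?A ?u" using y by simp
    ultimately show "y \<in> (\<Union>u\<in>?Z. ?A u)" by blast
  next
    fix y assume "y \<in> (\<Union>u\<in>?Z. ?A u)"
    then obtain u where u: "u \<in> ?Z" "y \<in> ?A u" by blast
    then have "splits k l (\<lambda>x. lfsr_colour W f y \<beta> l (h x)) S"
      by (subst splits_cong[where h = "\<lambda>x. u x mod l + 1"]) (auto simp: lfsr_colour_def split_patterns_def)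
    then show "y \<in> {y. y < W \<and> splits k l (\<lambda>x. lfsr_colour W f y \<beta> l (h x)) S}" using u by simp
  qed
  have disj: "?A u \<inter> ?A v = {}" if "u \<in> ?Z" "v \<in> ?Z" "u \<noteq> v" for u v
  proof (rule ccontr)
    assume "?A u \<inter> ?A v \<noteq> {}"
    then have "u x = v x" if "x \<in> S" for x using that by auto
    then have "u = v" using that by (intro PiE_ext[of u S "\<lambda>_. {..<2 ^ \<beta>}" v]) (auto simp: split_patterns_def)
    then show False using that by simp
  qed
  have "(2 ^ \<beta>) ^ k * card (\<Union>u\<in>?Z. ?A u) = (2 ^ \<beta>) ^ k * (\<Sum>u\<in>?Z. card (?A u))"
    using finite_split_patterns[OF S(1)] disj by (subst card_UN_disjoint) auto
  also have "\<dots> = (\<Sum>u\<in>?Z. (2 ^ \<beta>) ^ k * card (?A u))" by (simp add: sum_distrib_left)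
  also have "\<dots> = (\<Sum>u\<in>?Z. W)"
  proof (intro sum.cong refl)
    fix u assume "u \<in> ?Z"
    then have "x \<in> S \<Longrightarrow> u x < 2 ^ \<beta>" for x by (auto simp: split_patterns_def)
    then show "(2 ^ \<beta>) ^ k * card (?A u) = W"
      using lfsr_words_uniform[OF S(1) h \<beta> nd] S(2) by blast
  qed
  also have "\<dots> = pattern_count k l (2 ^ \<beta>) * W" using card_split_patterns[OF S] by simp
  finally show ?thesis unfolding eq .
qed

end

section \<open>The splitter\<close>

definition irred_nats :: "nat \<Rightarrow> nat list" where
  "irred_nats W = filter (\<lambda>f. irreducible (bpoly f)) [W..<2 * W]"

lemma irreducibles_eq: "irreducibles r = bpoly ` set (irred_nats (2 ^ r))"
proof -
  have "irreducibles r = {p \<in> polys_of_degree r. irreducible p}"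
    by (auto simp: irreducibles_def polys_of_degree_def)
  then show ?thesis by (auto simp: polys_of_degree_bpoly irred_nats_def)
qed

lemma card_irred_nats: "card (set (irred_nats (2 ^ r))) = card (irreducibles r)"
  unfolding irreducibles_eq by (rule card_image[symmetric]) (rule inj_on_subset[OF inj_bpoly], simp)

text \<open>A linear code with \<open>2 ^ L\<close> words whose coordinates are the functions of the list \<open>hs\<close>.\<close>

definition good_code :: "nat \<Rightarrow> nat \<Rightarrow> (nat \<Rightarrow> nat) list \<Rightarrow> bool" where
  "good_code L M hs \<longleftrightarrow> length hs = M * L \<and>
     (\<forall>h\<in>set hs. (\<forall>x<2 ^ L. h x < M) \<and> (\<forall>x<2 ^ L. \<forall>y<2 ^ L. h (x XOR y) = h x XOR h y)) \<and>
     (\<forall>x. 0 < x \<and> x < 2 ^ L \<longrightarrow> length (filter (\<lambda>h. h x = 0) hs) \<le> 3 * L)"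

definition block :: "nat \<Rightarrow> nat \<Rightarrow> nat \<Rightarrow> nat \<Rightarrow> (nat \<Rightarrow> nat) \<Rightarrow> (nat \<Rightarrow> nat) list" where
  "block n W \<beta> l h = concat (map (\<lambda>f. map (\<lambda>y. \<lambda>x\<in>{1..n}. lfsr_colour W f y \<beta> l (h x)) [0..<W]) (irred_nats W))"

lemma length_block: "length (block n W \<beta> l h) = length (irred_nats W) * W"
  by (simp add: block_def length_concat comp_def sum_list_triv)

lemma set_irred_nats: "f \<in> set (irred_nats (2 ^ r)) \<Longrightarrow> lfsr_irreducible (2 ^ r) r f"
  by unfold_locales (auto simp: irred_nats_def)

lemma split_count_block:
  assumes "S \<subseteq> {1..n}"
  shows "split_count k l (mset (concat (map (block n W \<beta> l) hs))) S
    = (\<Sum>h\<leftarrow>hs. \<Sum>f\<in>set (irred_nats W). card {y. y < W \<and> splits k l (\<lambda>x. lfsr_colour W f y \<beta> l (h x)) S})"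
proof -
  have "length (filter (\<lambda>g. splits k l g S) (block n W \<beta> l h))
     = (\<Sum>f\<in>set (irred_nats W). card {y. y < W \<and> splits k l (\<lambda>x. lfsr_colour W f y \<beta> l (h x)) S})" for h
  proof -
    have "length (filter (\<lambda>g. splits k l g S) (map (\<lambda>y. \<lambda>x\<in>{1..n}. lfsr_colour W f y \<beta> l (h x)) [0..<W]))
        = card {y. y < W \<and> splits k l (\<lambda>x. lfsr_colour W f y \<beta> l (h x)) S}" for f
    proof -
      have "splits k l (\<lambda>x\<in>{1..n}. lfsr_colour W f y \<beta> l (h x)) S \<longleftrightarrow> splits k l (\<lambda>x. lfsr_colour W f y \<beta> l (h x)) S" for y
        using assms by (intro splits_cong) auto
      then have "length (filter (\<lambda>g. splits k l g S) (map (\<lambda>y. \<lambda>x\<in>{1..n}. lfsr_colour W f y \<beta> l (h x)) [0..<W]))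
        = length (filter (\<lambda>y. splits k l (\<lambda>x. lfsr_colour W f y \<beta> l (h x)) S) [0..<W])"
        by (simp only: filter_map length_map comp_def)
      also have "\<dots> = card (set (filter (\<lambda>y. splits k l (\<lambda>x. lfsr_colour W f y \<beta> l (h x)) S) [0..<W]))"
        by (rule distinct_card[symmetric]) simp
      finally show ?thesis by (simp add: atLeast0LessThan conj_commute)
    qed
    moreover have "distinct (irred_nats W)" by (simp add: irred_nats_def)
    ultimately show ?thesis
      by (simp only: block_def filter_concat length_concat map_map comp_def sum_list_distinct_conv_sum_set)
  qed
  moreover have "size (filter_mset P (mset xs)) = length (filter P xs)" for P and xs :: "(nat \<Rightarrow> nat) list"
    by (metis mset_filter size_mset)
  ultimately show ?thesis
    by (simp only: split_count_def filter_concat length_concat map_map comp_def)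
qed

section \<open>Deviation from the exact fraction of splittings\<close>

lemma length_filter_bex_le:
  assumes "finite P"
  shows "length (filter (\<lambda>h. \<exists>p\<in>P. Q p h) hs) \<le> (\<Sum>p\<in>P. length (filter (Q p) hs))"
proof (induction hs)
  case (Cons h hs)
  have "(\<Sum>p\<in>P. length (filter (Q p) (h # hs))) = (\<Sum>p\<in>P. of_bool (Q p h)) + (\<Sum>p\<in>P. length (filter (Q p) hs))"
    unfolding sum.distrib[symmetric] by (intro sum.cong) auto
  moreover have "of_bool (\<exists>p\<in>P. Q p h) \<le> (\<Sum>p\<in>P. of_bool (Q p h) :: nat)"
    using assms by (auto simp: Suc_le_eq card_gt_0_iff)
  ultimately have *: "of_bool (\<exists>p\<in>P. Q p h) + length (filter (\<lambda>h. \<exists>p\<in>P. Q p h) hs)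
      \<le> (\<Sum>p\<in>P. length (filter (Q p) (h # hs)))"
    using Cons by linarith
  show ?case
  proof (cases "\<exists>p\<in>P. Q p h")
    case True
    then have "length (filter (\<lambda>h. \<exists>p\<in>P. Q p h) (h # hs))
        = of_bool (\<exists>p\<in>P. Q p h) + length (filter (\<lambda>h. \<exists>p\<in>P. Q p h) hs)" by simp
    with * show ?thesis by (rule ord_eq_le_trans[rotated])
  next
    case False
    then have "length (filter (\<lambda>h. \<exists>p\<in>P. Q p h) (h # hs))
        = of_bool (\<exists>p\<in>P. Q p h) + length (filter (\<lambda>h. \<exists>p\<in>P. Q p h) hs)" by simp
    with * show ?thesis by (rule ord_eq_le_trans[rotated])
  qed
qed simp

lemma sum_list_le_if:
  fixes d :: "'a \<Rightarrow> int"
  assumes "\<And>h. h \<in> set hs \<Longrightarrow> d h \<le> (if P h then a else b)" "0 \<le> a" "0 \<le> b"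
  shows "(\<Sum>h\<leftarrow>hs. d h) \<le> int (length (filter P hs)) * a + int (length hs) * b"
  using assms(1)
proof (induction hs)
  case (Cons h hs)
  have "d h \<le> (if P h then a else 0) + b" using Cons.prems[of h] assms(2,3) by (auto split: if_splits)
  moreover have "(\<Sum>h\<leftarrow>hs. d h) \<le> int (length (filter P hs)) * a + int (length hs) * b"
    using Cons by simp
  ultimately show ?case by (auto simp: distrib_right)
qed simp

text \<open>By linearity \<open>h\<close> identifies \<open>x\<close> and \<open>y\<close> iff it
  vanishes at the nonzero word \<open>x XOR y\<close>, which happens for at most
  \<open>3 * L\<close> coordinates. The factor \<open>card S * card S\<close> is a union bound over
  the pairs.\<close>

lemma few_collisions:
  assumes code: "good_code L M hs" and S: "finite S" "S \<subseteq> {..<2 ^ L}"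
  shows "length (filter (\<lambda>h. \<not> inj_on h S) hs) \<le> card S * card S * (3 * L)"
proof -
  let ?P = "{(x, y). x \<in> S \<and> y \<in> S \<and> x \<noteq> y}"
  have sub: "?P \<subseteq> S \<times> S" by auto
  have fin: "finite ?P" using finite_subset[OF sub] S by simp
  have "filter (\<lambda>h. \<not> inj_on h S) hs = filter (\<lambda>h. \<exists>p\<in>?P. h (fst p) = h (snd p)) hs"
    by (intro filter_cong refl) (auto simp: inj_on_def)
  then have "length (filter (\<lambda>h. \<not> inj_on h S) hs) \<le> (\<Sum>p\<in>?P. length (filter (\<lambda>h. h (fst p) = h (snd p)) hs))"
    using length_filter_bex_le[OF fin, of "\<lambda>p h. h (fst p) = h (snd p)" hs] by simp
  also have "\<dots> \<le> (\<Sum>p\<in>?P. 3 * L)"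
  proof (rule sum_mono, clarify)
    fix x y assume xy: "x \<in> S" "y \<in> S" "x \<noteq> y"
    then have lt: "x < 2 ^ L" "y < 2 ^ L" using S by auto
    have "x XOR y \<noteq> 0" using xy(3) by (simp add: xor_eq_0_iff)
    moreover have "x XOR y < 2 ^ L" using lt by (rule xor_less_power)
    ultimately have "length (filter (\<lambda>h. h (x XOR y) = 0) hs) \<le> 3 * L"
      using code by (simp add: good_code_def)
    moreover have "filter (\<lambda>h. h (fst (x, y)) = h (snd (x, y))) hs = filter (\<lambda>h. h (x XOR y) = 0) hs"
    proof (intro filter_cong refl)
      fix h assume "h \<in> set hs"
      then have e: "h (x XOR y) = h x XOR h y" using code lt by (simp add: good_code_def)
      then show "h (fst (x, y)) = h (snd (x, y)) \<longleftrightarrow> h (x XOR y) = 0" by (simp add: xor_eq_0_iff)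
    qed
    ultimately show "length (filter (\<lambda>h. h (fst (x, y)) = h (snd (x, y))) hs) \<le> 3 * L" by simp
  qed
  also have "\<dots> = card ?P * (3 * L)" by simp
  also have "\<dots> \<le> card S * card S * (3 * L)"
    using card_mono[OF _ sub] S by (intro mult_le_mono) (auto simp: card_cartesian_product)
  finally show ?thesis .
qed

text \<open>An injective \<open>h\<close> with a nondegenerate \<open>f\<close> contributes exactly
  the fraction \<open>z / K\<close> of its \<open>W\<close> states. The error from the other pairs
  is a fraction of at most \<open>(3 * k * k + 2 * K * \<beta>) / M \<le> 5 * K * k * k / M\<close>
  of all functions. Relative to \<open>z / K \<ge> 1 / K\<close> this is at most
  \<open>5 * K * K * k * k / M\<close>, hence by \<open>big\<close> at most
  \<open>1 / (2 * A) \<le> (\<delta> - 1) / 2\<close>.\<close>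

lemma balanced_blocks:
  assumes l: "2 \<le> l" and k: "l \<le> k" "k \<le> n" and n: "n < 2 ^ L"
    and M: "M = 2 ^ b" and W: "W = M * M" and \<beta>: "l \<le> 2 ^ \<beta>" "\<beta> \<le> k" and K: "K = (2 ^ \<beta>) ^ k"
    and \<delta>: "1 < \<delta>" "\<delta> \<le> 2" "1 \<le> real A * (\<delta> - 1)" and big: "10 * A * K * K * k * k \<le> M"
    and code: "good_code L M hs"
  shows "balanced_splitter \<delta> n k l (mset (concat (map (block n W \<beta> l) hs)))"
proof -
  have A: "0 < A" using \<delta> by (cases A) auto
  have k0: "0 < k" using l k by simp
  have \<beta>0: "0 < \<beta>" using \<beta> l by (cases \<beta>) auto
  have K0: "0 < K" using K by simp
  define r where "r = 2 * b"
  have Wr: "W = 2 ^ r" by (simp add: W M r_def mult_2 power_add)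
  have M10: "10 \<le> M"
  proof -
    have "10 * 1 \<le> 10 * (A * K * K * k * k)" using A K0 k0 by (intro mult_le_mono) auto
    also have "\<dots> = 10 * A * K * K * k * k" by simp
    also note big
    finally show ?thesis by simp
  qed
  have b2: "2 \<le> b"
  proof (rule ccontr)
    assume "\<not> 2 \<le> b"
    then have "b = 0 \<or> b = 1" by auto
    then show False using M M10 by auto
  qed
  have L0: "0 < L" using n k l by (cases L) auto
  define E where "E = set (irred_nats W)"
  define e where "e = card E"
  define z where "z = pattern_count k l (2 ^ \<beta>)"
  have z0: "0 < z" using pattern_count_pos[of l "2 ^ \<beta>" k] l \<beta> by (simp add: z_def)
  have zK: "z \<le> K" using pattern_count_le by (simp add: z_def K)
  have E: "lfsr_irreducible W r f" if "f \<in> E" for f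
    using that set_irred_nats by (simp add: E_def Wr)
  have We: "W \<le> 2 * r * e"
    using many_irreducibles[of r] b2 card_irred_nats[of r] by (simp add: E_def e_def Wr r_def)
  have e0: "0 < e"
  proof (rule gr0I)
    assume "e = 0" then have "W = 0" using We by simp
    then show False using M10 W by simp
  qed
  have N: "length hs = M * L" using code by (simp add: good_code_def)
  define N where "N = length hs"
  have N0: "0 < N" using N L0 M10 by (simp add: N_def)
  \<comment> \<open>The number of splittings if every pair of \<open>h\<close> and \<open>f\<close>
    were exact.\<close>
  define T where "T = real z * real W * real N * real e / real K"
  have T0: "0 < T" using z0 N0 e0 K0 M10 W by (simp add: T_def)
  have bounds: "T / \<delta> \<le> real (split_count k l (mset (concat (map (block n W \<beta> l) hs))) S)
       \<and> real (split_count k l (mset (concat (map (block n W \<beta> l) hs))) S) \<le> \<delta> * T"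
    if S: "S \<subseteq> {1..n}" "card S = k" for S
  proof -
    have fS: "finite S" using S finite_subset by blast
    have SL: "S \<subseteq> {..<2 ^ L}" using S n by auto
    define c where "c h f = card {y. y < W \<and> splits k l (\<lambda>x. lfsr_colour W f y \<beta> l (h x)) S}" for h f
    \<comment> \<open>Counts are multiplied by \<open>K\<close>, so that they can be compared with
      the fraction \<open>z / K\<close> in the integers.\<close>
    define dev where "dev h = (\<Sum>f\<in>E. \<bar>int K * int (c h f) - int z * int W\<bar>)" for h
    have cW: "c h f \<le> W" for h f
      unfolding c_def using card_mono[of "{..<W}" "{y. y < W \<and> splits k l (\<lambda>x. lfsr_colour W f y \<beta> l (h x)) S}"] by auto
    have dev1: "\<bar>int K * int (c h f) - int z * int W\<bar> \<le> int K * int W" for h f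
    proof -
      have "int K * int (c h f) \<le> int K * int W" using cW by (intro mult_left_mono) auto
      moreover have "int z * int W \<le> int K * int W" using zK by (intro mult_right_mono) auto
      moreover have "0 \<le> int K * int (c h f)" "0 \<le> int z * int W" by simp_all
      ultimately show ?thesis by linarith
    qed
    have dev_noninj: "dev h \<le> int K * int W * int e" for h
    proof -
      have "dev h \<le> (\<Sum>f\<in>E. int K * int W)" unfolding dev_def by (intro sum_mono dev1)
      then show ?thesis by (simp add: e_def mult.commute)
    qed
    have dev_inj: "int M * dev h \<le> int K * int W * int (2 * e * K * \<beta>)"
      if h: "h \<in> set hs" "inj_on h S" for h
    proof -
      have hS: "h ` S \<subseteq> {..<M}" using code h SL by (auto simp: good_code_def)
      let ?I = "window \<beta> (h ` S)"
      define G where "G = {f \<in> E. \<exists>J\<subseteq>?I. J \<noteq> {} \<and> bpoly f dvd (\<Sum>i\<in>J. monom 1 i)}"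
      have "bpoly ` G = {p \<in> irreducibles r. \<exists>J\<subseteq>?I. J \<noteq> {} \<and> p dvd (\<Sum>i\<in>J. monom 1 i)}"
        by (auto simp: G_def E_def irreducibles_eq Wr)
      moreover have "card (bpoly ` G) = card G"
        by (intro card_image inj_on_subset[OF inj_bpoly]) simp
      moreover have "card ?I = k * \<beta>" using card_window[OF \<beta>0] card_image[OF h(2)] S by simp
      ultimately have "r * card G \<le> 2 ^ (k * \<beta>) * (M * \<beta>)"
        using few_degenerate_irreducibles[OF window_subset[OF hS, of \<beta>], of r] by simp
      then have rG: "r * card G \<le> K * (M * \<beta>)" by (simp add: K power_mult[symmetric] mult.commute[of k])
      \<comment> \<open>The factor \<open>r\<close> in the bound on \<open>card G\<close> cancels
        against the one in \<open>W \<le> 2 * r * e\<close>, and \<open>W = M * M\<close> leaves one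
        factor \<open>M\<close> to spare.\<close>
      have "card G * M * M \<le> card G * (2 * r * e)"
        using We by (simp add: W mult.assoc)
      also have "\<dots> = 2 * e * (r * card G)" by simp
      also have "\<dots> \<le> 2 * e * (K * (M * \<beta>))" using rG by (rule mult_le_mono2)
      also have "\<dots> = (2 * e * K * \<beta>) * M" by simp
      finally have GM: "card G * M \<le> 2 * e * K * \<beta>" using M10 by simp
      have zero: "int K * int (c h f) - int z * int W = 0" if fEG: "f \<in> E - G" for f
      proof -
        interpret lfsr_irreducible W r f using E fEG by blast
        have "nondegenerate ?I" using fEG by (auto simp: nondegenerate_def G_def)
        then have "K * c h f = z * W"
          using splitting_states[OF fS S(2) h(2) \<beta>0] by (simp add: K c_def z_def)
        then show ?thesis by (metis diff_self of_nat_mult)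
      qed
      have "dev h = (\<Sum>f\<in>G. \<bar>int K * int (c h f) - int z * int W\<bar>)"
        unfolding dev_def
      proof (rule sum.mono_neutral_right)
        show "finite E" "G \<subseteq> E" by (auto simp: E_def G_def)
        show "\<forall>f\<in>E - G. \<bar>int K * int (c h f) - int z * int W\<bar> = 0" using zero by simp
      qed
      also have "\<dots> \<le> (\<Sum>f\<in>G. int K * int W)" by (intro sum_mono dev1)
      finally have "dev h \<le> int (card G) * (int K * int W)" by simp
      then have "int M * dev h \<le> int M * (int (card G) * (int K * int W))" by (intro mult_left_mono) auto
      also have "\<dots> = int (card G * M) * (int K * int W)" by simp
      also have "\<dots> \<le> int (2 * e * K * \<beta>) * (int K * int W)" by (rule mult_right_mono[OF of_nat_mono[OF GM]]) simp
      finally show ?thesis by (simp add: mult_ac)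
    qed
    define C where "C = (\<Sum>h\<leftarrow>hs. \<Sum>f\<in>E. c h f)"
    have C: "split_count k l (mset (concat (map (block n W \<beta> l) hs))) S = C"
      using split_count_block[OF S(1)] by (simp add: C_def c_def E_def)
    have "(\<Sum>h\<leftarrow>hs. int M * dev h) \<le> int (length (filter (\<lambda>h. \<not> inj_on h S) hs)) * (int M * (int K * int W * int e))
        + int (length hs) * (int K * int W * int (2 * e * K * \<beta>))"
    proof (rule sum_list_le_if)
      fix h assume "h \<in> set hs"
      then show "int M * dev h \<le> (if \<not> inj_on h S then int M * (int K * int W * int e)
          else int K * int W * int (2 * e * K * \<beta>))"
        using dev_inj[of h] dev_noninj[of h] by (auto intro: mult_left_mono)
    qed simp_all
    also have "\<dots> \<le> int (k * k * (3 * L)) * (int M * (int K * int W * int e))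
        + int N * (int K * int W * int (2 * e * K * \<beta>))"
      unfolding N_def using of_nat_mono[OF few_collisions[OF code fS SL, unfolded S(2)], where 'a = int]
      by (intro add_mono mult_right_mono order_refl) simp_all
    also have "\<dots> = int (K * W * N * e * (3 * k * k + 2 * K * \<beta>))"
      by (simp add: N_def N algebra_simps)
    also have "\<dots> \<le> int (K * W * N * e * (5 * K * k * k))"
    proof -
      have "1 * (k * k) \<le> K * (k * k)" using K0 by (intro mult_le_mono) auto
      moreover have "\<beta> \<le> k * k" using \<beta>(2) k0 le_trans[OF \<beta>(2), of "k * k"] by simp
      then have "K * \<beta> \<le> K * (k * k)" by (rule mult_le_mono2)
      ultimately have "3 * k * k + 2 * K * \<beta> \<le> 5 * K * k * k"
        unfolding mult.assoc by linarith
      then show ?thesis by (intro of_nat_mono mult_le_mono) auto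
    qed
    finally have up: "(\<Sum>h\<leftarrow>hs. int M * dev h) \<le> int (K * W * N * e * (5 * K * k * k))" .
    define D where "D = (\<Sum>h\<leftarrow>hs. dev h)"
    have D0: "0 \<le> D" unfolding D_def dev_def by (intro sum_list_nonneg) (auto intro: sum_nonneg)
    have "int (10 * A * K * K * k * k) * D \<le> int M * D"
      by (rule mult_right_mono[OF of_nat_mono[OF big] D0])
    also have "\<dots> \<le> int (K * W * N * e * (5 * K * k * k))" using up by (simp add: D_def sum_list_const_mult)
    finally have "int (5 * K * K * k * k) * (int (2 * A) * D) \<le> int (5 * K * K * k * k) * int (W * N * e)"
      by (simp add: mult_ac)
    then have D: "int (2 * A) * D \<le> int (W * N * e)"
      using K0 k0 by (subst (asm) mult_le_cancel_left_pos) auto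
    have "int K * int C - int (z * W * N * e) = (\<Sum>h\<leftarrow>hs. \<Sum>f\<in>E. int K * int (c h f) - int z * int W)"
    proof -
      have "(\<Sum>h\<leftarrow>xs. \<Sum>f\<in>E. int K * int (c h f) - int z * int W)
        = int K * int (\<Sum>h\<leftarrow>xs. \<Sum>f\<in>E. c h f) - int (z * W * length xs * e)" for xs
        by (induction xs) (simp_all add: sum_subtractf sum_distrib_left[symmetric] e_def algebra_simps)
      from this[of hs] show ?thesis by (simp add: C_def N_def)
    qed
    then have "\<bar>int K * int C - int (z * W * N * e)\<bar> \<le> (\<Sum>h\<leftarrow>hs. \<bar>\<Sum>f\<in>E. int K * int (c h f) - int z * int W\<bar>)"
      using sum_list_abs[of "map (\<lambda>h. \<Sum>f\<in>E. int K * int (c h f) - int z * int W) hs"] by (simp add: comp_def)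
    also have "\<dots> \<le> D" unfolding D_def dev_def by (intro sum_list_mono sum_abs)
    finally have "\<bar>int K * int C - int (z * W * N * e)\<bar> \<le> D" .
    then have "int (2 * A) * \<bar>int K * int C - int (z * W * N * e)\<bar> \<le> int (W * N * e)"
      using D by (meson mult_left_mono of_nat_0_le_iff order_trans)
    then have "real_of_int (int (2 * A) * \<bar>int K * int C - int (z * W * N * e)\<bar>) \<le> real_of_int (int (W * N * e))"
      by (simp only: of_int_le_iff)
    then have R: "2 * real A * \<bar>real K * real C - real z * real W * real N * real e\<bar> \<le> real W * real N * real e"
      by simp
    have KT: "real z * real W * real N * real e = real K * T" using K0 by (simp add: T_def)
    have "2 * real A * (real K * \<bar>real C - T\<bar>) = 2 * real A * \<bar>real K * real C - real K * T\<bar>"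
      by (simp add: abs_mult flip: right_diff_distrib)
    also have "\<dots> \<le> real W * real N * real e" using R KT by simp
    \<comment> \<open>Here \<open>z \<ge> 1\<close> turns the absolute error bound into one relative
      to \<open>T\<close>.\<close>
    also have "\<dots> \<le> real z * (real W * real N * real e)"
      using z0 mult_right_mono[of 1 "real z" "real W * real N * real e"] by simp
    also have "\<dots> = real K * T" using KT by (simp add: mult_ac)
    finally have "real K * (2 * real A * \<bar>real C - T\<bar>) \<le> real K * T" by (simp add: mult_ac)
    then have AT: "2 * real A * \<bar>real C - T\<bar> \<le> T" using K0 by simp
    have "2 * \<bar>real C - T\<bar> * 1 \<le> 2 * \<bar>real C - T\<bar> * (real A * (\<delta> - 1))"
      using \<delta> by (intro mult_left_mono) auto
    also have "\<dots> = 2 * real A * \<bar>real C - T\<bar> * (\<delta> - 1)" by simp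
    also have "\<dots> \<le> T * (\<delta> - 1)" using AT \<delta> by (intro mult_right_mono) auto
    finally have dT: "2 * \<bar>real C - T\<bar> \<le> T * (\<delta> - 1)" by simp
    have dT': "2 * (real C - T) \<le> T * (\<delta> - 1)" "2 * (T - real C) \<le> T * (\<delta> - 1)"
    proof -
      have "2 * x \<le> y" "- (2 * x) \<le> y" if "2 * \<bar>x\<bar> \<le> y" for x y :: real
        using that by linarith+
      from this[OF dT] show "2 * (real C - T) \<le> T * (\<delta> - 1)" "2 * (T - real C) \<le> T * (\<delta> - 1)"
        by (simp_all only: right_diff_distrib minus_diff_eq)
    qed
    have "real C \<le> \<delta> * T"
    proof -
      note dT'(1)
      moreover have "0 \<le> T * (\<delta> - 1)" using T0 \<delta> by simp
      ultimately show ?thesis by (simp add: algebra_simps)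
    qed
    moreover have "T / \<delta> \<le> real C"
    proof -
      \<comment> \<open>The estimate so far gives the lower bound
        \<open>T * (3 - \<delta>) / 2\<close>, which is at least \<open>T / \<delta>\<close> because
        \<open>1 < \<delta> \<le> 2\<close>.\<close>
      have "0 \<le> (2 - \<delta>) * (\<delta> - 1)" using \<delta> by simp
      then have "2 \<le> \<delta> * (3 - \<delta>)" by (simp add: algebra_simps)
      then have "T * 2 \<le> T * (\<delta> * (3 - \<delta>))" using T0 by (intro mult_left_mono) auto
      then have "2 * (T / \<delta>) \<le> T * (3 - \<delta>)" using \<delta> by (simp add: field_simps)
      also have "\<dots> \<le> 2 * real C" using dT'(2) by (simp add: algebra_simps)
      finally show ?thesis by simp
    qed
    ultimately show ?thesis using C by simp
  qed
  have "set (block n W \<beta> l h) \<subseteq> {1..n} \<rightarrow>\<^sub>E {1..l}" for h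
    using l by (auto simp: block_def lfsr_colour_def Suc_le_eq)
  then have "set_mset (mset (concat (map (block n W \<beta> l) hs))) \<subseteq> {1..n} \<rightarrow>\<^sub>E {1..l}" by auto
  then show ?thesis unfolding balanced_splitter_def using T0 bounds by blast
qed

section \<open>Reasoning about programs\<close>

text \<open>Memory is used as eight interleaved arrays, the cell \<open>i\<close> of array \<open>j < 8\<close> having address
  \<open>8 * i + j\<close>; distinct arrays then never overlap, whatever their lengths.\<close>

definition arr :: "state \<Rightarrow> nat \<Rightarrow> nat \<Rightarrow> nat" where
  "arr s j i = mem s (8 * i + j)"

definition cell :: "nat \<Rightarrow> expr \<Rightarrow> expr" where
  "cell j e = Bin Plus (Bin Times (Const 8) e) (Const j)"

definition ld :: "nat \<Rightarrow> expr \<Rightarrow> expr" where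
  "ld j e = Mem (cell j e)"

definition st :: "nat \<Rightarrow> expr \<Rightarrow> expr \<Rightarrow> prog" where
  "st j e v = Store (cell j e) v"

definition setr :: "nat \<Rightarrow> nat \<Rightarrow> state \<Rightarrow> state" where
  "setr r v s = s\<lparr>regs := (regs s)(r := v)\<rparr>"

definition seta :: "nat \<Rightarrow> nat \<Rightarrow> nat \<Rightarrow> state \<Rightarrow> state" where
  "seta j i v s = s\<lparr>mem := (mem s)(8 * i + j := v)\<rparr>"

definition emit :: "nat \<Rightarrow> state \<Rightarrow> state" where
  "emit v s = s\<lparr>outp := outp s @ [v]\<rparr>"

lemma state_simps [simp]:
  "regs (setr r v s) r' = (if r' = r then v else regs s r')"
  "arr (setr r v s) = arr s"
  "outp (setr r v s) = outp s"
  "regs (seta j i v s) = regs s"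
  "outp (seta j i v s) = outp s"
  "regs (emit v s) = regs s"
  "arr (emit v s) = arr s"
  "outp (emit v s) = outp s @ [v]"
  by (simp_all add: setr_def seta_def emit_def arr_def fun_eq_iff)

lemma cell_eq_iff:
  assumes "j < 8" "j' < (8 :: nat)"
  shows "8 * i + j = 8 * i' + j' \<longleftrightarrow> i = i' \<and> j = j'"
proof
  assume e: "8 * i + j = 8 * i' + j'"
  then have "(8 * i + j) mod 8 = (8 * i' + j') mod 8" by (rule arg_cong)
  then have "j = j'" using assms by simp
  with e show "i = i' \<and> j = j'" by simp
qed simp

lemma arr_seta [simp]:
  "j < 8 \<Longrightarrow> j' < 8 \<Longrightarrow> arr (seta j i v s) j' i' = (if j' = j \<and> i' = i then v else arr s j' i')"
  by (auto simp: arr_def seta_def cell_eq_iff)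

lemma arr_seta_other [simp]: "j < 8 \<Longrightarrow> j' < 8 \<Longrightarrow> j' \<noteq> j \<Longrightarrow> arr (seta j i v s) j' = arr s j'"
  by (simp add: fun_eq_iff)

lemma expr_val_ld [simp]: "expr_val s (ld j e) = arr s j (expr_val s e)"
  by (simp add: ld_def cell_def arr_def)

lemma expr_cost_ld [simp]: "expr_cost (ld j e) = 5 + expr_cost e"
  by (simp add: ld_def cell_def)

section \<open>Registers and arrays that a program leaves unchanged\<close>

definition frame :: "nat set \<Rightarrow> nat set \<Rightarrow> state \<Rightarrow> state \<Rightarrow> bool" where
  "frame R J s s' \<longleftrightarrow> (\<forall>r. r \<notin> R \<longrightarrow> regs s' r = regs s r) \<and>
     (\<forall>j. j < 8 \<and> j \<notin> J \<longrightarrow> arr s' j = arr s j)"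

fun wregs :: "prog \<Rightarrow> nat set" where
  "wregs (Assign r e) = {r}"
| "wregs (Seq P Q) = wregs P \<union> wregs Q"
| "wregs (Cond e P Q) = wregs P \<union> wregs Q"
| "wregs (While e P) = wregs P"
| "wregs _ = {}"

text \<open>The array is read off the shape of the address expression; an address of any other shape
  counts as touching everything.\<close>

definition cell_region :: "expr \<Rightarrow> nat set" where
  "cell_region a = (if \<exists>j<8. \<exists>e. a = cell j e then {j. \<exists>e. a = cell j e} else UNIV)"

lemma cell_region_cell: "j < 8 \<Longrightarrow> cell_region (cell j e) = {j}"
  by (auto simp: cell_region_def cell_def)

fun warrs :: "prog \<Rightarrow> nat set" where
  "warrs (Store a e) = cell_region a"
| "warrs (Seq P Q) = warrs P \<union> warrs Q"
| "warrs (Cond e P Q) = warrs P \<union> warrs Q"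
| "warrs (While e P) = warrs P"
| "warrs _ = {}"

fun silent :: "prog \<Rightarrow> bool" where
  "silent (Write e) = False"
| "silent (Seq P Q) = (silent P \<and> silent Q)"
| "silent (Cond e P Q) = (silent P \<and> silent Q)"
| "silent (While e P) = silent P"
| "silent _ = True"

lemma st_simps [simp]: "wregs (st j e v) = {}" "j < 8 \<Longrightarrow> warrs (st j e v) = {j}" "silent (st j e v)"
  by (simp_all add: st_def cell_region_cell)

lemma frame_refl [simp]: "frame R J s s"
  by (simp add: frame_def)

lemma frame_trans: "frame R J s s' \<Longrightarrow> frame R' J' s' s'' \<Longrightarrow> frame (R \<union> R') (J \<union> J') s s''"
  by (simp add: frame_def)

lemma frame_mono: "frame R J s s' \<Longrightarrow> R \<subseteq> R' \<Longrightarrow> J \<subseteq> J' \<Longrightarrow> frame R' J' s s'"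
  by (auto simp: frame_def)

lemma frame_regs: "frame R J s s' \<Longrightarrow> r \<notin> R \<Longrightarrow> regs s' r = regs s r"
  by (simp add: frame_def)

lemma frame_arr: "frame R J s s' \<Longrightarrow> j \<notin> J \<Longrightarrow> j < 8 \<Longrightarrow> arr s' j = arr s j"
  by (simp add: frame_def)

lemma cell_region_sound:
  assumes "j < 8" "j \<notin> cell_region a"
  shows "arr (s\<lparr>mem := (mem s)(expr_val s a := v)\<rparr>) j i = arr s j i"
proof -
  obtain e j' where a: "a = cell j' e" "j' < 8" "j \<noteq> j'"
    using assms by (auto simp: cell_region_def split: if_splits)
  then have "8 * expr_val s e + j' \<noteq> 8 * i + j" using cell_eq_iff[OF a(2) assms(1)] by blast
  then show ?thesis by (simp add: arr_def a cell_def)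
qed

text \<open>What is preserved follows from the program text alone, so loop invariants need to
  mention only what changes.\<close>

lemma exec_frame: "exec w P s t s' \<Longrightarrow> frame (wregs P) (warrs P) s s'"
proof (induction rule: exec.induct)
  case (Assign s e r)
  then show ?case by (simp add: frame_def arr_def fun_eq_iff)
next
  case (Store s a e)
  then show ?case using cell_region_sound by (simp add: frame_def fun_eq_iff)
next
  case (Write s e)
  then show ?case by (simp add: frame_def arr_def fun_eq_iff)
next
  case (WhileTrue s e P t s' t' s'')
  then show ?case using frame_trans by fastforce
qed (auto intro: frame_trans frame_mono)

lemma exec_silent: "exec w P s t s' \<Longrightarrow> silent P \<Longrightarrow> outp s' = outp s"
  by (induction rule: exec.induct) auto

text \<open>\<open>expr_fits\<close> with a number \<open>Z\<close> in place of
  \<open>2 ^ w\<close>, which keeps exponentials out of the size conditions.\<close>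

fun fits :: "nat \<Rightarrow> state \<Rightarrow> expr \<Rightarrow> bool" where
  "fits Z s (Const c) \<longleftrightarrow> c < Z"
| "fits Z s (Reg r) \<longleftrightarrow> regs s r < Z"
| "fits Z s (Mem e) \<longleftrightarrow> fits Z s e \<and> mem s (expr_val s e) < Z"
| "fits Z s (Bin f e1 e2) \<longleftrightarrow> fits Z s e1 \<and> fits Z s e2 \<and> expr_val s (Bin f e1 e2) < Z"

lemma expr_fits_iff: "expr_fits w s e \<longleftrightarrow> fits (2 ^ w) s e"
  by (induction e) auto

lemma fits_cell [simp]: "fits Z s (cell j e) \<longleftrightarrow> 8 < Z \<and> fits Z s e \<and> 8 * expr_val s e + j < Z"
  by (auto simp: cell_def)

lemma expr_val_cell [simp]: "expr_val s (cell j e) = 8 * expr_val s e + j"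
  by (simp add: cell_def)

lemma expr_cost_cell [simp]: "expr_cost (cell j e) = 4 + expr_cost e"
  by (simp add: cell_def)

lemma fits_ld [simp]:
  "fits Z s (ld j e) \<longleftrightarrow> 8 < Z \<and> fits Z s e \<and> 8 * expr_val s e + j < Z \<and> arr s j (expr_val s e) < Z"
  by (auto simp: ld_def arr_def)

locale ram =
  fixes w Z :: nat
  assumes Z: "Z = 2 ^ w"
begin

text \<open>Total correctness including the running time. As execution is deterministic, the rules
  for basic statements are equivalences and serve as rewrite rules.\<close>

definition run :: "prog \<Rightarrow> state \<Rightarrow> (nat \<Rightarrow> state \<Rightarrow> bool) \<Rightarrow> bool" where
  "run P s Q \<longleftrightarrow> (\<exists>t s'. exec w P s t s' \<and> Q t s')"

lemma run_mono: "run P s Q \<Longrightarrow> (\<And>t s'. Q t s' \<Longrightarrow> Q' t s') \<Longrightarrow> run P s Q'"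
  unfolding run_def by blast

lemma run_frame:
  "run P s Q \<Longrightarrow> (\<And>t s'. Q t s' \<Longrightarrow> frame (wregs P) (warrs P) s s' \<Longrightarrow> (silent P \<Longrightarrow> outp s' = outp s) \<Longrightarrow> Q' t s')
    \<Longrightarrow> run P s Q'"
  unfolding run_def using exec_frame exec_silent by blast

lemma run_exec: "exec w P s t s' \<Longrightarrow> run P s Q \<longleftrightarrow> Q t s'"
  unfolding run_def using exec_deterministic by blast

lemma run_Skip [simp]: "run Skip s Q \<longleftrightarrow> Q 1 s"
  by (rule run_exec[OF exec.Skip])

lemma run_Assign [simp]: "run (Assign r e) s Q \<longleftrightarrow> fits Z s e \<and> Q (1 + expr_cost e) (setr r (expr_val s e) s)"
proof (cases "fits Z s e")
  case True
  then have "expr_fits w s e" by (simp add: expr_fits_iff Z)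
  from run_exec[OF exec.Assign[OF this]] True show ?thesis by (simp add: setr_def)
next
  case False
  then have "\<not> expr_fits w s e" by (simp add: expr_fits_iff Z)
  then show ?thesis using False unfolding run_def by (auto elim: AssignE)
qed

lemma run_st [simp]: "run (st j a e) s Q \<longleftrightarrow> fits Z s (cell j a) \<and> fits Z s e
    \<and> Q (5 + expr_cost a + expr_cost e) (seta j (expr_val s a) (expr_val s e) s)"
proof (cases "fits Z s (cell j a) \<and> fits Z s e")
  case True
  then have "expr_fits w s (cell j a)" "expr_fits w s e" by (simp_all add: expr_fits_iff Z)
  from run_exec[OF exec.Store[OF this]] True show ?thesis by (simp add: seta_def st_def)
next
  case False
  then have "\<not> (expr_fits w s (cell j a) \<and> expr_fits w s e)" by (simp add: expr_fits_iff Z)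
  then show ?thesis using False unfolding run_def st_def by (auto elim: StoreE)
qed

lemma run_Write [simp]: "run (Write e) s Q \<longleftrightarrow> fits Z s e \<and> Q (1 + expr_cost e) (emit (expr_val s e) s)"
proof (cases "fits Z s e")
  case True
  then have "expr_fits w s e" by (simp add: expr_fits_iff Z)
  from run_exec[OF exec.Write[OF this]] True show ?thesis by (simp add: emit_def)
next
  case False
  then have "\<not> expr_fits w s e" by (simp add: expr_fits_iff Z)
  then show ?thesis using False unfolding run_def by (auto elim: WriteE)
qed

lemma run_Seq: "run (Seq P R) s Q \<longleftrightarrow> run P s (\<lambda>t s'. run R s' (\<lambda>t' s''. Q (t + t') s''))"
proof
  assume "run (Seq P R) s Q"
  then show "run P s (\<lambda>t s'. run R s' (\<lambda>t' s''. Q (t + t') s''))"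
    unfolding run_def by (auto elim!: SeqE)
next
  assume "run P s (\<lambda>t s'. run R s' (\<lambda>t' s''. Q (t + t') s''))"
  then show "run (Seq P R) s Q" unfolding run_def by (meson exec.Seq)
qed

lemma run_Cond: "run (Cond e P R) s Q \<longleftrightarrow> fits Z s e \<and>
    (if expr_val s e \<noteq> 0 then run P s (\<lambda>t. Q (1 + expr_cost e + t)) else run R s (\<lambda>t. Q (1 + expr_cost e + t)))"
    (is "?L \<longleftrightarrow> ?R")
proof
  assume ?L
  then obtain t s' where ts: "exec w (Cond e P R) s t s'" "Q t s'" unfolding run_def by blast
  from ts(1) show ?R
    using ts(2) by (cases rule: CondE) (auto simp: run_def expr_fits_iff Z)
next
  assume ?R
  then have f: "expr_fits w s e" by (simp add: expr_fits_iff Z)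
  show ?L
  proof (cases "expr_val s e = 0")
    case True
    with \<open>?R\<close> f exec.CondFalse[OF f True] show ?thesis unfolding run_def by (simp, meson)
  next
    case False
    with \<open>?R\<close> f exec.CondTrue[OF f False] show ?thesis unfolding run_def by (simp, meson)
  qed
qed

lemma run_seq:
  assumes "run P s Q1"
    and "\<And>t s'. Q1 t s' \<Longrightarrow> frame (wregs P) (warrs P) s s' \<Longrightarrow> (silent P \<Longrightarrow> outp s' = outp s)
      \<Longrightarrow> run R s' (\<lambda>t' s''. Q (t + t') s'')"
  shows "run (Seq P R) s Q"
  unfolding run_Seq by (rule run_frame[OF assms(1)]) (rule assms(2))

text \<open>The invariant is indexed by the number of completed rounds and \<open>N\<close> is the
  exact number of rounds, so termination and running time come out together. The body may use the
  frame relative to the state before the loop.\<close>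

lemma run_for:
  assumes init: "I 0 s"
    and body: "\<And>i s'. i < N \<Longrightarrow> I i s' \<Longrightarrow> frame (wregs P) (warrs P) s s' \<Longrightarrow> (silent P \<Longrightarrow> outp s' = outp s) \<Longrightarrow>
      fits Z s' e \<and> expr_val s' e \<noteq> 0 \<and> run P s' (\<lambda>t s''. t \<le> c i \<and> I (Suc i) s'')"
    and finish: "\<And>s'. I N s' \<Longrightarrow> frame (wregs P) (warrs P) s s' \<Longrightarrow> fits Z s' e \<and> expr_val s' e = 0"
    and post: "\<And>t s'. I N s' \<Longrightarrow> frame (wregs P) (warrs P) s s' \<Longrightarrow> (silent P \<Longrightarrow> outp s' = outp s) \<Longrightarrow>
      t \<le> (\<Sum>i<N. c i + (1 + expr_cost e)) + (1 + expr_cost e) \<Longrightarrow> Q t s'"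
  shows "run (While e P) s Q"
proof -
  let ?fr = "\<lambda>s'. frame (wregs P) (warrs P) s s' \<and> (silent P \<longrightarrow> outp s' = outp s)"
  have "run (While e P) s' (\<lambda>t s''. I N s'' \<and> ?fr s'' \<and>
      t \<le> (\<Sum>i\<in>{i..<N}. c i + (1 + expr_cost e)) + (1 + expr_cost e))"
    if "i \<le> N" "I i s'" "?fr s'" for i s'
    using that
  proof (induction "N - i" arbitrary: i s')
    case 0
    then have [simp]: "i = N" by simp
    have "exec w (While e P) s' (1 + expr_cost e) s'"
      using finish[of s'] 0 by (intro exec.WhileFalse) (auto simp: expr_fits_iff Z)
    then show ?case using 0 unfolding run_def by auto
  next
    case (Suc m)
    then have i: "i < N" by simp
    obtain t s1 where 1: "exec w P s' t s1" "t \<le> c i" "I (Suc i) s1"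
      and e: "fits Z s' e" "expr_val s' e \<noteq> 0"
      using body[OF i, of s'] Suc.prems unfolding run_def by blast
    have "?fr s1"
      using Suc.prems frame_trans[OF _ exec_frame[OF 1(1)], of "wregs P" "warrs P" s] exec_silent[OF 1(1)] by auto
    moreover have m: "m = N - Suc i" using Suc.hyps(2) by simp
    ultimately obtain t' s2 where 2: "exec w (While e P) s1 t' s2" "I N s2" "?fr s2"
      "t' \<le> (\<Sum>i\<in>{Suc i..<N}. c i + (1 + expr_cost e)) + (1 + expr_cost e)"
      using Suc.hyps(1)[OF m Suc_leI[OF i] 1(3)] unfolding run_def by blast
    have "exec w (While e P) s' (1 + expr_cost e + t + t') s2"
      using 1 2 e by (intro exec.WhileTrue) (auto simp: expr_fits_iff Z)
    moreover have "1 + expr_cost e + t + t' \<le> (\<Sum>i\<in>{i..<N}. c i + (1 + expr_cost e)) + (1 + expr_cost e)"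
      using 1(2) 2(4) i by (simp add: sum.atLeast_Suc_lessThan)
    ultimately show ?case using 2 unfolding run_def by blast
  qed
  from this[of 0 s] init show ?thesis
    unfolding run_def using post by (auto simp: atLeast0LessThan)
qed

end

section \<open>The program\<close>

abbreviation add_expr (infixl "\<oplus>" 65) where "a \<oplus> b \<equiv> Bin Plus a b"
abbreviation sub_expr (infixl "\<ominus>" 65) where "a \<ominus> b \<equiv> Bin Minus a b"
abbreviation mul_expr (infixl "\<otimes>" 70) where "a \<otimes> b \<equiv> Bin Times a b"
abbreviation div_expr (infixl "\<oslash>" 70) where "a \<oslash> b \<equiv> Bin Quot a b"
abbreviation mod_expr (infixl "\<odot>" 70) where "a \<odot> b \<equiv> Bin Rem a b"
abbreviation seq_prog (infixr ";;" 55) where "P ;; Q \<equiv> Seq P Q"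
abbreviation assign (infix "::=" 60) where "r ::= e \<equiv> Assign r e"

text \<open>The registers 0 to 4 are those in which the input is passed.\<close>

abbreviation (input) "rn \<equiv> 0 :: nat"
abbreviation (input) "rk \<equiv> 1 :: nat"
abbreviation (input) "rl \<equiv> 2 :: nat"
abbreviation (input) "rp \<equiv> 3 :: nat"
abbreviation (input) "rq \<equiv> 4 :: nat"
abbreviation (input) "rA \<equiv> 5 :: nat"
abbreviation (input) "r\<beta> \<equiv> 6 :: nat"
abbreviation (input) "rB \<equiv> 7 :: nat"
abbreviation (input) "rK \<equiv> 8 :: nat"
abbreviation (input) "rM \<equiv> 9 :: nat"
abbreviation (input) "rW \<equiv> 10 :: nat"
abbreviation (input) "rV \<equiv> 11 :: nat"
abbreviation (input) "rL \<equiv> 12 :: nat"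
abbreviation (input) "rQ \<equiv> 13 :: nat"
abbreviation (input) "rU \<equiv> 14 :: nat"
abbreviation (input) "rz \<equiv> 15 :: nat"
abbreviation (input) "rP \<equiv> 16 :: nat"
abbreviation (input) "rx \<equiv> 17 :: nat"
abbreviation (input) "ra \<equiv> 18 :: nat"
abbreviation (input) "rv \<equiv> 19 :: nat"
abbreviation (input) "rf \<equiv> 20 :: nat"
abbreviation (input) "ri \<equiv> 21 :: nat"
abbreviation (input) "ry \<equiv> 22 :: nat"
abbreviation (input) "rs \<equiv> 23 :: nat"
abbreviation (input) "rt \<equiv> 24 :: nat"
abbreviation (input) "rc \<equiv> 25 :: nat"

abbreviation (input) "aX \<equiv> 0 :: nat"
abbreviation (input) "aC \<equiv> 1 :: nat"
abbreviation (input) "aD \<equiv> 2 :: nat"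
abbreviation (input) "aw \<equiv> 3 :: nat"
abbreviation (input) "ah \<equiv> 4 :: nat"
abbreviation (input) "aB \<equiv> 5 :: nat"
abbreviation (input) "aS \<equiv> 6 :: nat"

subsection \<open>The table of exclusive ors\<close>

lemma xor_halves: "(a::nat) XOR b = 2 * ((a div 2) XOR (b div 2)) + (a + b) mod 2"
  by (subst xor_nat_rec) (simp add: mod2_eq_if)

text \<open>Cell \<open>a * V + b\<close> is to hold \<open>a XOR b\<close>. It is computed from the
  entry for \<open>a div 2\<close> and \<open>b div 2\<close>, which lies earlier in the table, with
  the parity of \<open>a + b\<close> as last bit.\<close>

definition xor_table :: prog where
  "xor_table = rz ::= Const 0 ;;
    While (Reg rV \<otimes> Reg rV \<ominus> Reg rz)
      (st aX (Reg rz) (Const 2 \<otimes> ld aX (Reg rz \<oslash> Reg rV \<oslash> Const 2 \<otimes> Reg rV \<oplus> Reg rz \<odot> Reg rV \<oslash> Const 2)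
         \<oplus> (Reg rz \<oslash> Reg rV \<oplus> Reg rz \<odot> Reg rV) \<odot> Const 2) ;;
       rz ::= Reg rz \<oplus> Const 1)"

lemma xor_table_frame: "wregs xor_table = {rz}" "warrs xor_table = {aX}" "silent xor_table"
  by (simp_all add: xor_table_def)

lemma div_mod_lt: "(a::nat) < V \<Longrightarrow> b < U \<Longrightarrow> a * U + b < V * U"
  using div_less_iff_less_mult[of U "a * U + b" V] by simp

lemma (in ram) run_xor_table:
  assumes V: "regs s rV = V" "V = 2 ^ v" "0 < v" and zero: "\<And>i. arr s aX i = 0" and big: "16 * (V * V) + 16 < Z"
  shows "run xor_table s (\<lambda>t s'. t \<le> 50 * (V * V) + 10 \<and> (\<forall>a<V. \<forall>b<V. arr s' aX (a * V + b) = a XOR b))"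
proof -
  have V2: "2 \<le> V" using V by (cases v) auto
  have VV: "V \<le> V * V" by simp
  then have VZ: "V < Z" using big by linarith
  let ?idx = "\<lambda>z. z div V div 2 * V + z mod V div 2"
  \<comment> \<open>Entry 0 is the only one that refers to itself, and the initial memory content 0
    is already its correct value.\<close>
  have idx: "?idx z < z \<or> z = 0" "?idx z div V = z div V div 2" "?idx z mod V = z mod V div 2" for z
  proof -
    have m: "z mod V < V" using V2 by simp
    show "?idx z div V = z div V div 2" "?idx z mod V = z mod V div 2" using m by simp_all
    have z: "z = z div V * V + z mod V" by simp
    have "?idx z \<le> z div V * V + z mod V"
      by (intro add_mono mult_le_mono1) simp_all
    then have "?idx z \<le> z" by simp
    moreover have "z = 0" if "?idx z = z"
    proof -
      have "z div V div 2 = z div V" "z mod V div 2 = z mod V"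
        using \<open>?idx z div V = z div V div 2\<close> \<open>?idx z mod V = z mod V div 2\<close> unfolding that by simp_all
      then have "z div V = 0" "z mod V = 0" by simp_all
      then show "z = 0" using z by simp
    qed
    ultimately show "?idx z < z \<or> z = 0" by linarith
  qed
  have idx_le: "?idx z \<le> z" for z using idx(1)[of z] by auto
  show ?thesis unfolding xor_table_def run_Seq run_Assign
  proof (intro conjI, goal_cases)
    case 1
    show ?case using big by simp
  next
    case 2
    show ?case
  proof (rule run_for[where N = "V * V" and c = "\<lambda>_. 40" and
        I = "\<lambda>z s'. regs s' rz = z \<and> regs s' rV = V \<and>
          (\<forall>i. arr s' aX i = (if i < z then (i div V) XOR (i mod V) else 0))"], goal_cases)
    case (2 z s')
    have arr: "arr s' aX (?idx z) = (z div V div 2) XOR (z mod V div 2)"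
      using 2 idx[of z] by auto
    have x: "2 * ((z div V div 2) XOR (z mod V div 2)) + (z div V + z mod V) mod 2 = (z div V) XOR (z mod V)"
      by (rule xor_halves[symmetric])
    have lt: "z div V < V" "z mod V < V" using 2 V2 by (simp_all add: less_mult_imp_div_less)
    have "(z div V) XOR (z mod V) < V" unfolding V(2) using lt V by (intro xor_less_power) auto
    moreover have "(z div V + z mod V) mod 2 < 2" by simp
    ultimately show ?case
      using 2(1,2) arr x idx[of z] idx_le[of z] big VV lt
      by (simp add: run_Seq, (intro conjI; linarith))
  next
    case (4 t s')
    then have t: "t \<le> V * V * 46 + 6" by simp
    have "arr s' aX (a * V + b) = a XOR b" if "a < V" "b < V" for a b
      using 4 div_mod_lt[OF that] that by simp
    then show ?case using t by simp
  qed (use V(1) zero big VZ in \<open>auto\<close>)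
  qed
qed

subsection \<open>Sieving reducible polynomials\<close>

text \<open>Carry-less multiplication: the product of polynomials transported to words.\<close>

definition cmul :: "nat \<Rightarrow> nat \<Rightarrow> nat" where
  "cmul a b = inv bpoly (bpoly a * bpoly b)"

lemma bpoly_cmul: "bpoly (cmul a b) = bpoly a * bpoly b"
  unfolding cmul_def by (rule f_inv_into_f) (metis surj_bpoly rangeI)

lemma double_xor_parity: "(2 * (b div 2)) XOR (b mod 2) = (b :: nat)"
proof -
  have "b mod 2 div 2 = 0" by simp
  then show ?thesis by (subst xor_halves) simp
qed

text \<open>Horner's rule in the binary digits of \<open>b\<close>; this recursion fills the product
  table of the sieve.\<close>

lemma cmul_rec: "cmul a b = (2 * cmul a (b div 2)) XOR (b mod 2 * a)"
proof -
  have b: "bpoly b = pCons 0 (bpoly (b div 2)) + bpoly (b mod 2)"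
    by (metis bpoly_double bpoly_xor double_xor_parity)
  have m: "bpoly a * bpoly (b mod 2) = bpoly (b mod 2 * a)"
    by (cases "even b") (auto simp: odd_iff_mod_2_eq_one)
  have "bpoly (cmul a b) = bpoly ((2 * cmul a (b div 2)) XOR (b mod 2 * a))"
    by (simp only: bpoly_cmul bpoly_xor bpoly_double b distrib_left m mult_pCons_right smult_0_left add_0_left)
  then show ?thesis by (simp only: bpoly_eq_iff)
qed

lemma cmul_0 [simp]: "cmul a 0 = 0"
proof -
  have "bpoly (cmul a 0) = bpoly 0" by (simp only: bpoly_cmul) simp
  then show ?thesis by (simp only: bpoly_eq_iff)
qed

lemma cmul_less:
  assumes "a < 2 ^ i" "b < 2 ^ j"
  shows "cmul a b < 2 ^ (i + j)"
proof (cases "a = 0 \<or> b = 0")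
  case True
  then have "bpoly (cmul a b) = 0" unfolding bpoly_cmul by auto
  then show ?thesis by simp
next
  case False
  then have nz: "bpoly a \<noteq> 0" "bpoly b \<noteq> 0" by auto
  then have c: "cmul a b \<noteq> 0" using bpoly_cmul[of a b] by (metis bpoly_0 mult_eq_0_iff)
  have "degree (bpoly (cmul a b)) = degree (bpoly a) + degree (bpoly b)"
    unfolding bpoly_cmul using nz by (rule degree_mult_eq)
  then have "degree (bpoly (cmul a b)) < i + j"
    using degree_bpoly[of a i] degree_bpoly[of b j] False assms by simp
  then show ?thesis using degree_bpoly[OF c] by blast
qed

text \<open>In a nontrivial factorisation both degrees lie between 1 and \<open>r - 1\<close>, which
  for words is the range from 2 to below \<open>2 ^ r\<close>. A table of \<open>W * W\<close>
  products thus decides irreducibility.\<close>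

lemma reducible_iff_cmul:
  assumes f: "2 ^ r \<le> f" "f < 2 * 2 ^ r" and r: "0 < r"
  shows "\<not> irreducible (bpoly f) \<longleftrightarrow> (\<exists>a b. 2 \<le> a \<and> a < 2 ^ r \<and> 2 \<le> b \<and> b < 2 ^ r \<and> cmul a b = f)"
proof -
  have "0 < f" using f(1) by (rule order_less_le_trans[rotated]) simp
  then have deg: "degree (bpoly f) = r" using degree_bpoly_eq[of f r] f by simp
  have d0: "degree (bpoly a) = 0 \<longleftrightarrow> a < 2" for a
    using degree_bpoly[of a 1] by (cases "a = 0") auto
  show ?thesis
  proof
    assume "\<not> irreducible (bpoly f)"
    then obtain p q where pq: "bpoly f = p * q" "degree p \<noteq> 0" "degree q \<noteq> 0"
      using irreducible_bit_poly_iff[of "bpoly f"] deg r by auto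
    obtain a b where ab: "bpoly a = p" "bpoly b = q" using surj_bpoly by metis
    have nz: "p \<noteq> 0" "q \<noteq> 0" "a \<noteq> 0" "b \<noteq> 0" using pq ab by (auto intro!: gr0I)
    have "degree p + degree q = r" using deg pq(1) degree_mult_eq[OF nz(1,2)] by simp
    then have "degree p < r" "degree q < r" using pq by auto
    then have "a < 2 ^ r" "b < 2 ^ r"
      using degree_bpoly[OF nz(3), of r] degree_bpoly[OF nz(4), of r] ab by simp_all
    moreover have "2 \<le> a" "2 \<le> b" using d0[of a] d0[of b] pq ab by auto
    moreover have "cmul a b = f" using pq(1) ab bpoly_cmul[of a b] by (simp add: bpoly_eq_iff[symmetric])
    ultimately show "\<exists>a b. 2 \<le> a \<and> a < 2 ^ r \<and> 2 \<le> b \<and> b < 2 ^ r \<and> cmul a b = f" by blast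
  next
    assume "\<exists>a b. 2 \<le> a \<and> a < 2 ^ r \<and> 2 \<le> b \<and> b < 2 ^ r \<and> cmul a b = f"
    then obtain a b where ab: "2 \<le> a" "2 \<le> b" "cmul a b = f" by blast
    then have "bpoly f = bpoly a * bpoly b" using bpoly_cmul[of a b] by simp
    moreover have "degree (bpoly a) \<noteq> 0" "degree (bpoly b) \<noteq> 0" using d0[of a] d0[of b] ab by auto
    ultimately show "\<not> irreducible (bpoly f)"
      using irreducible_bit_poly_iff[of "bpoly f"] deg r by auto
  qed
qed

text \<open>Array \<open>aC\<close> receives the product of \<open>a\<close> and \<open>b\<close> at
  index \<open>a * W + b\<close>, and \<open>aD\<close> marks the products of factors that are at
  least 2. As subtraction is truncated, the product of \<open>a - 1\<close> and \<open>b - 1\<close>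
  is nonzero exactly for such factors.\<close>

definition sieve :: prog where
  "sieve = rz ::= Const 0 ;;
    While (Reg rV \<ominus> Reg rz)
      (st aC (Reg rz) (ld aX (Const 2 \<otimes> ld aC (Reg rz \<oslash> Reg rW \<otimes> Reg rW \<oplus> Reg rz \<odot> Reg rW \<oslash> Const 2) \<otimes> Reg rV
         \<oplus> Reg rz \<odot> Reg rW \<odot> Const 2 \<otimes> (Reg rz \<oslash> Reg rW))) ;;
       Cond ((Reg rz \<oslash> Reg rW \<ominus> Const 1) \<otimes> (Reg rz \<odot> Reg rW \<ominus> Const 1)) (st aD (ld aC (Reg rz)) (Const 1)) Skip ;;
       rz ::= Reg rz \<oplus> Const 1)"

lemma sieve_frame: "wregs sieve = {rz}" "warrs sieve = {aC, aD}" "silent sieve"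
  by (auto simp add: sieve_def)

lemma (in ram) run_sieve:
  assumes W: "regs s rW = W" "regs s rV = V" "V = W * W" "W = 2 ^ r" "0 < r"
    and zero: "\<And>i. arr s aC i = 0" "\<And>i. arr s aD i = 0"
    and xor: "\<And>a b. a < V \<Longrightarrow> b < V \<Longrightarrow> arr s aX (a * V + b) = a XOR b" and big: "16 * (V * V) + 16 < Z"
  shows "run sieve s (\<lambda>t s'. t \<le> 100 * V + 10 \<and>
    (\<forall>f. arr s' aD f \<le> 1 \<and> (W \<le> f \<and> f < 2 * W \<longrightarrow> (arr s' aD f = 0 \<longleftrightarrow> irreducible (bpoly f)))))"
proof -
  have W2: "2 \<le> W" using W by (cases r) auto
  have WV: "W \<le> V" "V \<le> V * V" unfolding W(3) by simp_all
  have V2: "2 \<le> V" using WV W2 by simp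
  let ?idx = "\<lambda>z. z div W * W + z mod W div 2"
  define mark where "mark z y \<longleftrightarrow> (\<exists>i<z. 2 \<le> i div W \<and> 2 \<le> i mod W \<and> cmul (i div W) (i mod W) = y)" for z y
  show ?thesis unfolding sieve_def run_Seq run_Assign
  proof (intro conjI, goal_cases)
    case 1
    show ?case using big by simp
  next
    case 2
    show ?case
  proof (rule run_for[where N = V and c = "\<lambda>_. 80" and
        I = "\<lambda>z s'. regs s' rz = z \<and>
          (\<forall>i. arr s' aC i = (if i < z then cmul (i div W) (i mod W) else 0)) \<and>
          (\<forall>y. arr s' aD y = of_bool (mark z y))"], goal_cases)
    case (2 z s')
    have fr: "frame {rz} {aC, aD} (setr rz 0 s) s'" using 2(3) by (simp add: insert_commute)
    have regs: "regs s' rW = W" "regs s' rV = V" "regs s' rz = z"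
      using frame_regs[OF fr] 2(2) W by simp_all
    have X: "arr s' aX (a * V + b) = a XOR b" if "a < V" "b < V" for a b
      using frame_arr[OF fr, of aX] xor[OF that] by simp
    have lt: "z div W < W" "z mod W < W" using 2(1) W2 by (simp_all add: less_mult_imp_div_less W(3))
    have "z mod W div 2 < W" by (rule le_less_trans[OF div_le_dividend lt(2)])
    then have idx: "?idx z div W = z div W" "?idx z mod W = z mod W div 2" by simp_all
    have idx_le: "?idx z \<le> z"
    proof -
      have "?idx z \<le> z div W * W + z mod W" by (intro add_mono) simp_all
      then show ?thesis by simp
    qed
    \<comment> \<open>For \<open>z mod W = 0\<close> the entry refers to itself, and the initial 0
      is the product with 0.\<close>
    have c: "arr s' aC (?idx z) = cmul (z div W) (z mod W div 2)"
    proof (cases "?idx z < z")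
      case True
      then show ?thesis using 2(2) idx by simp
    next
      case False
      then have "?idx z mod W = z mod W" using idx_le by simp
      then have "z mod W = 0" using idx(2) by simp
      then show ?thesis using 2(2) False by simp
    qed
    obtain r' where r': "r = Suc r'" using W(5) by (cases r) auto
    have "z mod W < 2 * 2 ^ r'" using lt(2) W(4) r' by simp
    then have "z mod W div 2 < 2 ^ r'" by (rule less_mult_imp_div_less[of _ "2 ^ r'" 2, unfolded mult.commute[of _ 2]])
    then have "cmul (z div W) (z mod W div 2) < 2 ^ (r + r')"
      using lt(1) unfolding W(4) by (intro cmul_less)
    \<comment> \<open>Halving the second factor saves one bit, so even the doubled product is a
      valid row of the table of exclusive ors.\<close>
    then have c2: "2 * cmul (z div W) (z mod W div 2) < V"
      unfolding W(3,4) r' by (simp add: power_add)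
    have "z mod W mod 2 * (z div W) \<le> 1 * (z div W)" by (intro mult_le_mono1) simp
    then have m: "z mod W mod 2 * (z div W) < V" using lt(1) WV(1) by linarith
    have res: "arr s' aX (2 * cmul (z div W) (z mod W div 2) * V + z mod W mod 2 * (z div W)) = cmul (z div W) (z mod W)"
      using X[OF c2 m] cmul_rec[of "z div W" "z mod W"] by simp
    have cV: "cmul (z div W) (z mod W) < V"
      using cmul_less[of "z div W" r "z mod W" r] lt unfolding W(3,4) by (simp add: power_add)
    have bnd: "2 * cmul (z div W) (z mod W div 2) * V + z mod W mod 2 * (z div W) < V * V"
      by (rule div_mod_lt[OF c2 m])
    have "(z div W - 1) * (z mod W - 1) \<le> W * W" 
      by (intro mult_le_mono le_trans[OF diff_le_self less_imp_le[OF lt(1)]] le_trans[OF diff_le_self less_imp_le[OF lt(2)]])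
    then have bnd2: "(z div W - 1) * (z mod W - 1) \<le> V" unfolding W(3) .
    have mark: "mark (Suc z) y \<longleftrightarrow> mark z y \<or> (2 \<le> z div W \<and> 2 \<le> z mod W \<and> cmul (z div W) (z mod W) = y)" for y
      by (auto simp: mark_def less_Suc_eq)
    have cond: "(z div W - 1) * (z mod W - 1) = 0 \<longleftrightarrow> \<not> (2 \<le> z div W \<and> 2 \<le> z mod W)" by auto
    have bnd3: "2 * cmul (z div W) (z mod W div 2) * V < V * V" by (rule le_less_trans[OF le_add1 bnd])
    have bnds: "z div W * W \<le> z" "z mod W mod 2 < 2" "z mod W div 2 < W" by (simp_all add: \<open>z mod W div 2 < W\<close>)
    \<comment> \<open>With names for the nonlinear terms, most of the size conditions become
      linear.\<close>
    obtain a b d i e b2 j ab where abd: "z div W = a" "z mod W = b" "b div 2 = b2" "cmul a b2 = d" "a * W + b2 = i"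
      "b mod 2 * a = e"
      "2 * d * V + e = j" "cmul a b = ab" by blast
    note unf = abd
    have small: "8 < Z" "z < Z" "W < Z" "V < Z" "V - z < Z" "8 * z + 1 < Z" "8 * z + 2 < Z" "z + 1 < Z" "a < Z" "b < Z"
      "a * W < Z" "i < Z" "8 * i + 1 < Z" "b2 < Z" "2 * d * V < Z" "2 * d < Z" "d < Z" "e < Z" "b mod 2 < Z"
      "j < Z" "8 * j < Z" "ab < Z" "8 * ab + 2 < Z" "a - 1 < Z" "b - 1 < Z" "(a - 1) * (b - 1) < Z"
      using 2(1) big WV W2 idx_le[unfolded unf] lt[unfolded unf] cV[unfolded unf] bnd[unfolded unf] bnd2[unfolded unf]
        c2[unfolded unf] m[unfolded unf] bnd3[unfolded unf] bnds[unfolded unf] by linarith+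
    note facts' = regs c[unfolded unf] res[unfolded unf] small
    have I: "\<forall>i. arr s' aC i = (if i < z then cmul (i div W) (i mod W) else 0)" "\<forall>y. arr s' aD y = of_bool (mark z y)"
      using 2(2) by blast+
    show ?case
    proof (cases "2 \<le> a \<and> 2 \<le> b")
      case True
      then have "(a - 1) * (b - 1) \<noteq> 0" "mark (Suc z) y \<longleftrightarrow> mark z y \<or> ab = y" for y
        using mark[of y, unfolded unf] cond[unfolded unf] by auto
      then show ?thesis
        using facts' I 2(1) abd by (simp add: run_Seq run_Cond less_Suc_eq)
    next
      case False
      then have "(a - 1) * (b - 1) = 0" "mark (Suc z) y \<longleftrightarrow> mark z y" for y
        using mark[of y, unfolded unf] cond[unfolded unf] by blast+
      then show ?thesis
        using facts' I 2(1) abd by (simp add: run_Seq run_Cond less_Suc_eq)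
    qed
  next
    case (4 t s')
    have "arr s' aD f = 0 \<longleftrightarrow> irreducible (bpoly f)" if f: "W \<le> f" "f < 2 * W" for f
    proof -
      have "mark V f \<longleftrightarrow> (\<exists>a b. 2 \<le> a \<and> a < W \<and> 2 \<le> b \<and> b < W \<and> cmul a b = f)"
        unfolding mark_def
      proof
        assume "\<exists>i<V. 2 \<le> i div W \<and> 2 \<le> i mod W \<and> cmul (i div W) (i mod W) = f"
        then obtain i where i: "i < V" "2 \<le> i div W" "2 \<le> i mod W" "cmul (i div W) (i mod W) = f" by blast
        moreover have "i div W < W" "i mod W < W" using i(1) W2 by (simp_all add: W(3) less_mult_imp_div_less)
        ultimately show "\<exists>a b. 2 \<le> a \<and> a < W \<and> 2 \<le> b \<and> b < W \<and> cmul a b = f" by blast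
      next
        assume "\<exists>a b. 2 \<le> a \<and> a < W \<and> 2 \<le> b \<and> b < W \<and> cmul a b = f"
        then obtain a b where ab: "2 \<le> a" "a < W" "2 \<le> b" "b < W" "cmul a b = f" by blast
        then show "\<exists>i<V. 2 \<le> i div W \<and> 2 \<le> i mod W \<and> cmul (i div W) (i mod W) = f"
          using div_mod_lt[OF ab(2,4)] W(3) by (intro exI[of _ "a * W + b"]) simp
      qed
      moreover have "arr s' aD f = of_bool (mark V f)" using 4(1) by blast
      ultimately show ?thesis using reducible_iff_cmul[of r f] f W(4,5) by auto
    qed
    moreover have "arr s' aD f \<le> 1" for f using 4(1) by simp
    ultimately show ?case using 4(4) by simp
  next
    case 1
    show ?case using zero by (simp add: mark_def)
  next
    case (3 s')
    have "regs s' rV = V" using frame_regs[OF 3(2), of rV] W(2) by simp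
    moreover have "V < Z" using WV big by linarith
    ultimately show ?case using 3(1) by simp
  qed
  qed
qed

subsection \<open>One coordinate of the code\<close>

text \<open>The sum starts at 1 because every linear function vanishes at the zero word.\<close>

definition wsum :: "(nat \<Rightarrow> nat) \<Rightarrow> nat \<Rightarrow> nat" where
  "wsum u Q = (\<Sum>x\<in>{1..<Q}. u x)"

text \<open>The weight of the words \<open>P + x\<close>, \<open>x < P\<close>, that become zeros if
  \<open>v\<close> is chosen as the value at the power of two \<open>P\<close>: their value is then
  \<open>h x XOR v\<close>.\<close>

definition bucket :: "(nat \<Rightarrow> nat) \<Rightarrow> (nat \<Rightarrow> nat) \<Rightarrow> nat \<Rightarrow> nat \<Rightarrow> nat" where
  "bucket u h P v = (\<Sum>x<P. if h x = v then u (P + x) else 0)"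

text \<open>The invariant of the greedy choice: \<open>h\<close> is linear on words of
  \<open>m\<close> bits, and its zeros carry at most the fraction \<open>1 / M\<close> of the
  weight, the average over all linear functions.\<close>

definition code_fun :: "nat \<Rightarrow> (nat \<Rightarrow> nat) \<Rightarrow> nat \<Rightarrow> (nat \<Rightarrow> nat) \<Rightarrow> bool" where
  "code_fun M u m h \<longleftrightarrow> (\<forall>x<2 ^ m. h x < M) \<and> (\<forall>x<2 ^ m. \<forall>y<2 ^ m. h (x XOR y) = h x XOR h y) \<and>
     M * wsum (\<lambda>x. if h x = 0 then u x else 0) (2 ^ m) \<le> wsum u (2 ^ m)"

lemma add_power_eq_xor: "x < 2 ^ m \<Longrightarrow> 2 ^ m + x = (2 ^ m) XOR (x :: nat)"
proof -
  assume x: "x < 2 ^ m"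
  have "bit (2 ^ m + x) i \<longleftrightarrow> bit ((2 ^ m) XOR x) i" for i
    using x by (subst disjunctive_add) (auto simp: bit_or_iff bit_xor_iff bit_exp_iff not_bit_of_less)
  then show ?thesis by (simp add: bit_eq_iff)
qed

lemma sum_split_power:
  fixes g :: "nat \<Rightarrow> nat"
  assumes "1 \<le> P"
  shows "(\<Sum>x\<in>{1..<2 * P}. g x) = (\<Sum>x\<in>{1..<P}. g x) + (\<Sum>x<P. g (P + x))"
proof -
  have "(\<Sum>x<P. g (P + x)) = (\<Sum>x\<in>{P..<2 * P}. g x)"
    by (rule sum.reindex_bij_witness[of _ "\<lambda>x. x - P" "\<lambda>x. P + x"]) auto
  moreover have "(\<Sum>x\<in>{1..<P}. g x) + (\<Sum>x\<in>{P..<2 * P}. g x) = (\<Sum>x\<in>{1..<2 * P}. g x)"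
    using assms by (intro sum.atLeastLessThan_concat) auto
  ultimately show ?thesis by simp
qed

lemma wsum_double: "1 \<le> P \<Longrightarrow> wsum u (2 * P) = wsum u P + (\<Sum>x<P. u (P + x))"
  unfolding wsum_def by (rule sum_split_power)

lemma bucket_sum:
  assumes "\<And>x. x < P \<Longrightarrow> h x < M"
  shows "(\<Sum>v<M. bucket u h P v) = (\<Sum>x<P. u (P + x))"
  unfolding bucket_def using assms by (subst sum.swap) simp

lemma code_fun_0: "code_fun M u 0 h \<longleftrightarrow> h 0 = 0 \<and> 0 < M"
  by (auto simp: code_fun_def wsum_def xor_eq_0_iff)

text \<open>The \<open>M\<close> buckets share the weight of the words that contain the new bit, so
  the lightest one holds at most a fraction \<open>1 / M\<close> of it. Linearity determines the
  values at all these words from the value \<open>a\<close> at \<open>2 ^ m\<close>.\<close>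

lemma code_fun_Suc:
  assumes M: "M = 2 ^ b" and h: "code_fun M u m h" and a: "a < M"
    and min: "\<And>v. v < M \<Longrightarrow> bucket u h (2 ^ m) a \<le> bucket u h (2 ^ m) v"
    and h': "\<And>x. x < 2 ^ m \<Longrightarrow> h' x = h x" "\<And>x. x < 2 ^ m \<Longrightarrow> h' (2 ^ m + x) = h x XOR a"
  shows "code_fun M u (Suc m) h'"
  unfolding code_fun_def
proof (intro conjI allI impI)
  let ?P = "2 ^ m :: nat"
  have hM: "h x < M" if "x < ?P" for x using h that by (simp add: code_fun_def)
  have lin: "h (x XOR y) = h x XOR h y" if "x < ?P" "y < ?P" for x y
    using h that by (simp add: code_fun_def)
  \<comment> \<open>Writing a word as its lower part plus \<open>c\<close> times the new basis
    vector treats words with and without the new bit uniformly.\<close>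
  have rep: "\<exists>x0<?P. \<exists>c\<in>{0, 1}. x = x0 XOR c * ?P \<and> h' x = h x0 XOR c * a" if "x < 2 ^ Suc m" for x
  proof (cases "x < ?P")
    case True
    then show ?thesis using h' by (intro exI[of _ x] conjI bexI[of _ 0]) auto
  next
    case False
    then have "x - ?P < ?P" "x = ?P + (x - ?P)" using that by auto
    then show ?thesis using h'(2)[of "x - ?P"] add_power_eq_xor[of "x - ?P" m]
      by (intro exI[of _ "x - ?P"] conjI bexI[of _ 1]) (simp_all add: xor.commute)
  qed
  have h'x: "h' (x0 XOR c * ?P) = h x0 XOR c * a" if "x0 < ?P" "c \<in> {0, 1}" for x0 c
    using that h'[of x0] add_power_eq_xor[of x0 m] by (auto simp: xor.commute)
  fix x :: nat assume x: "x < 2 ^ Suc m"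
  obtain x0 c where xc: "x0 < ?P" "c \<in> {0, 1}" "x = x0 XOR c * ?P" "h' x = h x0 XOR c * a"
    using rep[OF x] by blast
  show "h' x < M"
    using xc(2,4) hM[OF xc(1)] a unfolding M by (auto intro: xor_less_power)
  fix y :: nat assume y: "y < 2 ^ Suc m"
  obtain y0 d where yd: "y0 < ?P" "d \<in> {0, 1}" "y = y0 XOR d * ?P" "h' y = h y0 XOR d * a"
    using rep[OF y] by blast
  \<comment> \<open>\<open>e\<close> is the sum of \<open>c\<close> and \<open>d\<close> modulo
    2.\<close>
  define e where "e = (if c = d then 0 else 1 :: nat)"
  have e: "c * z XOR d * z = e * z" for z
    using xc(2) yd(2) by (auto simp: e_def)
  have "x XOR y = (x0 XOR y0) XOR (c * ?P XOR d * ?P)"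
    unfolding xc(3) yd(3) by (simp only: xor.assoc xor.left_commute)
  then have "h' (x XOR y) = h' ((x0 XOR y0) XOR e * ?P)" by (simp only: e)
  also have "\<dots> = h (x0 XOR y0) XOR e * a"
    using xc(1) yd(1) by (intro h'x) (auto simp: e_def intro: xor_less_power)
  also have "\<dots> = (h x0 XOR h y0) XOR (c * a XOR d * a)" using lin[OF xc(1) yd(1)] by (simp only: e)
  also have "\<dots> = h' x XOR h' y" unfolding xc(4) yd(4) by (simp only: xor.assoc xor.left_commute)
  finally show "h' (x XOR y) = h' x XOR h' y" .
next
  let ?P = "2 ^ m :: nat"
  have hM: "h x < M" if "x < ?P" for x using h that by (simp add: code_fun_def)
  have "M * bucket u h ?P a \<le> (\<Sum>x<?P. u (?P + x))"
  proof -
    have "M * bucket u h ?P a = (\<Sum>v<M. bucket u h ?P a)" by simp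
    also have "\<dots> \<le> (\<Sum>v<M. bucket u h ?P v)" using min by (intro sum_mono) simp
    also have "\<dots> = (\<Sum>x<?P. u (?P + x))" by (rule bucket_sum) (rule hM)
    finally show ?thesis .
  qed
  moreover have "(\<Sum>x<?P. if h' (?P + x) = 0 then u (?P + x) else 0) = bucket u h ?P a"
    unfolding bucket_def by (intro sum.cong refl) (simp add: h'(2) xor_eq_0_iff)
  moreover have "wsum (\<lambda>x. if h' x = 0 then u x else 0) ?P = wsum (\<lambda>x. if h x = 0 then u x else 0) ?P"
    unfolding wsum_def by (intro sum.cong refl) (simp add: h'(1))
  moreover have "M * wsum (\<lambda>x. if h x = 0 then u x else 0) ?P \<le> wsum u ?P"
    using h by (simp add: code_fun_def)
  ultimately show "M * wsum (\<lambda>x. if h' x = 0 then u x else 0) (2 ^ Suc m) \<le> wsum u (2 ^ Suc m)"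
    by (simp add: wsum_double distrib_left)
qed

definition clear_buckets :: prog where
  "clear_buckets = rv ::= Const 0 ;;
    While (Reg rM \<ominus> Reg rv) (st aB (Reg rv) (Const 0) ;; rv ::= Reg rv \<oplus> Const 1)"

lemma clear_buckets_frame: "wregs clear_buckets = {rv}" "warrs clear_buckets = {aB}" "silent clear_buckets"
  by (simp_all add: clear_buckets_def)

lemma (in ram) run_clear_buckets:
  assumes M: "regs s rM = M" and big: "8 * M + 20 < Z"
  shows "run clear_buckets s (\<lambda>t s'. t \<le> 30 * M + 10 \<and> (\<forall>v<M. arr s' aB v = 0))"
  unfolding clear_buckets_def run_Seq run_Assign
proof (intro conjI, goal_cases)
  case 2
  show ?case
  proof (rule run_for[where N = M and c = "\<lambda>_. 20" and
        I = "\<lambda>z s'. regs s' rv = z \<and> regs s' rM = M \<and> (\<forall>v<z. arr s' aB v = 0)"], goal_cases)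
    case (2 z s')
    then show ?case using big by (simp add: run_Seq less_Suc_eq)
  qed (use M big in auto)
qed (use big in simp)

definition fill_buckets :: prog where
  "fill_buckets = rx ::= Const 0 ;;
    While (Reg rP \<ominus> Reg rx)
      (st aB (ld ah (Reg rx)) (ld aB (ld ah (Reg rx)) \<oplus> ld aw (Reg rP \<oplus> Reg rx)) ;;
       rx ::= Reg rx \<oplus> Const 1)"

lemma fill_buckets_frame: "wregs fill_buckets = {rx}" "warrs fill_buckets = {aB}" "silent fill_buckets"
  by (simp_all add: fill_buckets_def)

lemma (in ram) run_fill_buckets:
  assumes P: "regs s rP = P" and h: "\<And>x. x < P \<Longrightarrow> arr s ah x < M"
    and zero: "\<And>v. v < M \<Longrightarrow> arr s aB v = 0"
    and big: "8 * M + 20 < Z" "16 * P + 20 < Z" "(\<Sum>x<P. arr s aw (P + x)) < Z"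
  shows "run fill_buckets s (\<lambda>t s'. t \<le> 60 * P + 10 \<and> (\<forall>v<M. arr s' aB v = bucket (arr s aw) (arr s ah) P v))"
  unfolding fill_buckets_def run_Seq run_Assign
proof (intro conjI, goal_cases)
  case 2
  let ?g = "\<lambda>z v. \<Sum>x<z. if arr s ah x = v then arr s aw (P + x) else 0"
  show ?case
  proof (rule run_for[where N = P and c = "\<lambda>_. 50" and
        I = "\<lambda>z s'. regs s' rx = z \<and> (\<forall>v<M. arr s' aB v = ?g z v)"], goal_cases)
    case (2 z s')
    have fr: "frame {rx} {aB} (setr rx 0 s) s'" using 2(3) by (simp add: insert_commute)
    have facts: "regs s' rP = P" "arr s' ah = arr s ah" "arr s' aw = arr s aw"
      using frame_regs[OF fr] frame_arr[OF fr] P by simp_all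
    have g: "?g z v \<le> (\<Sum>x<P. arr s aw (P + x))" if "z \<le> P" for v z
    proof -
      have "?g z v \<le> (\<Sum>x<z. arr s aw (P + x))" by (intro sum_mono) simp
      also have "\<dots> \<le> (\<Sum>x<P. arr s aw (P + x))" using that by (intro sum_mono2) auto
      finally show ?thesis .
    qed
    have "?g z (arr s ah z) + arr s aw (P + z) = ?g (Suc z) (arr s ah z)" by simp
    also have "\<dots> < Z" using g[of "Suc z"] 2(1) big(3) by (meson Suc_leI le_less_trans)
    finally have lt: "?g z (arr s ah z) + arr s aw (P + z) < Z" .
    have hz: "arr s ah z < M" using h 2(1) by simp
    have eq: "arr s' aB (arr s ah z) = ?g z (arr s ah z)" using 2(2) hz by simp
    obtain v u G where abd: "arr s ah z = v" "arr s aw (P + z) = u" "arr s' aB v = G" by blast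
    have G: "G + u < Z" "v < M" using lt eq hz abd by simp_all
    have eq': "?g z v = G" using eq abd by simp
    show ?case using 2(1,2) facts G abd big(1,2) eq' by (simp add: run_Seq)
  next
    case (4 t s')
    then show ?case by (simp add: bucket_def)
  next
    case (3 s')
    have "regs s' rP = P" using frame_regs[OF 3(2), of rP] P by simp
    then show ?case using 3(1) big by simp
  qed (use P zero big in auto)
qed (use big in simp)

definition argmin :: prog where
  "argmin = ra ::= Const 0 ;; rv ::= Const 0 ;;
    While (Reg rM \<ominus> Reg rv)
      (Cond (ld aB (Reg ra) \<ominus> ld aB (Reg rv)) (ra ::= Reg rv) Skip ;; rv ::= Reg rv \<oplus> Const 1)"

lemma argmin_frame: "wregs argmin = {ra, rv}" "warrs argmin = {}" "silent argmin"
  by (simp_all add: argmin_def insert_commute)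

lemma (in ram) run_argmin:
  assumes M: "regs s rM = M" "0 < M" and big: "8 * M + 20 < Z" "\<And>v. v < M \<Longrightarrow> arr s aB v < Z"
  shows "run argmin s (\<lambda>t s'. t \<le> 60 * M + 20 \<and> regs s' ra < M \<and> (\<forall>v<M. arr s aB (regs s' ra) \<le> arr s aB v))"
  unfolding argmin_def run_Seq run_Assign
proof (intro conjI, goal_cases)
  case 3
  show ?case
  proof (rule run_for[where N = M and c = "\<lambda>_. 50" and
        I = "\<lambda>z s'. regs s' rv = z \<and> regs s' rM = M \<and> arr s' aB = arr s aB \<and> regs s' ra < M \<and>
          (\<forall>v<z. arr s aB (regs s' ra) \<le> arr s aB v)"], goal_cases)
    case (2 z s')
    then have "arr s aB z < Z" "arr s aB (regs s' ra) < Z" using big(2) by simp_all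
    then have b: "arr s aB z < Z" "arr s aB (regs s' ra) < Z" "arr s aB (regs s' ra) - arr s aB z < Z" "M - z < Z"
      using big(1) by linarith+
    show ?case
    proof (cases "arr s aB z < arr s aB (regs s' ra)")
      case True
      moreover have "\<forall>v<z. arr s aB z \<le> arr s aB v" using 2(2) True by (meson less_imp_le le_trans)
      ultimately show ?thesis using 2(1,2) b big(1) by (simp add: run_Seq run_Cond less_Suc_eq)
    next
      case False
      then show ?thesis using 2(1,2) b big(1) by (simp add: run_Seq run_Cond less_Suc_eq)
    qed
  qed (use M big(1) in auto)
qed (use big in simp_all)

definition extend_code :: prog where
  "extend_code = rx ::= Const 0 ;;
    While (Reg rP \<ominus> Reg rx)
      (st ah (Reg rP \<oplus> Reg rx) (ld aX (ld ah (Reg rx) \<otimes> Reg rV \<oplus> Reg ra)) ;; rx ::= Reg rx \<oplus> Const 1)"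

lemma extend_code_frame: "wregs extend_code = {rx}" "warrs extend_code = {ah}" "silent extend_code"
  by (simp_all add: extend_code_def)

lemma (in ram) run_extend_code:
  assumes P: "regs s rP = P" "regs s rV = V" "regs s ra = a" and h: "\<And>x. x < P \<Longrightarrow> arr s ah x < M"
    and M: "M \<le> V" "a < M" "M = 2 ^ b"
    and xor: "\<And>a b. a < V \<Longrightarrow> b < V \<Longrightarrow> arr s aX (a * V + b) = a XOR b"
    and big: "16 * (V * V) + 20 < Z" "16 * P + 20 < Z"
  shows "run extend_code s (\<lambda>t s'. t \<le> 60 * P + 10 \<and>
    (\<forall>x<P. arr s' ah x = arr s ah x \<and> arr s' ah (P + x) = arr s ah x XOR a))"
  unfolding extend_code_def run_Seq run_Assign
proof (intro conjI, goal_cases)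
  case 2
  show ?case
  proof (rule run_for[where N = P and c = "\<lambda>_. 50" and
        I = "\<lambda>z s'. regs s' rx = z \<and> (\<forall>x<P. arr s' ah x = arr s ah x) \<and> (\<forall>x<z. arr s' ah (P + x) = arr s ah x XOR a)"], goal_cases)
    case (2 z s')
    have fr: "frame {rx} {ah} (setr rx 0 s) s'" using 2(3) by (simp add: insert_commute)
    have facts: "regs s' rP = P" "regs s' rV = V" "regs s' ra = a" "arr s' aX = arr s aX"
      using frame_regs[OF fr] frame_arr[OF fr] P by simp_all
    have hz: "arr s ah z < M" using h 2(1) by simp
    have lt: "arr s ah z < V" "a < V" using hz M by simp_all
    have x: "arr s aX (arr s ah z * V + a) = arr s ah z XOR a" using xor[OF lt] .
    have "arr s ah z XOR a < M" using hz M by (auto intro: xor_less_power)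
    moreover have "arr s ah z * V + a < V * V" using lt by (rule div_mod_lt)
    moreover have "V \<le> V * V" by simp
    moreover have hz': "arr s' ah z = arr s ah z" using 2(1,2) by simp
    moreover have "\<forall>x<P. arr s' ah x = arr s ah x" "\<forall>x<z. arr s' ah (P + x) = arr s ah x XOR a" using 2(2) by blast+
    moreover obtain v k y where abd: "arr s ah z = v" "v * V + a = k" "v XOR a = y" by blast
    ultimately have F: "arr s' ah z = v" "arr s aX k = y" "k < V * V" "V \<le> V * V" "y < M" "v < M"
      "\<forall>x<P. arr s' ah x = arr s ah x" "\<forall>x<z. arr s' ah (P + x) = arr s ah x XOR a" using x hz by simp_all
    then have small: "k < Z" "8 * k < Z" "V < Z" "v < Z" "y < Z" "a < Z" "v * V < Z"
      using big(1) M lt abd(2) by linarith+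
    have small2: "8 * P + 8 * z + 4 < Z" "8 * z + 4 < Z" "z + 1 < Z" "P < Z" "P - z < Z" "P + z < Z"
      using big(2) \<open>z < P\<close> by linarith+
    show ?case using 2(1) 2(2) facts F small small2 abd by (simp add: run_Seq less_Suc_eq)
  next
    case (4 t s')
    then show ?case by simp
  next
    case (3 s')
    have "regs s' rP = P" using frame_regs[OF 3(2), of rP] P by simp
    then show ?case using 3(1) big by simp
  qed (use P big in auto)
qed (use big in simp)

definition greedy_step :: prog where
  "greedy_step = clear_buckets ;; fill_buckets ;; argmin ;; extend_code ;; rP ::= Const 2 \<otimes> Reg rP"

definition greedy :: prog where
  "greedy = st ah (Const 0) (Const 0) ;; rP ::= Const 1 ;; While (Reg rQ \<ominus> Reg rP) greedy_step"

lemma greedy_step_frame: "wregs greedy_step = {rP, rx, ra, rv}" "warrs greedy_step = {ah, aB}" "silent greedy_step"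
  by (auto simp: greedy_step_def clear_buckets_frame fill_buckets_frame argmin_frame extend_code_frame)

lemma greedy_frame: "wregs greedy = {rP, rx, ra, rv}" "warrs greedy = {ah, aB}" "silent greedy"
  by (auto simp: greedy_def greedy_step_frame)

lemma (in ram) run_greedy_step:
  assumes regs: "regs s rM = M" "regs s rV = V" "regs s rP = 2 ^ m" and M: "M = 2 ^ b" "M \<le> V"
    and xor: "\<And>a b. a < V \<Longrightarrow> b < V \<Longrightarrow> arr s aX (a * V + b) = a XOR b"
    and code: "code_fun M (arr s aw) m (arr s ah)"
    and big: "8 * M + 20 < Z" "16 * (V * V) + 20 < Z" "16 * 2 ^ m + 20 < Z" "wsum (arr s aw) (2 ^ Suc m) < Z"
  shows "run greedy_step s (\<lambda>t s'. t \<le> 120 * 2 ^ m + 90 * M + 60 \<and> regs s' rP = 2 ^ Suc m \<and>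
    code_fun M (arr s aw) (Suc m) (arr s' ah))"
  unfolding greedy_step_def
proof (rule run_seq[OF run_clear_buckets[OF regs(1) big(1)]], goal_cases)
  case (1 t1 s1)
  note fr1 = 1(2)[unfolded clear_buckets_frame]
  have a1: "regs s1 rM = M" "regs s1 rV = V" "regs s1 rP = 2 ^ m" "arr s1 aw = arr s aw" "arr s1 ah = arr s ah" "arr s1 aX = arr s aX"
    using frame_regs[OF fr1] frame_arr[OF fr1] regs by simp_all
  have hM: "arr s ah x < M" if "x < 2 ^ m" for x using code that by (simp add: code_fun_def)
  have tot: "(\<Sum>x<2 ^ m. arr s aw (2 ^ m + x)) < Z"
    using big(4) wsum_double[of "2 ^ m" "arr s aw"] by simp
  show ?case
  proof (rule run_seq[OF run_fill_buckets[OF a1(3), where M = M]], goal_cases)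
    case (6 t2 s2)
    note fr2 = 6(2)[unfolded fill_buckets_frame]
    have a2: "regs s2 rM = M" "regs s2 rV = V" "regs s2 rP = 2 ^ m" "arr s2 aw = arr s aw" "arr s2 ah = arr s ah" "arr s2 aX = arr s aX"
      using frame_regs[OF fr2] frame_arr[OF fr2] a1 by simp_all
    have B: "arr s2 aB v = bucket (arr s aw) (arr s ah) (2 ^ m) v" if "v < M" for v using 6(1) a1 that by simp
    have bZ: "arr s2 aB v < Z" if "v < M" for v
    proof -
      have "bucket (arr s aw) (arr s ah) (2 ^ m) v \<le> (\<Sum>x<2 ^ m. arr s aw (2 ^ m + x))"
        unfolding bucket_def by (intro sum_mono) simp
      then show ?thesis using B[OF that] tot by simp
    qed
    show ?case
    proof (rule run_seq[OF run_argmin[OF a2(1) _ big(1) bZ]], goal_cases)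
      case (3 t3 s3)
      note fr3 = 3(2)[unfolded argmin_frame]
      have a3: "regs s3 rV = V" "regs s3 rP = 2 ^ m" "arr s3 aw = arr s aw" "arr s3 ah = arr s ah" "arr s3 aX = arr s aX"
        using frame_regs[OF fr3] frame_arr[OF fr3] a2 by simp_all
      have xor3: "arr s3 aX (a * V + b) = a XOR b" if "a < V" "b < V" for a b
        using xor[OF that] a3 by simp
      show ?case
      proof (rule run_seq[OF run_extend_code[OF a3(2,1) refl, where M = M and b = b]], goal_cases)
        case (8 t4 s4)
        note fr4 = 8(2)[unfolded extend_code_frame]
        have a4: "regs s4 rP = 2 ^ m" using frame_regs[OF fr4] a3 by simp
        have "code_fun M (arr s aw) (Suc m) (arr s4 ah)"
        proof (rule code_fun_Suc[OF M(1) code])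
          show "regs s3 ra < M" using 3(1) by simp
          show "bucket (arr s aw) (arr s ah) (2 ^ m) (regs s3 ra) \<le> bucket (arr s aw) (arr s ah) (2 ^ m) v" if "v < M" for v
            using 3(1) B that by metis
          show "arr s4 ah x = arr s ah x" "arr s4 ah (2 ^ m + x) = arr s ah x XOR regs s3 ra" if "x < 2 ^ m" for x
            using 8(1) that a3(4) by simp_all
        qed
        moreover have "t1 + (t2 + (t3 + (t4 + 4))) \<le> 120 * 2 ^ m + 90 * M + 60"
          using 1(1) 6(1) 3(1) 8(1) by linarith
        ultimately show ?case using a4 big(3) by simp
      qed (use hM a3 3(1) M xor3 big in auto)
    qed (use M in auto)
  qed (use hM a1 1(1) big tot in auto)
qed

text \<open>Bit position \<open>m\<close> costs \<open>O(2 ^ m + M)\<close>; the geometric sum keeps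
  the dependence on \<open>2 ^ L\<close> linear.\<close>

lemma (in ram) run_greedy:
  assumes regs: "regs s rM = M" "regs s rV = V" "regs s rQ = 2 ^ L" and M: "M = 2 ^ b" "M \<le> V"
    and xor: "\<And>a b. a < V \<Longrightarrow> b < V \<Longrightarrow> arr s aX (a * V + b) = a XOR b"
    and big: "8 * M + 20 < Z" "16 * (V * V) + 20 < Z" "16 * 2 ^ L + 20 < Z" "wsum (arr s aw) (2 ^ L) < Z"
  shows "run greedy s (\<lambda>t s'. t \<le> 120 * 2 ^ L + 90 * (M * L) + 70 * L + 30 \<and> code_fun M (arr s aw) L (arr s' ah))"
  unfolding greedy_def run_Seq run_Assign run_st
proof (intro conjI, goal_cases)
  case 4
  show ?case
  proof (rule run_for[where N = L and c = "\<lambda>m. 120 * 2 ^ m + 90 * M + 60" and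
        I = "\<lambda>m s'. regs s' rP = 2 ^ m \<and> code_fun M (arr s aw) m (arr s' ah)"], goal_cases)
    case 1
    show ?case using M by (simp add: code_fun_0)
  next
    case (2 m s')
    note fr = 2(3)[unfolded greedy_step_frame]
    have a: "regs s' rM = M" "regs s' rV = V" "regs s' rQ = 2 ^ L" "arr s' aw = arr s aw" "arr s' aX = arr s aX"
      using frame_regs[OF fr] frame_arr[OF fr] regs by simp_all
    have mL: "(2::nat) ^ Suc m \<le> 2 ^ L" using 2(1) by (intro power_increasing) auto
    then have "(2::nat) * 2 ^ m \<le> 2 ^ L" by simp
    then have lt: "16 * 2 ^ m + 20 < Z" "2 ^ m < Z" using big(3) by linarith+
    have lt2: "(2::nat) ^ L - 2 ^ m < Z" "(2::nat) ^ L < Z" "(2::nat) ^ m < 2 ^ L" using big(3) 2(1) by auto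
    have "wsum (arr s aw) (2 ^ Suc m) \<le> wsum (arr s aw) (2 ^ L)"
      unfolding wsum_def using mL by (intro sum_mono2) auto
    then have w: "wsum (arr s' aw) (2 ^ Suc m) < Z" using big(4) a by simp
    have "run greedy_step s' (\<lambda>t s''. t \<le> 120 * 2 ^ m + 90 * M + 60 \<and> regs s'' rP = 2 ^ Suc m \<and>
      code_fun M (arr s' aw) (Suc m) (arr s'' ah))"
      using 2(2) a xor w big lt by (intro run_greedy_step[OF a(1,2) _ M]) auto
    moreover have "fits Z s' (Reg rQ \<ominus> Reg rP)" using a 2(2) lt lt2(1,2) by simp
    moreover have "expr_val s' (Reg rQ \<ominus> Reg rP) \<noteq> 0" using a 2(2) lt2(3) by simp
    ultimately show ?case using a by simp
  next
    case (3 s')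
    note fr = 3(2)[unfolded greedy_step_frame]
    have "regs s' rQ = 2 ^ L" using frame_regs[OF fr] regs by simp
    then show ?case using 3(1) big(3) by simp
  next
    case (4 t s')
    have "(\<Sum>i<L. 120 * 2 ^ i + 90 * M + 60 + 4 :: nat) = 120 * (\<Sum>i<L. 2 ^ i) + 90 * (M * L) + 64 * L"
      by (simp add: sum.distrib sum_distrib_left[symmetric])
    moreover have "(\<Sum>i<L. 2 ^ i :: nat) \<le> 2 ^ L" by (induction L) auto
    ultimately have "t \<le> 120 * 2 ^ L + 90 * (M * L) + 64 * L + 4" using 4(4) by simp
    then show ?case using 4(1) by simp
  qed
qed (use big in simp_all)

section \<open>The weights of the code words\<close>

definition init_weights :: prog where
  "init_weights = rx ::= Const 0 ;; While (Reg rQ \<ominus> Reg rx) (st aw (Reg rx) (Const 1) ;; rx ::= Reg rx \<oplus> Const 1)"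

lemma init_weights_frame: "wregs init_weights = {rx}" "warrs init_weights = {aw}" "silent init_weights"
  by (simp_all add: init_weights_def)

lemma (in ram) run_init_weights:
  assumes Q: "regs s rQ = Q" and big: "8 * Q + 20 < Z"
  shows "run init_weights s (\<lambda>t s'. t \<le> 30 * Q + 10 \<and> (\<forall>x<Q. arr s' aw x = 1))"
  unfolding init_weights_def run_Seq run_Assign
proof (intro conjI, goal_cases)
  case 2
  show ?case
  proof (rule run_for[where N = Q and c = "\<lambda>_. 20" and
        I = "\<lambda>z s'. regs s' rx = z \<and> regs s' rQ = Q \<and> (\<forall>x<z. arr s' aw x = 1)"], goal_cases)
    case (2 z s')
    then show ?case using big by (simp add: run_Seq less_Suc_eq)
  qed (use Q big in auto)
qed (use big in simp)

definition update_weights :: prog where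
  "update_weights = rx ::= Const 1 ;;
    While (Reg rQ \<ominus> Reg rx) (Cond (ld ah (Reg rx)) Skip (st aw (Reg rx) (Const 2 \<otimes> ld aw (Reg rx))) ;; rx ::= Reg rx \<oplus> Const 1)"

lemma update_weights_frame: "wregs update_weights = {rx}" "warrs update_weights = {aw}" "silent update_weights"
  by (simp_all add: update_weights_def)

lemma (in ram) run_update_weights:
  assumes Q: "regs s rQ = Q" "0 < Q" and h: "\<And>x. x < Q \<Longrightarrow> arr s ah x < Z"
    and big: "8 * Q + 20 < Z" "2 * wsum (arr s aw) Q < Z"
  shows "run update_weights s (\<lambda>t s'. t \<le> 60 * Q + 10 \<and>
    (\<forall>x. 1 \<le> x \<and> x < Q \<longrightarrow> arr s' aw x = (if arr s ah x = 0 then 2 * arr s aw x else arr s aw x)))"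
  unfolding update_weights_def run_Seq run_Assign
proof (intro conjI, goal_cases)
  case 2
  show ?case
  proof (rule run_for[where N = "Q - 1" and c = "\<lambda>_. 50" and
        I = "\<lambda>z s'. regs s' rx = Suc z \<and> regs s' rQ = Q \<and>
          (\<forall>x. arr s' aw x = (if 1 \<le> x \<and> x < Suc z \<and> arr s ah x = 0 then 2 * arr s aw x else arr s aw x))"], goal_cases)
    case (2 z s')
    note fr = 2(3)
    have a: "arr s' ah = arr s ah" using frame_arr[OF fr, of ah] by simp
    have "arr s aw (Suc z) \<le> wsum (arr s aw) Q"
      unfolding wsum_def using 2(1) by (intro member_le_sum) auto
    then have b: "2 * arr s aw (Suc z) < Z" "arr s aw (Suc z) < Z" using big(2) by linarith+
    have c: "arr s ah (Suc z) < Z" using h 2(1) by simp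
    have d: "8 * z + 20 < Z" "Q - Suc z < Z" "\<not> Q \<le> Suc z" using 2(1) big(1) by linarith+
    show ?case
    proof (cases "arr s ah (Suc z) = 0")
      case True
      then show ?thesis using 2(1,2) a b d big(1) by (auto simp add: run_Seq run_Cond less_Suc_eq)
    next
      case False
      then have "(x = Suc z \<or> x < Suc z) \<and> arr s ah x = 0 \<longleftrightarrow> x < Suc z \<and> arr s ah x = 0" for x by auto
      then show ?thesis using 2(1,2) a c d False big(1) by (auto simp add: run_Seq run_Cond less_Suc_eq)
    qed
  next
    case (4 t s')
    then show ?case using Q(2) by simp
  qed (use Q big in auto)
qed (use big in simp)

text \<open>Doubling adds the weight of the zeros once more, and this is at most a fraction
  \<open>1 / M\<close> of the total.\<close>

lemma wsum_update:
  assumes M: "M * wsum (\<lambda>x. if h x = 0 then u x else 0) Q \<le> wsum u Q"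
    and u': "\<And>x. 1 \<le> x \<Longrightarrow> x < Q \<Longrightarrow> u' x = (if h x = 0 then 2 * u x else u x)"
  shows "M * wsum u' Q \<le> (M + 1) * wsum u Q"
proof -
  have "wsum u' Q = wsum u Q + wsum (\<lambda>x. if h x = 0 then u x else 0) Q"
    unfolding wsum_def sum.distrib[symmetric] by (intro sum.cong refl) (auto simp: u')
  then show ?thesis using M by (simp add: algebra_simps)
qed

text \<open>\<open>(1 + 1 / M) ^ M \<le> exp 1 \<le> 4\<close>. The value 4 rather than 3 makes the
  final weight \<open>2 ^ L * 4 ^ L\<close> a power of two, whence the \<open>3 * L\<close> in
  \<open>good_code\<close>. The hypothesis \<open>le\<close> is cleared of denominators, so that the
  loop invariant stays in the natural numbers.\<close>

lemma weight_bound: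
  assumes "c \<le> M * L" "0 < M" and le: "M ^ c * x \<le> q * (M + 1) ^ c"
  shows "x \<le> q * 4 ^ L"
proof -
  let ?y = "1 + 1 / real M"
  have "?y ^ M \<le> exp (1 / real M) ^ M"
    by (intro power_mono) (simp_all add: exp_ge_add_one_self)
  also have "\<dots> = exp 1" using assms(2) by (simp flip: exp_of_nat_mult)
  also have "\<dots> \<le> 4" using exp_le by linarith
  finally have y: "?y ^ M \<le> 4" .
  have "real M ^ c * real x \<le> real q * real (M + 1) ^ c"
    using of_nat_mono[OF le, where 'a = real] by simp
  also have "real (M + 1) = real M * ?y" using assms(2) by (simp add: field_simps)
  finally have "real M ^ c * real x \<le> real M ^ c * (real q * ?y ^ c)" by (simp add: power_mult_distrib mult_ac)
  then have "real x \<le> real q * ?y ^ c" using assms(2) by simp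
  also have "\<dots> \<le> real q * ?y ^ (M * L)" using assms by (intro mult_left_mono power_increasing) auto
  also have "\<dots> = real q * (?y ^ M) ^ L" by (simp add: power_mult)
  also have "\<dots> \<le> real q * 4 ^ L" using y by (intro mult_left_mono power_mono) auto
  finally have "real x \<le> real (q * 4 ^ L)" by simp
  then show ?thesis by (simp only: of_nat_le_iff)
qed

subsection \<open>Writing the colourings\<close>

text \<open>Appends the parity of the register to the word and then performs one
  \<open>lfsr_step\<close>, with the exclusive or looked up. For the doubled state \<open>y\<close>,
  truncated subtraction expresses \<open>W \<le> y\<close> as
  \<open>y + 1 - W \<noteq> 0\<close>.\<close>

definition read_bit :: prog where
  "read_bit = rs ::= Const 2 \<otimes> Reg rs \<oplus> Reg ry \<odot> Const 2 ;; ry ::= Const 2 \<otimes> Reg ry ;;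
       Cond (Reg ry \<oplus> Const 1 \<ominus> Reg rW) (ry ::= ld aX (Reg ry \<otimes> Reg rV \<oplus> Reg rf)) Skip ;;
       rt ::= Reg rt \<oplus> Const 1"

definition read_word :: prog where
  "read_word = rs ::= Const 0 ;; rt ::= Const 0 ;; While (Reg r\<beta> \<ominus> Reg rt) read_bit"

lemma read_bit_frame: "wregs read_bit = {ry, rs, rt}" "warrs read_bit = {}" "silent read_bit"
  by (auto simp: read_bit_def)

lemma read_word_frame: "wregs read_word = {ry, rs, rt}" "warrs read_word = {}" "silent read_word"
  by (auto simp: read_word_def read_bit_frame)

lemma (in ram) run_read_word:
  assumes regs: "regs s r\<beta> = \<beta>" "regs s rW = W" "regs s rV = V" "regs s rf = f" "regs s ry = lfsr W f i y0"
    and W: "W = 2 ^ r" "V = W * W" "0 < r" "W \<le> f" "f < 2 * W" and y0: "y0 < W"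
    and xor: "\<And>a b. a < V \<Longrightarrow> b < V \<Longrightarrow> arr s aX (a * V + b) = a XOR b"
    and big: "16 * (V * V) + 20 < Z" "2 ^ \<beta> < Z" "\<beta> + 20 < Z"
  shows "run read_word s (\<lambda>t s'. t \<le> 80 * \<beta> + 10 \<and>
    regs s' rs = bits_val (\<lambda>t. odd (lfsr W f (i + t) y0)) \<beta> \<and> regs s' ry = lfsr W f (i + \<beta>) y0)"
  unfolding read_word_def run_Seq run_Assign
proof (intro conjI, goal_cases)
  case 3
  have W2: "2 \<le> W" using W by (cases r) auto
  then have WV: "2 * W \<le> V" "V \<le> V * V" unfolding W(2) by simp_all
  show ?case
  proof (rule run_for[where N = \<beta> and c = "\<lambda>_. 70" and
        I = "\<lambda>z s'. regs s' rt = z \<and> regs s' rs = bits_val (\<lambda>t. odd (lfsr W f (i + t) y0)) z \<and> regs s' ry = lfsr W f (i + z) y0"], goal_cases)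
    case 1
    show ?case using regs by simp
  next
    case (2 z s')
    note fr = 2(3)[unfolded read_bit_frame]
    have a: "regs s' r\<beta> = \<beta>" "regs s' rW = W" "regs s' rV = V" "regs s' rf = f" "arr s' aX = arr s aX"
      using frame_regs[OF fr] frame_arr[OF fr] regs by simp_all
    let ?bs = "bits_val (\<lambda>t. odd (lfsr W f (i + t) y0))"
    have bs: "2 * ?bs z + lfsr W f (i + z) y0 mod 2 = ?bs (Suc z)"
      by (simp add: odd_iff_mod_2_eq_one of_bool_def)
    have "?bs (Suc z) < 2 ^ Suc z" by (rule bits_val_less)
    also have "\<dots> \<le> 2 ^ \<beta>" using 2(1) by (intro power_increasing) auto
    also have "\<dots> < Z" by (rule big(2))
    finally have bsZ: "?bs (Suc z) < Z" .
    have step: "lfsr W f (i + Suc z) y0 = (if W \<le> 2 * lfsr W f (i + z) y0 then (2 * lfsr W f (i + z) y0) XOR f else 2 * lfsr W f (i + z) y0)"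
      by (simp add: lfsr_Suc lfsr_step_def)
    have yW: "lfsr W f (i + z) y0 < W" "lfsr W f (i + Suc z) y0 < W" using lfsr_less[OF W(1,4,5) y0] by blast+
    obtain y y' b b' where abd: "lfsr W f (i + z) y0 = y" "lfsr W f (i + Suc z) y0 = y'" "?bs z = b" "?bs (Suc z) = b'" by blast
    note unf = abd
    have yV: "2 * y < V" "f < V" using yW[unfolded unf] WV W by linarith+
    then have x: "arr s aX (2 * y * V + f) = (2 * y) XOR f" by (rule xor)
    have bnd: "2 * y * V + f < V * V" using yV by (rule div_mod_lt)
    have "y mod 2 < 2" by simp
    then have small: "z + 20 < Z" "y < Z" "2 * y + 1 < Z" "2 * y < Z" "W < Z" "V < Z" "f < Z" "b < Z" "2 * b < Z" "y mod 2 < Z" "b' < Z" "y' < Z"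
       "\<beta> < Z" "\<beta> - z < Z" "2 * y * V < Z" "2 * y * V + f < Z" "16 * y * V + 8 * f < Z" "2 * y + 1 - W < Z"
      using 2(1) big bsZ[unfolded unf] yW[unfolded unf] bs[unfolded unf] WV yV bnd W(4,5) by linarith+
    show ?case
    proof (cases "W \<le> 2 * y")
      case True
      then have "2 * y + 1 - W \<noteq> 0" "(2 * y) XOR f = y'" using step[unfolded unf] by simp_all
      then show ?thesis
        using 2(1,2) a small bs[unfolded unf] x abd
        by (simp add: read_bit_def run_Seq run_Cond)
    next
      case False
      then have "2 * y + 1 - W = 0" "2 * y = y'" using step[unfolded unf] by simp_all
      then show ?thesis
        using 2(1,2) a small bs[unfolded unf] abd
        by (simp add: read_bit_def run_Seq run_Cond)
    qed
  next
    case (3 s')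
    note fr = 3(2)[unfolded read_bit_frame]
    have "regs s' r\<beta> = \<beta>" using frame_regs[OF fr] regs by simp
    then show ?case using 3(1) big by simp
  next
    case (4 t s')
    then show ?case by simp
  qed
qed (use big in simp_all)

definition colour_step :: prog where
  "colour_step = read_word ;; st aS (Reg rv) (Reg rs \<odot> Reg rl \<oplus> Const 1) ;; rv ::= Reg rv \<oplus> Const 1"

definition fill_colours :: prog where
  "fill_colours = rv ::= Const 0 ;; While (Reg rM \<ominus> Reg rv) colour_step"

lemma colour_step_frame: "wregs colour_step = {rv, ry, rs, rt}" "warrs colour_step = {aS}" "silent colour_step"
  by (auto simp: colour_step_def read_word_frame)

lemma fill_colours_frame: "wregs fill_colours = {rv, ry, rs, rt}" "warrs fill_colours = {aS}" "silent fill_colours"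
  by (auto simp: fill_colours_def colour_step_frame)

text \<open>The register is not restarted between words: after \<open>z\<close> words it has made
  \<open>z * \<beta>\<close> steps, which is where the interval read by \<open>z\<close> begins. One
  pass therefore yields all \<open>M\<close> colours.\<close>

lemma (in ram) run_fill_colours:
  assumes regs: "regs s r\<beta> = \<beta>" "regs s rW = W" "regs s rV = V" "regs s rf = f" "regs s ry = y0" "regs s rM = M" "regs s rl = l"
    and W: "W = 2 ^ r" "V = W * W" "0 < r" "W \<le> f" "f < 2 * W" and y0: "y0 < W" and l: "0 < l"
    and xor: "\<And>a b. a < V \<Longrightarrow> b < V \<Longrightarrow> arr s aX (a * V + b) = a XOR b"
    and big: "16 * (V * V) + 20 < Z" "2 ^ \<beta> < Z" "\<beta> + 20 < Z" "8 * M + 30 < Z" "l + 1 < Z"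
  shows "run fill_colours s (\<lambda>t s'. t \<le> M * (80 * \<beta> + 40) + 10 \<and> (\<forall>v<M. arr s' aS v = lfsr_colour W f y0 \<beta> l v))"
  unfolding fill_colours_def run_Seq run_Assign
proof (intro conjI, goal_cases)
  case 2
  show ?case
  proof (rule run_for[where N = M and c = "\<lambda>_. 80 * \<beta> + 30" and
        I = "\<lambda>z s'. regs s' rv = z \<and> regs s' ry = lfsr W f (z * \<beta>) y0 \<and> (\<forall>v<z. arr s' aS v = lfsr_colour W f y0 \<beta> l v)"], goal_cases)
    case 1
    show ?case using regs by simp
  next
    case (2 z s')
    note fr = 2(3)[unfolded colour_step_frame]
    have a: "regs s' r\<beta> = \<beta>" "regs s' rW = W" "regs s' rV = V" "regs s' rf = f" "regs s' rM = M" "regs s' rl = l" "arr s' aX = arr s aX"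
      using frame_regs[OF fr] frame_arr[OF fr] regs by simp_all
    have "run colour_step s' (\<lambda>t s''. t \<le> 80 * \<beta> + 30 \<and> regs s'' rv = Suc z \<and> regs s'' ry = lfsr W f (Suc z * \<beta>) y0
        \<and> (\<forall>v<Suc z. arr s'' aS v = lfsr_colour W f y0 \<beta> l v))"
      unfolding colour_step_def
    proof (rule run_seq[OF run_read_word[OF a(1-4) _ W y0 _ big(1-3), where i = "z * \<beta>"]], goal_cases)
      case 1
      then show ?case using 2(2) by simp
    next
      case (2 a b)
      then show ?case using xor a by simp
    next
      case (3 t1 s1)
      note fr1 = 3(2)[unfolded read_word_frame]
      have a1: "regs s1 rv = z" "regs s1 rl = l" "arr s1 aS = arr s' aS"
        using frame_regs[OF fr1] frame_arr[OF fr1] a 2(2) by simp_all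
      have w: "regs s1 rs = lfsr_word W f y0 \<beta> z" using 3(1) by (simp add: lfsr_word_def)
      have "lfsr_word W f y0 \<beta> z < 2 ^ \<beta>" unfolding lfsr_word_def by (rule bits_val_less)
      then have wZ: "lfsr_word W f y0 \<beta> z < Z" using big(2) by linarith
      have "lfsr_word W f y0 \<beta> z mod l < l" using l by simp
      then obtain x where x: "lfsr_word W f y0 \<beta> z mod l = x" "x < l" by blast
      have col: "lfsr_colour W f y0 \<beta> l z = x + 1" by (simp add: lfsr_colour_def x)
      have y: "regs s1 ry = lfsr W f (Suc z * \<beta>) y0" using 3(1) by (simp add: add.commute)
      have small: "x < Z" "x + 1 < Z" "l < Z" "z < Z" "z + 1 < Z" "8 * z + 6 < Z" using big x \<open>z < M\<close> by linarith+
      show ?case using 3(1) a1 w wZ x(1) col y small 2(2) big by (simp add: run_Seq less_Suc_eq)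
    qed
    then show ?case using a 2(1,2) big by simp
  next
    case (3 s')
    note fr = 3(2)[unfolded colour_step_frame]
    have "regs s' rM = M" using frame_regs[OF fr] regs by simp
    then show ?case using 3(1) big by simp
  next
    case (4 t s')
    then show ?case by (simp add: algebra_simps)
  qed
qed (use big in simp)

section \<open>Output of the functions of one block\<close>

definition write_function :: prog where
  "write_function = rx ::= Const 1 ;;
    While (Reg rn \<oplus> Const 1 \<ominus> Reg rx) (Write (ld aS (ld ah (Reg rx))) ;; rx ::= Reg rx \<oplus> Const 1)"

lemma write_function_frame: "wregs write_function = {rx}" "warrs write_function = {}"
  by (simp_all add: write_function_def)

lemma (in ram) run_write_function:
  assumes n: "regs s rn = n" and h: "\<And>x. x \<le> n \<Longrightarrow> arr s ah x < M" and S: "\<And>v. v < M \<Longrightarrow> arr s aS v < Z"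
    and big: "8 * n + 40 < Z" "8 * M + 30 < Z"
  shows "run write_function s (\<lambda>t s'. t \<le> 40 * n + 20 \<and> outp s' = outp s @ map (\<lambda>x. arr s aS (arr s ah x)) [1..<n + 1])"
  unfolding write_function_def run_Seq run_Assign
proof (intro conjI, goal_cases)
  case 2
  show ?case
  proof (rule run_for[where N = n and c = "\<lambda>_. 30" and
        I = "\<lambda>z s'. regs s' rx = Suc z \<and> regs s' rn = n \<and> arr s' ah = arr s ah \<and> arr s' aS = arr s aS \<and>
          outp s' = outp s @ map (\<lambda>x. arr s aS (arr s ah x)) [1..<z + 1]"], goal_cases)
    case (2 z s')
    have hv: "arr s ah (Suc z) < M" using h 2(1) by simp
    then have Sv: "arr s aS (arr s ah (Suc z)) < Z" by (rule S)
    have "arr s ah (Suc z) < Z" "8 * arr s ah (Suc z) + 6 < Z" "8 * z + 20 < Z" "n + 2 < Z" "n - z < Z" using hv big 2(1) by linarith+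
    then show ?case using 2(1,2) Sv big by (simp add: run_Seq)
  next
    case (4 t s')
    then show ?case by simp
  qed (use n big in auto)
qed (use big in simp)

lemma function_tables_append: "function_tables n (xs @ ys) = function_tables n xs @ function_tables n ys"
  by (simp add: function_tables_def)

definition lfsr_fun :: "nat \<Rightarrow> nat \<Rightarrow> nat \<Rightarrow> nat \<Rightarrow> (nat \<Rightarrow> nat) \<Rightarrow> nat \<Rightarrow> nat \<Rightarrow> nat \<Rightarrow> nat" where
  "lfsr_fun n W \<beta> l h f y = (\<lambda>x\<in>{1..n}. lfsr_colour W f y \<beta> l (h x))"

lemma block_lfsr_fun: "block n W \<beta> l h = concat (map (\<lambda>f. map (lfsr_fun n W \<beta> l h f) [0..<W]) (irred_nats W))"
  by (simp add: block_def lfsr_fun_def[abs_def])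

lemma function_tables_lfsr_fun:
  "function_tables n [lfsr_fun n W \<beta> l h f y] = map (\<lambda>x. lfsr_colour W f y \<beta> l (h x)) [1..<n + 1]"
proof -
  have "map (lfsr_fun n W \<beta> l h f y) [1..<n + 1] = map (\<lambda>x. lfsr_colour W f y \<beta> l (h x)) [1..<n + 1]"
    by (rule map_cong) (auto simp: lfsr_fun_def)
  then show ?thesis by (simp only: function_tables_def list.map concat.simps append_Nil2)
qed

definition state_step :: prog where
  "state_step = ry ::= Reg ri ;; fill_colours ;; write_function ;; ri ::= Reg ri \<oplus> Const 1"

definition poly_step :: prog where
  "poly_step = Cond (ld aD (Reg rf)) Skip (ri ::= Const 0 ;; While (Reg rW \<ominus> Reg ri) state_step) ;; rf ::= Reg rf \<oplus> Const 1"

definition emit_block :: prog where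
  "emit_block = rf ::= Reg rW ;; While (Const 2 \<otimes> Reg rW \<ominus> Reg rf) poly_step"

lemma state_step_frame: "wregs state_step = {rx, rv, ri, ry, rs, rt}" "warrs state_step = {aS}"
  by (auto simp: state_step_def fill_colours_frame write_function_frame)

lemma poly_step_frame: "wregs poly_step = {rx, rv, rf, ri, ry, rs, rt}" "warrs poly_step = {aS}"
  by (auto simp: poly_step_def state_step_frame)

lemma emit_block_frame: "wregs emit_block = {rx, rv, rf, ri, ry, rs, rt}" "warrs emit_block = {aS}"
  by (auto simp: emit_block_def poly_step_frame)

locale emission = ram +
  fixes n l \<beta> M W V r :: nat
  assumes W: "W = 2 ^ r" "V = W * W" "0 < r" and l: "0 < l"
    and big: "16 * (V * V) + 20 < Z" "2 ^ \<beta> < Z" "\<beta> + 20 < Z" "8 * M + 30 < Z" "l + 1 < Z" "8 * n + 40 < Z"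
begin

definition ready :: "state \<Rightarrow> bool" where
  "ready s \<longleftrightarrow> regs s rn = n \<and> regs s r\<beta> = \<beta> \<and> regs s rW = W \<and> regs s rV = V \<and> regs s rM = M \<and> regs s rl = l \<and>
    (\<forall>a<V. \<forall>b<V. arr s aX (a * V + b) = a XOR b) \<and> (\<forall>x\<le>n. arr s ah x < M) \<and>
    (\<forall>f. arr s aD f \<le> 1 \<and> (W \<le> f \<and> f < 2 * W \<longrightarrow> (arr s aD f = 0 \<longleftrightarrow> irreducible (bpoly f))))"

lemma ready_frame: "frame R {aS} s s' \<Longrightarrow> R \<inter> {rn, r\<beta>, rW, rV, rM, rl} = {} \<Longrightarrow> ready s \<Longrightarrow> ready s'"
  using frame_regs[of R "{aS}" s s'] frame_arr[of R "{aS}" s s'] unfolding ready_def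
  by (auto simp: disjoint_iff)

lemma WV: "2 * W \<le> V" "V \<le> V * V"
proof -
  have "2 \<le> W" using W by (cases r) auto
  then show "2 * W \<le> V" "V \<le> V * V" unfolding W(2) by simp_all
qed

definition state_cost :: nat where
  "state_cost = M * (80 * \<beta> + 40) + 40 * n + 50"

lemma run_state_step:
  assumes s: "ready s" "regs s rf = f" "regs s ri = y" "W \<le> f" "f < 2 * W" "y < W"
  shows "run state_step s (\<lambda>t s'. t \<le> state_cost \<and> regs s' ri = Suc y \<and>
    outp s' = outp s @ function_tables n [lfsr_fun n W \<beta> l (arr s ah) f y])"
  unfolding state_step_def run_Seq[of "Assign ry _"] run_Assign
proof (intro conjI, goal_cases)
  case 1
  have "y < Z" using s(6) WV big by linarith
  then show ?case using s(3) by simp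
next
  case 2
  let ?s = "setr ry (expr_val s (Reg ri)) s"
  have xor: "arr ?s aX (a * V + b) = a XOR b" if "a < V" "b < V" for a b
    using s(1) that by (simp add: ready_def)
  have regs: "regs ?s r\<beta> = \<beta>" "regs ?s rW = W" "regs ?s rV = V" "regs ?s rf = f" "regs ?s ry = y" "regs ?s rM = M" "regs ?s rl = l"
    using s by (simp_all add: ready_def)
  show ?case
  proof (rule run_seq[OF run_fill_colours[OF regs W s(4,5,6) l xor big(1-5)]], goal_cases)
    case (3 t1 s1)
    note fr1 = 3(2)[unfolded fill_colours_frame]
    have a1: "regs s1 rn = n" "regs s1 ri = y" "arr s1 ah = arr s ah"
      using frame_regs[OF fr1] frame_arr[OF fr1] s by (simp_all add: ready_def)
    have out1: "outp s1 = outp s" using 3(3) fill_colours_frame by simp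
    have h1: "arr s1 ah x < M" if "x \<le> n" for x using a1 s(1) that by (simp add: ready_def)
    have S1: "arr s1 aS v < Z" if "v < M" for v
    proof -
      have "lfsr_word W f y \<beta> v mod l < l" using l by simp
      then show ?thesis using 3(1) that big(5) by (simp add: lfsr_colour_def)
    qed
    show ?case
    proof (rule run_seq[OF run_write_function[OF a1(1) h1 S1 big(6,4)]], goal_cases)
      case (3 t2 s2)
      note fr2 = 3(2)[unfolded write_function_frame]
      have a2: "regs s2 ri = y" using frame_regs[OF fr2] a1 by simp
      have "outp s2 = outp s @ function_tables n [lfsr_fun n W \<beta> l (arr s ah) f y]"
      proof -
        have "map (\<lambda>x. arr s1 aS (arr s1 ah x)) [1..<n + 1] = map (\<lambda>x. lfsr_colour W f y \<beta> l (arr s ah x)) [1..<n + 1]"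
        proof (rule map_cong[OF refl])
          fix x assume "x \<in> set [1..<n + 1]"
          then have "x \<le> n" by auto
          then have "arr s ah x < M" using s(1) by (simp add: ready_def)
          then show "arr s1 aS (arr s1 ah x) = lfsr_colour W f y \<beta> l (arr s ah x)"
            using \<open>t1 \<le> _ \<and> _\<close> a1 by simp
        qed
        then show ?thesis using 3(1) out1 by (simp only: function_tables_lfsr_fun)
      qed
      moreover have "y + 1 < Z" using s(6) WV big by linarith
      moreover have "2 + (t1 + (t2 + 4)) \<le> state_cost"
        using 3(1) \<open>t1 \<le> _ \<and> _\<close> unfolding state_cost_def by linarith
      ultimately show ?case using a2 big by simp
    qed
  qed
qed

lemma run_poly_step:
  assumes s: "ready s" "regs s rf = f" "W \<le> f" "f < 2 * W"
  shows "run poly_step s (\<lambda>t s'. t \<le> W * (state_cost + 10) + 30 \<and> regs s' rf = Suc f \<and>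
    outp s' = outp s @ function_tables n (if irreducible (bpoly f) then map (lfsr_fun n W \<beta> l (arr s ah) f) [0..<W] else []))"
proof -
  have f: "f < Z" "8 * f + 8 < Z" "f + 1 < Z" "W < Z" using s WV big by linarith+
  have D: "arr s aD f \<le> 1" "arr s aD f = 0 \<longleftrightarrow> irreducible (bpoly f)" using s by (auto simp: ready_def)
  have DZ: "arr s aD f < Z" using D(1) big by linarith
  show ?thesis
  proof (cases "irreducible (bpoly f)")
    case False
    then show ?thesis using s f D DZ big by (simp add: poly_step_def run_Seq run_Cond function_tables_def)
  next
    case True
    have "run (While (Reg rW \<ominus> Reg ri) state_step) (setr ri 0 s) (\<lambda>t s'. t \<le> W * (state_cost + 10) + 5 \<and> regs s' rf = f \<and>
      outp s' = outp s @ function_tables n (map (lfsr_fun n W \<beta> l (arr s ah) f) [0..<W]))"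
    proof (rule run_for[where N = W and c = "\<lambda>_. state_cost" and
        I = "\<lambda>z s'. regs s' ri = z \<and> outp s' = outp s @ function_tables n (map (lfsr_fun n W \<beta> l (arr s ah) f) [0..<z])"], goal_cases)
      case 1
      show ?case by (simp add: function_tables_def)
    next
      case (2 z s')
      note fr = 2(3)[unfolded state_step_frame]
      have rd: "ready s'" by (rule ready_frame[OF fr]) (use s in \<open>auto simp: ready_def\<close>)
      have a: "regs s' rf = f" "arr s' ah = arr s ah" using frame_regs[OF fr] frame_arr[OF fr] s by simp_all
      have rW: "regs s' rW = W" using rd by (simp add: ready_def)
      have "run state_step s' (\<lambda>t s''. t \<le> state_cost \<and> regs s'' ri = Suc z \<and>
          outp s'' = outp s' @ function_tables n [lfsr_fun n W \<beta> l (arr s' ah) f z])"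
        using 2(1,2) by (intro run_state_step[OF rd a(1) _ s(3,4)]) auto
      then have "run state_step s' (\<lambda>t s''. t \<le> state_cost \<and> regs s'' ri = Suc z \<and>
          outp s'' = outp s @ function_tables n (map (lfsr_fun n W \<beta> l (arr s ah) f) [0..<Suc z]))"
        by (rule run_mono) (use 2(2) a in \<open>simp add: function_tables_append\<close>)
      then show ?case using 2(1,2) rW f by simp
    next
      case (3 s')
      note fr = 3(2)[unfolded state_step_frame]
      have "regs s' rW = W" using frame_regs[OF fr] s by (simp add: ready_def)
      then show ?case using 3(1) f by simp
    next
      case (4 t s')
      note fr = 4(2)[unfolded state_step_frame]
      have "regs s' rf = f" using frame_regs[OF fr] s by simp
      then show ?case using 4 by (simp add: algebra_simps)
    qed
    then have "run (While (Reg rW \<ominus> Reg ri) state_step) (setr ri 0 s) (\<lambda>t s'. 11 + t + 4 \<le> W * (state_cost + 10) + 30 \<and> regs s' rf = f \<and>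
      outp s' = outp s @ function_tables n (map (lfsr_fun n W \<beta> l (arr s ah) f) [0..<W]))"
      by (rule run_mono) auto
    then show ?thesis using True s f D DZ big
      by (simp add: poly_step_def run_Seq run_Cond) (erule run_mono, simp)
  qed
qed

lemma run_emit_block:
  assumes s: "ready s"
  shows "run emit_block s (\<lambda>t s'. t \<le> W * (W * (state_cost + 10) + 40) + 20 \<and>
    outp s' = outp s @ function_tables n (block n W \<beta> l (arr s ah)))"
  unfolding emit_block_def run_Seq run_Assign
proof (intro conjI, goal_cases)
  case 1
  have "W < Z" using WV big by linarith
  then show ?case using s by (simp add: ready_def)
next
  case 2
  have f: "2 * W < Z" "W < Z" using WV big by linarith+
  let ?g = "\<lambda>f. map (lfsr_fun n W \<beta> l (arr s ah) f) [0..<W]"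
  let ?fs = "\<lambda>z. filter (\<lambda>f. irreducible (bpoly f)) [W..<W + z]"
  show ?case
  proof (rule run_for[where N = W and c = "\<lambda>_. W * (state_cost + 10) + 30" and
        I = "\<lambda>z s'. regs s' rf = W + z \<and> outp s' = outp s @ function_tables n (concat (map ?g (?fs z)))"], goal_cases)
    case 1
    show ?case using s by (simp add: function_tables_def ready_def)
  next
    case (2 z s')
    note fr = 2(3)[unfolded poly_step_frame]
    have rd: "ready s'" by (rule ready_frame[OF fr]) (use s in \<open>auto simp: ready_def\<close>)
    have a: "arr s' ah = arr s ah" "regs s' rW = W" using frame_arr[OF fr] rd by (simp_all add: ready_def)
    have "run poly_step s' (\<lambda>t s''. t \<le> W * (state_cost + 10) + 30 \<and> regs s'' rf = Suc (W + z) \<and>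
      outp s'' = outp s' @ function_tables n (if irreducible (bpoly (W + z)) then map (lfsr_fun n W \<beta> l (arr s' ah) (W + z)) [0..<W] else []))"
      using 2(1,2) by (intro run_poly_step[OF rd]) auto
    then have "run poly_step s' (\<lambda>t s''. t \<le> W * (state_cost + 10) + 30 \<and> regs s'' rf = W + Suc z \<and>
      outp s'' = outp s @ function_tables n (concat (map ?g (?fs (Suc z)))))"
      by (rule run_mono) (use 2(2) a in \<open>auto simp add: function_tables_append\<close>)
    moreover have "W + z < Z" "2 * W - (W + z) < Z" using f 2(1) by linarith+
    ultimately show ?case using 2(1,2) a f by simp
  next
    case (3 s')
    note fr = 3(2)[unfolded poly_step_frame]
    have "regs s' rW = W" using frame_regs[OF fr] s by (simp add: ready_def)
    moreover have "2 < Z" using big by linarith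
    ultimately show ?case using 3(1) f by simp
  next
    case (4 t s')
    have "?fs W = irred_nats W" by (simp add: irred_nats_def mult_2)
    then have "outp s' = outp s @ function_tables n (block n W \<beta> l (arr s ah))"
      using 4(1) by (simp only: block_lfsr_fun)
    then show ?case using 4(4) by (simp add: algebra_simps)
  qed
qed

end

section \<open>The loop over the coordinates of the code\<close>

definition coordinate_step :: prog where
  "coordinate_step = greedy ;; update_weights ;; emit_block ;; rc ::= Reg rc \<oplus> Const 1"

definition main_loop :: prog where
  "main_loop = rc ::= Const 0 ;; While (Reg rM \<otimes> Reg rL \<ominus> Reg rc) coordinate_step"

lemma coordinate_step_frame:
  "wregs coordinate_step = {rP, rx, ra, rv, rf, ri, ry, rs, rt, rc}" "warrs coordinate_step = {aw, ah, aB, aS}"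
  by (auto simp: coordinate_step_def greedy_frame update_weights_frame emit_block_frame)

locale construction = emission +
  fixes b L :: nat
  assumes M: "M = 2 ^ b" "M \<le> V" and L: "n < 2 ^ L"
    and bigL: "16 * 2 ^ L + 20 < Z" "2 * (2 ^ L * 4 ^ L) < Z" "M * L + 1 < Z"
begin

definition set_up :: "state \<Rightarrow> bool" where
  "set_up s \<longleftrightarrow> regs s rn = n \<and> regs s r\<beta> = \<beta> \<and> regs s rW = W \<and> regs s rV = V \<and> regs s rM = M \<and> regs s rl = l \<and>
    regs s rL = L \<and> regs s rQ = 2 ^ L \<and>
    (\<forall>a<V. \<forall>b<V. arr s aX (a * V + b) = a XOR b) \<and>
    (\<forall>f. arr s aD f \<le> 1 \<and> (W \<le> f \<and> f < 2 * W \<longrightarrow> (arr s aD f = 0 \<longleftrightarrow> irreducible (bpoly f))))"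

lemma set_up_frame:
  "frame R J s s' \<Longrightarrow> R \<inter> {rn, r\<beta>, rW, rV, rM, rl, rL, rQ} = {} \<Longrightarrow> J \<inter> {aX, aD} = {} \<Longrightarrow> set_up s \<Longrightarrow> set_up s'"
proof -
  assume fr: "frame R J s s'" and R: "R \<inter> {rn, r\<beta>, rW, rV, rM, rl, rL, rQ} = {}" and J: "J \<inter> {aX, aD} = {}"
    and s: "set_up s"
  have "regs s' x = regs s x" if "x \<in> {rn, r\<beta>, rW, rV, rM, rl, rL, rQ}" for x
    using R that by (intro frame_regs[OF fr]) blast
  moreover have "aX \<notin> J" "aD \<notin> J" using J by blast+
  then have "arr s' aX = arr s aX" "arr s' aD = arr s aD" using frame_arr[OF fr] by simp_all
  ultimately show "set_up s'" using s unfolding set_up_def by simp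
qed

text \<open>The weight of a word doubles with each of its zeros. The greedy choice of a coordinate lets the
  total weight grow by a factor of at most \<open>1 + 1 / M\<close>, and \<open>(1 + 1 / M) ^ (M * L) \<le> 4 ^ L\<close>, so in
  the end no word has more than \<open>3 * L\<close> zeros.\<close>

definition partial_code :: "nat \<Rightarrow> state \<Rightarrow> (nat \<Rightarrow> nat) list \<Rightarrow> bool" where
  "partial_code c s hs \<longleftrightarrow> length hs = c \<and>
    (\<forall>h\<in>set hs. (\<forall>x<2 ^ L. h x < M) \<and> (\<forall>x<2 ^ L. \<forall>y<2 ^ L. h (x XOR y) = h x XOR h y)) \<and>
    (\<forall>x. 1 \<le> x \<and> x < 2 ^ L \<longrightarrow> arr s aw x = 2 ^ length (filter (\<lambda>h. h x = 0) hs)) \<and>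
    M ^ c * wsum (arr s aw) (2 ^ L) \<le> 2 ^ L * (M + 1) ^ c"

definition step_cost :: nat where
  "step_cost = 180 * 2 ^ L + 90 * (M * L) + 70 * L + 100 + W * (W * (state_cost + 10) + 40)"

lemma run_coordinate_step:
  assumes s: "set_up s" "regs s rc = c" "c < M * L" "partial_code c s hs"
  shows "run coordinate_step s (\<lambda>t s'. t \<le> step_cost \<and> regs s' rc = Suc c \<and>
    (\<exists>h. partial_code (Suc c) s' (hs @ [h]) \<and> outp s' = outp s @ function_tables n (block n W \<beta> l h)))"
proof -
  have regs: "regs s rM = M" "regs s rV = V" "regs s rQ = 2 ^ L"
    and xor: "\<And>a b. a < V \<Longrightarrow> b < V \<Longrightarrow> arr s aX (a * V + b) = a XOR b"
    using s(1) by (auto simp: set_up_def)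
  have M0: "0 < M" using M by simp
  \<comment> \<open>The final estimate holds at every stage; it excludes overflow in the bucket sums
    and in the doubling of weights.\<close>
  have ws: "wsum (arr s aw) (2 ^ L) \<le> 2 ^ L * 4 ^ L"
    using s(3,4) M0 by (intro weight_bound[of c M L]) (auto simp: partial_code_def)
  have wZ: "2 * wsum (arr s aw) (2 ^ L) < Z" "wsum (arr s aw) (2 ^ L) < Z" using ws bigL(2) by linarith+
  have MZ: "8 * M + 20 < Z" "16 * (V * V) + 20 < Z" using big by simp_all
  show ?thesis
    unfolding coordinate_step_def
  proof (rule run_seq[OF run_greedy[OF regs M xor MZ bigL(1) wZ(2)]], goal_cases)
    case (3 t1 s1)
    note fr1 = 3(2)[unfolded greedy_frame]
    have su1: "set_up s1" by (rule set_up_frame[OF fr1 _ _ s(1)]) auto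
    have a1: "regs s1 rQ = 2 ^ L" "regs s1 rc = c" "arr s1 aw = arr s aw"
      using frame_regs[OF fr1] frame_arr[OF fr1] regs s by simp_all
    have out1: "outp s1 = outp s" using 3(3) greedy_frame by simp
    define h where "h = arr s1 ah"
    have code: "code_fun M (arr s aw) L h" using 3(1) by (simp add: h_def)
    have hM: "h x < M" if "x < 2 ^ L" for x using code that by (simp add: code_fun_def)
    have hZ: "arr s1 ah x < Z" if "x < 2 ^ L" for x using hM[OF that] MZ by (simp add: h_def)
    show ?case
    proof (rule run_seq[OF run_update_weights[OF a1(1) _ hZ]], goal_cases)
      case (5 t2 s2)
      note fr2 = 5(2)[unfolded update_weights_frame]
      have su2: "set_up s2" by (rule set_up_frame[OF fr2 _ _ su1]) auto
      have a2: "arr s2 ah = h" "regs s2 rc = c"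
        using frame_arr[OF fr2] frame_regs[OF fr2] a1 by (simp_all add: h_def)
      have out2: "outp s2 = outp s" using 5(3) out1 update_weights_frame by simp
      have w2: "arr s2 aw x = (if h x = 0 then 2 * arr s aw x else arr s aw x)" if "1 \<le> x" "x < 2 ^ L" for x
        using 5(1) that a1 by (simp add: h_def)
      have rd: "ready s2" using su2 a2 hM L unfolding ready_def set_up_def by auto
      show ?case
      proof (rule run_seq[OF run_emit_block[OF rd]], goal_cases)
        case (1 t3 s3)
        note fr3 = 1(2)[unfolded emit_block_frame]
        have a3: "regs s3 rc = c" "arr s3 aw = arr s2 aw"
          using frame_arr[OF fr3] frame_regs[OF fr3] a2 by simp_all
        have w3: "arr s3 aw x = (if h x = 0 then 2 * arr s aw x else arr s aw x)" if "1 \<le> x" "x < 2 ^ L" for x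
          using w2[OF that] a3 by simp
        have "M * wsum (\<lambda>x. if h x = 0 then arr s aw x else 0) (2 ^ L) \<le> wsum (arr s aw) (2 ^ L)"
          using code by (simp add: code_fun_def)
        then have "M * wsum (arr s3 aw) (2 ^ L) \<le> (M + 1) * wsum (arr s aw) (2 ^ L)"
          by (rule wsum_update) (rule w3)
        then have "M ^ c * (M * wsum (arr s3 aw) (2 ^ L)) \<le> M ^ c * ((M + 1) * wsum (arr s aw) (2 ^ L))"
          by (rule mult_le_mono2)
        also have "\<dots> = (M + 1) * (M ^ c * wsum (arr s aw) (2 ^ L))" by (simp only: mult_ac)
        also have "\<dots> \<le> (M + 1) * (2 ^ L * (M + 1) ^ c)"
          using s(4) unfolding partial_code_def by (intro mult_le_mono2) blast
        finally have pw: "M ^ Suc c * wsum (arr s3 aw) (2 ^ L) \<le> 2 ^ L * (M + 1) ^ Suc c"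
          by (simp only: power_Suc mult_ac)
        have pc: "partial_code (Suc c) s3 (hs @ [h])"
          using s(4) w3 code pw by (auto simp: partial_code_def code_fun_def)
        have "partial_code (Suc c) (setr rc (Suc c) s3) (hs @ [h])"
          using pc by (simp add: partial_code_def)
        moreover have "outp s3 = outp s @ function_tables n (block n W \<beta> l h)"
          using 1(1) out2 a2 by simp
        moreover have "t1 + (t2 + (t3 + 4)) \<le> step_cost"
          using 1(1) 5(1) 3(1) unfolding step_cost_def by linarith
        moreover have "c + 1 < Z" using s(3) bigL(3) by linarith
        ultimately show ?case using a3 big by auto
      qed
    qed (use bigL wZ a1 in auto)
  qed
qed

lemma good_code_of_partial_code:
  assumes "partial_code (M * L) s hs"
  shows "good_code L M hs"
proof -
  have M0: "0 < M" using M by simp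
  have ws: "wsum (arr s aw) (2 ^ L) \<le> 2 ^ L * 4 ^ L"
    using assms M0 by (intro weight_bound[of "M * L" M L]) (auto simp: partial_code_def)
  have "length (filter (\<lambda>h. h x = 0) hs) \<le> 3 * L" if x: "0 < x" "x < 2 ^ L" for x
  proof -
    have "2 ^ length (filter (\<lambda>h. h x = 0) hs) = arr s aw x"
      using assms x by (simp add: partial_code_def)
    also have "\<dots> \<le> wsum (arr s aw) (2 ^ L)"
      unfolding wsum_def using x by (intro member_le_sum) auto
    also have "\<dots> \<le> 2 ^ L * 4 ^ L" by (rule ws)
    \<comment> \<open>The weight of \<open>x\<close> is 2 to the number of its zeros, so comparing
      exponents bounds that number.\<close>
    also have "\<dots> = 2 ^ (3 * L)" by (simp add: power_mult power_mult_distrib[symmetric])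
    finally show ?thesis by simp
  qed
  then show ?thesis using assms by (simp add: good_code_def partial_code_def)
qed

text \<open>The list \<open>hs\<close> exists only in the proof: a coordinate is written out as soon
  as it is chosen and then overwritten in \<open>ah\<close>, while its influence on later choices
  survives in the weights.\<close>

lemma run_main_loop:
  assumes s: "set_up s" and w: "\<And>x. x < 2 ^ L \<Longrightarrow> arr s aw x = 1"
  shows "run main_loop s (\<lambda>t s'. t \<le> M * L * (step_cost + 10) + 10 \<and>
    (\<exists>hs. good_code L M hs \<and> outp s' = outp s @ function_tables n (concat (map (block n W \<beta> l) hs))))"
  unfolding main_loop_def run_Seq run_Assign
proof (intro conjI, goal_cases)
  case 1
  show ?case using big by simp
next
  case 2
  have MZ: "M < Z" using big by linarith
  have LZ: "L < Z"
  proof -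
    have "L \<le> M * L" using M by simp
    then show ?thesis using bigL(3) by linarith
  qed
  show ?case
  proof (rule run_for[where N = "M * L" and c = "\<lambda>_. step_cost" and
        I = "\<lambda>c s'. regs s' rc = c \<and>
          (\<exists>hs. partial_code c s' hs \<and> outp s' = outp s @ function_tables n (concat (map (block n W \<beta> l) hs)))"], goal_cases)
    case 1
    have "wsum (arr s aw) (2 ^ L) \<le> 2 ^ L" unfolding wsum_def using w by simp
    then have "partial_code 0 (setr rc (expr_val s (Const 0)) s) []" using w by (simp add: partial_code_def)
    moreover have "outp (setr rc (expr_val s (Const 0)) s) = outp s @ function_tables n (concat (map (block n W \<beta> l) []))"
      by (simp add: function_tables_def)
    ultimately show ?case by auto
  next
    case (2 c s')
    note fr = 2(3)[unfolded coordinate_step_frame]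
    have su: "set_up s'" by (rule set_up_frame[OF fr]) (use s in \<open>auto simp: set_up_def\<close>)
    obtain hs where hs: "partial_code c s' hs" "outp s' = outp s @ function_tables n (concat (map (block n W \<beta> l) hs))"
      using 2(2) by blast
    have "run coordinate_step s' (\<lambda>t s''. t \<le> step_cost \<and> regs s'' rc = Suc c \<and>
       (\<exists>h. partial_code (Suc c) s'' (hs @ [h]) \<and> outp s'' = outp s' @ function_tables n (block n W \<beta> l h)))"
      using 2(1,2) hs by (intro run_coordinate_step[OF su]) auto
    then have "run coordinate_step s' (\<lambda>t s''. t \<le> step_cost \<and> regs s'' rc = Suc c \<and>
       (\<exists>hs. partial_code (Suc c) s'' hs \<and> outp s'' = outp s @ function_tables n (concat (map (block n W \<beta> l) hs))))"
    proof (rule run_mono)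
      fix t s''
      assume *: "t \<le> step_cost \<and> regs s'' rc = Suc c \<and>
       (\<exists>h. partial_code (Suc c) s'' (hs @ [h]) \<and> outp s'' = outp s' @ function_tables n (block n W \<beta> l h))"
      then obtain h where h: "partial_code (Suc c) s'' (hs @ [h])" "outp s'' = outp s' @ function_tables n (block n W \<beta> l h)"
        by blast
      have "outp s'' = outp s @ function_tables n (concat (map (block n W \<beta> l) (hs @ [h])))"
        using h(2) hs(2) by (simp add: function_tables_append)
      then show "t \<le> step_cost \<and> regs s'' rc = Suc c \<and>
       (\<exists>hs. partial_code (Suc c) s'' hs \<and> outp s'' = outp s @ function_tables n (concat (map (block n W \<beta> l) hs)))"
        using * h(1) by blast
    qed
    moreover have "regs s' rM = M" "regs s' rL = L" using su by (simp_all add: set_up_def)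
    moreover have "M * L < Z" "c < Z" "M * L - c < Z" using bigL(3) 2(1) by linarith+
    ultimately show ?case using 2(1,2) MZ LZ by simp
  next
    case (3 s')
    note fr = 3(2)[unfolded coordinate_step_frame]
    have su: "set_up s'" by (rule set_up_frame[OF fr]) (use s in \<open>auto simp: set_up_def\<close>)
    then have "regs s' rM = M" "regs s' rL = L" by (simp_all add: set_up_def)
    moreover have "M * L < Z" using bigL(3) by linarith
    ultimately show ?case using 3(1) MZ LZ by simp
  next
    case (4 t s')
    then show ?case using good_code_of_partial_code by (auto simp: algebra_simps)
  qed
qed

end

subsection \<open>Choosing the parameters\<close>

text \<open>Finds the least power of two not below the value of \<open>u\<close>, with its exponent.
  It serves three times: for \<open>2 ^ \<beta> \<ge> l\<close>, for \<open>M\<close> and for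
  \<open>2 ^ L > n\<close>.\<close>

definition doubling :: "nat \<Rightarrow> nat \<Rightarrow> nat \<Rightarrow> prog" where
  "doubling u r c = r ::= Const 1 ;; c ::= Const 0 ;;
     While (Reg u \<ominus> Reg r) (r ::= Const 2 \<otimes> Reg r ;; c ::= Reg c \<oplus> Const 1)"

lemma doubling_frame: "wregs (doubling u r c) = {r, c}" "warrs (doubling u r c) = {}" "silent (doubling u r c)"
  by (auto simp: doubling_def)

lemma (in ram) run_doubling:
  assumes u: "regs s u = B" "1 \<le> B" and d: "u \<noteq> r" "u \<noteq> c" "r \<noteq> c" and big: "2 * B + 3 < Z"
  shows "run (doubling u r c) s (\<lambda>t s'. \<exists>m. regs s' r = 2 ^ m \<and> regs s' c = m \<and> B \<le> 2 ^ m \<and> 2 ^ m < 2 * B \<and> t \<le> 20 * m + 20)"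
proof -
  define m where "m = (LEAST m. B \<le> 2 ^ m)"
  have "B \<le> 2 ^ B" by (simp add: less_imp_le)
  then have m: "B \<le> 2 ^ m" unfolding m_def by (rule LeastI)
  have below: "2 ^ i < B" if "i < m" for i using not_less_Least[OF that[unfolded m_def]] by simp
  have up: "2 ^ m < 2 * B"
  proof (cases m)
    case (Suc j)
    then show ?thesis using below[of j] by simp
  qed (use u in simp)
  show ?thesis
    unfolding doubling_def run_Seq run_Assign
  proof (intro conjI, goal_cases)
    case 3
    show ?case
    proof (rule run_for[where N = m and c = "\<lambda>_. 10" and
          I = "\<lambda>i s'. regs s' u = B \<and> regs s' r = 2 ^ i \<and> regs s' c = i"], goal_cases)
      case 1
      show ?case using u d by simp
    next
      case (2 i s')
      have "2 * 2 ^ i < Z" "(2::nat) ^ i < Z" "B - 2 ^ i < Z" "B < Z" using below[OF 2(1)] big by linarith+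
      moreover have "i < 2 ^ i" by simp
      then have "i + 1 < Z" "i < Z" using below[OF 2(1)] big by linarith+
      ultimately show ?case using 2 below[OF 2(1)] d big by (simp add: run_Seq)
    next
      case (3 s')
      then show ?case using m up big by simp
    next
      case (4 t s')
      then show ?case using m up by (intro exI[of _ m]) simp
    qed
  qed (use big in simp_all)
qed

definition power_loop :: prog where
  "power_loop = rK ::= Const 1 ;; rz ::= Const 0 ;;
    While (Reg rk \<ominus> Reg rz) (rK ::= Reg rK \<otimes> Reg rB ;; rz ::= Reg rz \<oplus> Const 1)"

lemma power_loop_frame: "wregs power_loop = {rK, rz}" "warrs power_loop = {}" "silent power_loop"
  by (auto simp: power_loop_def)

lemma (in ram) run_power_loop:
  assumes s: "regs s rk = k" "regs s rB = B" "1 \<le> B" and big: "B ^ k < Z" "k + 2 < Z" "B < Z"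
  shows "run power_loop s (\<lambda>t s'. regs s' rK = B ^ k \<and> t \<le> 20 * k + 20)"
  unfolding power_loop_def run_Seq run_Assign
proof (intro conjI, goal_cases)
  case 3
  show ?case
  proof (rule run_for[where N = k and c = "\<lambda>_. 10" and
        I = "\<lambda>i s'. regs s' rk = k \<and> regs s' rB = B \<and> regs s' rK = B ^ i \<and> regs s' rz = i"], goal_cases)
    case (2 i s')
    have "B ^ i \<le> B ^ k" "B ^ Suc i \<le> B ^ k"
      using power_increasing[of i k B] power_increasing[of "Suc i" k B] 2(1) s(3) by simp_all
    then have "B ^ i < Z" "B ^ i * B < Z" using big by (simp_all add: mult.commute)
    then show ?case using 2(1,2) big by (simp add: run_Seq mult.commute)
  qed (use s big in auto)
qed (use big in simp_all)

text \<open>\<open>rA\<close> receives an integer above \<open>1 / (p / q - 1)\<close>, and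
  \<open>rM\<close> the least power of two that satisfies the condition \<open>big\<close> of
  \<open>balanced_blocks\<close>.\<close>

definition params :: prog where
  "params = rA ::= Reg rq \<oslash> (Reg rp \<ominus> Reg rq) \<oplus> Const 1 ;; doubling rl rB r\<beta> ;; power_loop ;;
     rU ::= Const 10 \<otimes> Reg rA \<otimes> Reg rK \<otimes> Reg rK \<otimes> Reg rk \<otimes> Reg rk ;; doubling rU rM rz ;;
     rW ::= Reg rM \<otimes> Reg rM ;; rV ::= Reg rW \<otimes> Reg rW ;; rU ::= Reg rn \<oplus> Const 1 ;; doubling rU rQ rL"

lemma params_frame: "wregs params = {rA, r\<beta>, rB, rK, rM, rW, rV, rL, rQ, rU, rz}" "warrs params = {}" "silent params"
  by (auto simp: params_def doubling_frame power_loop_frame)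

text \<open>\<open>G\<close> is \<open>10 * A * K * K * k * k\<close> with \<open>2 * l\<close> in
  place of \<open>2 ^ \<beta>\<close>: an upper bound known before \<open>\<beta>\<close> is, in
  terms of which the size conditions can be stated.\<close>

lemma (in ram) run_params:
  assumes regs: "regs s rn = n" "regs s rk = k" "regs s rl = l" "regs s rp = p" "regs s rq = q"
    and lk: "1 \<le> l" "l \<le> k" and pq: "q < p" "p < Z" and A: "A = q div (p - q) + 1"
    and G: "G = 10 * A * (2 * l) ^ k * (2 * l) ^ k * k * k"
    and big: "16 * G * G * G * G + 20 < Z" "2 * n + 10 < Z"
  shows "run params s (\<lambda>t s'. \<exists>\<beta> K b L. regs s' r\<beta> = \<beta> \<and> l \<le> 2 ^ \<beta> \<and> 2 ^ \<beta> < 2 * l \<and> K = (2 ^ \<beta>) ^ k \<and>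
    regs s' rM = 2 ^ b \<and> 10 * A * K * K * k * k \<le> 2 ^ b \<and> 2 ^ b < 2 * (10 * A * K * K * k * k) \<and>
    10 * A * K * K * k * k \<le> G \<and> regs s' rW = 2 ^ b * 2 ^ b \<and> regs s' rV = 2 ^ b * 2 ^ b * (2 ^ b * 2 ^ b) \<and>
    regs s' rL = L \<and> regs s' rQ = 2 ^ L \<and> n < 2 ^ L \<and> 2 ^ L < 2 * (n + 1) \<and> t \<le> 20 * (\<beta> + k + b + L) + 200)"
proof -
  have A1: "1 \<le> A" by (simp add: A)
  define l2 where "l2 = (2 * l) ^ k"
  have l2: "2 * l \<le> l2" using lk unfolding l2_def by (intro self_le_power) auto
  have k1: "1 \<le> k" using lk by simp
  have prod_le: "x \<le> x * y" if "1 \<le> y" for x y :: nat using that by simp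
  have G': "G = 10 * A * l2 * l2 * k * k" by (simp add: G l2_def)
  have l21: "1 \<le> l2" using l2 lk by simp
  have mono: "10 * A * x * y * k * k \<le> G" "10 * A * x * y * k \<le> G" "10 * A * x * y \<le> G" "10 * A * x \<le> G"
    if "x \<le> l2" "y \<le> l2" for x y
  proof -
    have a: "10 * A * x \<le> 10 * A * l2" using that by simp
    have b: "10 * A * x * y \<le> 10 * A * l2 * l2" using a that(2) by (rule mult_le_mono)
    have c: "10 * A * l2 * l2 \<le> 10 * A * l2 * l2 * k" "10 * A * l2 * l2 * k \<le> G" "10 * A * l2 \<le> 10 * A * l2 * l2"
      unfolding G' using k1 l21 prod_le by blast+
    show "10 * A * x \<le> G" using a c by linarith
    show "10 * A * x * y \<le> G" using b c by linarith
    show "10 * A * x * y * k \<le> G" by (rule le_trans[OF mult_le_mono1[OF b] c(2)])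
    show "10 * A * x * y * k * k \<le> G" unfolding G' by (intro mult_le_mono1 b)
  qed
  have lG: "10 * l2 \<le> G" "10 * k \<le> G" "10 * A \<le> G"
  proof -
    have "10 * 1 * l2 * 1 * 1 * 1 \<le> G" "10 * 1 * 1 * 1 * k * 1 \<le> G" "10 * A * 1 * 1 * 1 * 1 \<le> G"
      unfolding G' using A1 l21 k1 by (intro mult_le_mono order_refl; simp)+
    then show "10 * l2 \<le> G" "10 * k \<le> G" "10 * A \<le> G" by simp_all
  qed
  have G10: "10 \<le> G" using lG k1 by linarith
  have GZ: "16 * G + 20 < Z" "4 * (G * G) < Z" "16 * (G * G * (G * G)) < Z"
  proof -
    define Y where "Y = G * G * G * G"
    have "G \<le> G * G" "G * G \<le> G * G * G" "G * G * G \<le> Y"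
      unfolding Y_def using G10 by (intro prod_le; simp)+
    moreover have Y: "16 * Y + 20 < Z" using big(1) by (simp add: Y_def mult.assoc)
    ultimately show "16 * G + 20 < Z" "4 * (G * G) < Z" by linarith+
    show "16 * (G * G * (G * G)) < Z" using Y by (simp add: Y_def mult.assoc)
  qed
  show ?thesis
    unfolding params_def run_Seq[of "Assign rA _"] run_Assign
  proof (intro conjI, goal_cases)
    case 1
    have "A < Z" using lG GZ by linarith
    then have "q div (p - q) + 1 < Z" unfolding A .
    then show ?case using regs pq GZ by simp
  next
    case 2
    let ?s = "setr rA (expr_val s (Reg rq \<oslash> (Reg rp \<ominus> Reg rq) \<oplus> Const 1)) s"
    have a: "regs ?s rA = A" "regs ?s rl = l" "regs ?s rk = k" "regs ?s rn = n" using regs A by simp_all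
    show ?case
    proof (rule run_seq[OF run_doubling[OF a(2) lk(1)]], goal_cases)
      case 4
      show ?case using l2 lG GZ lk by linarith
    next
      case (5 t1 s1)
      then obtain \<beta> where \<beta>: "regs s1 rB = 2 ^ \<beta>" "regs s1 r\<beta> = \<beta>" "l \<le> 2 ^ \<beta>" "2 ^ \<beta> < 2 * l" "t1 \<le> 20 * \<beta> + 20" by blast
      note fr1 = 5(2)[unfolded doubling_frame]
      have a1: "regs s1 rA = A" "regs s1 rk = k" "regs s1 rn = n" using frame_regs[OF fr1] a by simp_all
      define K where "K = ((2::nat) ^ \<beta>) ^ k"
      have Kl: "K \<le> l2" unfolding K_def l2_def using \<beta>(4) by (intro power_mono) auto
      have K1: "1 \<le> K" by (simp add: K_def)
      define U where "U = 10 * A * K * K * k * k"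
      have UG: "U \<le> G" unfolding U_def by (rule mono(1)[OF Kl Kl])
      have U1: "1 \<le> U" unfolding U_def using A1 K1 k1 by simp
      have sub: "10 * A < Z" "10 * A * K < Z" "10 * A * K * K < Z" "10 * A * K * K * k < Z" "10 * A * K * K * k * k < Z" "A < Z" "K < Z" "k < Z" "10 < Z"
        using mono[OF Kl Kl] lG GZ Kl by linarith+
      show ?case
      proof (rule run_seq[OF run_power_loop[OF a1(2) \<beta>(1)]], goal_cases)
        case (2)
        show ?case using Kl lG GZ by (simp add: K_def)
      next
        case (4)
        show ?case using \<beta>(4) l2 lG GZ by linarith
      next
        case (5 t2 s2)
        note fr2 = 5(2)[unfolded power_loop_frame]
        have a2: "regs s2 rA = A" "regs s2 rk = k" "regs s2 rn = n" "regs s2 r\<beta> = \<beta>" "regs s2 rK = K"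
          using frame_regs[OF fr2] a1 \<beta> 5(1) by (simp_all add: K_def)
        show ?case
          unfolding run_Seq[of "Assign rU _"] run_Assign
        proof (intro conjI, goal_cases)
          case 1
          show ?case using a2 sub by simp
        next
          case 2
          let ?e = "Const 10 \<otimes> Reg rA \<otimes> Reg rK \<otimes> Reg rK \<otimes> Reg rk \<otimes> Reg rk"
          have u: "regs (setr rU (expr_val s2 ?e) s2) rU = U" using a2 by (simp add: U_def)
          show ?case
          proof (rule run_seq[OF run_doubling[OF u U1]], goal_cases)
            case 4
            show ?case using UG GZ by linarith
          next
            case (5 t3 s3)
            then obtain b where b: "regs s3 rM = 2 ^ b" "U \<le> 2 ^ b" "2 ^ b < 2 * U" "t3 \<le> 20 * b + 20" by blast
            note fr3 = 5(2)[unfolded doubling_frame]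
            have a3: "regs s3 rn = n" "regs s3 r\<beta> = \<beta>" using frame_regs[OF fr3] a2 by simp_all
            define M where "M = (2::nat) ^ b"
            have MG: "M \<le> 2 * G" using b UG by (simp add: M_def)
            have "M * M \<le> 2 * G * (2 * G)" using MG MG by (rule mult_le_mono)
            moreover from this this have "M * M * (M * M) \<le> 2 * G * (2 * G) * (2 * G * (2 * G))" by (rule mult_le_mono)
            ultimately have Z3: "M < Z" "M * M < Z" "M * M * (M * M) < Z" using GZ MG by simp_all
            have r3: "regs s3 rM = M" using b by (simp add: M_def)
            have n2: "n < Z" "n + 1 < Z" "1 < Z" using big by linarith+
            let ?s4 = "setr rU (n + 1) (setr rV (M * M * (M * M)) (setr rW (M * M) s3))"
            have u4: "regs ?s4 rU = n + 1" "1 \<le> n + 1" by simp_all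
            have R: "run (doubling rU rQ rL) ?s4
              (\<lambda>t s'. \<exists>m. regs s' rQ = 2 ^ m \<and> regs s' rL = m \<and> n + 1 \<le> 2 ^ m \<and> 2 ^ m < 2 * (n + 1) \<and> t \<le> 20 * m + 20)"
              using run_doubling[OF u4, of rQ rL] big by simp
            show ?case
              unfolding run_Seq[of "Assign _ _"] run_Assign
            proof (intro conjI, goal_cases)
              case 4
              have e: "setr rU (expr_val (setr rV (expr_val (setr rW (expr_val s3 (Reg rM \<otimes> Reg rM)) s3) (Reg rW \<otimes> Reg rW))
                   (setr rW (expr_val s3 (Reg rM \<otimes> Reg rM)) s3)) (Reg rn \<oplus> Const 1))
                 (setr rV (expr_val (setr rW (expr_val s3 (Reg rM \<otimes> Reg rM)) s3) (Reg rW \<otimes> Reg rW))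
                   (setr rW (expr_val s3 (Reg rM \<otimes> Reg rM)) s3)) = ?s4"
                using r3 a3 by simp
              show ?case
                unfolding e
              proof (rule run_frame[OF R], goal_cases)
                case (1 t4 s4)
                then obtain L where L: "regs s4 rQ = 2 ^ L" "regs s4 rL = L" "n + 1 \<le> 2 ^ L" "2 ^ L < 2 * (n + 1)" "t4 \<le> 20 * L + 20"
                  by blast
                note fr4 = 1(2)[unfolded doubling_frame]
                have a4: "regs s4 r\<beta> = \<beta>" "regs s4 rM = 2 ^ b" "regs s4 rW = 2 ^ b * 2 ^ b" "regs s4 rV = 2 ^ b * 2 ^ b * (2 ^ b * 2 ^ b)"
                  using frame_regs[OF fr4] a3 b by (simp_all add: M_def)
                show ?case
                  by (rule exI[of _ \<beta>], rule exI[of _ K], rule exI[of _ b], rule exI[of _ L])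
                     (use a4 \<beta> b L UG 5(1) \<open>regs s2 rK = _ \<and> _\<close> in \<open>simp add: K_def U_def\<close>)
              qed
            qed (use r3 a3 Z3 n2 in simp_all)
          qed simp_all
        qed
      qed (use k1 lG GZ in simp_all)
    qed simp_all
  qed
qed

subsection \<open>The whole program\<close>

definition build_splitter :: prog where
  "build_splitter = params ;; xor_table ;; sieve ;; init_weights ;; main_loop"

definition write_ones :: prog where
  "write_ones = rx ::= Const 0 ;; While (Reg rn \<ominus> Reg rx) (Write (Const 1) ;; rx ::= Reg rx \<oplus> Const 1)"

text \<open>For \<open>l = 1\<close> the permitted exponent does not grow with \<open>k\<close>,
  whereas the general construction has \<open>M \<ge> 10 * k * k\<close>. In that case the constant
  function alone is a splitter.\<close>

definition splitter_prog :: prog where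
  "splitter_prog = Cond (Reg rl \<ominus> Const 1) build_splitter write_ones"

lemma (in ram) run_write_ones:
  assumes n: "regs s rn = n" and big: "n + 5 < Z"
  shows "run write_ones s (\<lambda>t s'. t \<le> 20 * n + 10 \<and> outp s' = outp s @ function_tables n [\<lambda>x\<in>{1..n}. 1])"
  unfolding write_ones_def run_Seq run_Assign
proof (intro conjI, goal_cases)
  case 2
  show ?case
  proof (rule run_for[where N = n and c = "\<lambda>_. 10" and
        I = "\<lambda>z s'. regs s' rx = z \<and> regs s' rn = n \<and> outp s' = outp s @ replicate z 1"], goal_cases)
    case (2 z s')
    then show ?case using big by (simp add: run_Seq replicate_append_same)
  next
    case (4 t s')
    have "map (\<lambda>x\<in>{1..n}. 1) [1..<n + 1] = map (\<lambda>x. 1) [1..<n + 1]"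
      by (rule map_cong) auto
    then have "function_tables n [\<lambda>x\<in>{1..n}. 1] = replicate n (1 :: nat)"
      by (simp only: function_tables_def list.map concat.simps append_Nil2 map_replicate_const length_upt add_diff_cancel_right')
    then show ?case using 4 by simp
  qed (use n big in auto)
qed (use big in simp)

lemma balanced_splitter_1:
  assumes "1 \<le> \<delta>" "0 < k"
  shows "balanced_splitter \<delta> n k 1 (mset [\<lambda>x\<in>{1..n}. 1])"
proof -
  have "split_count k 1 (mset [\<lambda>x\<in>{1..n}. 1]) S = 1" if S: "S \<subseteq> {1..n}" "card S = k" for S
  proof -
    have "(\<lambda>x\<in>{1..n}. 1 :: nat) -` {1} \<inter> S = S" using S by auto
    then have "splits k 1 (\<lambda>x\<in>{1..n}. 1) S" using S by (simp add: splits_def del: One_nat_def)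
    then show ?thesis by (simp add: split_count_def)
  qed
  then show ?thesis
    unfolding balanced_splitter_def using assms by (auto intro!: exI[of _ "1 :: real"] simp: field_simps)
qed

text \<open>The table of exclusive ors has \<open>V * V = M ^ 8\<close> entries. The main loop
  treats \<open>M * L\<close> coordinates, each with at most \<open>W * W = M ^ 4\<close> pairs of
  polynomial and state in time \<open>O(M * \<beta> + n)\<close>, which is
  \<open>O(M ^ 7 * L * n)\<close> altogether.\<close>

lemma total_cost_bound:
  fixes M L n \<beta> u :: nat
  assumes M: "1 \<le> M" and L: "1 \<le> L" "L \<le> 2 ^ L" "2 ^ L \<le> 2 * n" and n: "1 \<le> n"
    and le: "\<beta> \<le> M" "u \<le> 3 * M + L"
    and sc: "sc = M * (80 * \<beta> + 40) + 40 * n + 50"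
    and stc: "stc = 180 * 2 ^ L + 90 * (M * L) + 70 * L + 100 + M * M * (M * M * (sc + 10) + 40)"
    and t: "t \<le> (20 * u + 200) + (50 * (M * M * (M * M) * (M * M * (M * M))) + 10)
        + (100 * (M * M * (M * M)) + 10) + (30 * 2 ^ L + 10) + (M * L * (stc + 10) + 10) + 10"
  shows "t \<le> 2000 * (M ^ 8 * L * n)"
proof -
  \<comment> \<open>\<open>y\<close> dominates every monomial in the cost of emitting one
    block.\<close>
  define y where "y = M ^ 6 * n"
  have pw: "1 \<le> M ^ i" for i using M by simp
  have mon: "M ^ i \<le> y" "M ^ i * n \<le> y" if "i \<le> 6" for i
  proof -
    have a: "M ^ i \<le> M ^ 6" using that M by (intro power_increasing) auto
    then show "M ^ i * n \<le> y" unfolding y_def by (rule mult_le_mono1)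
    have "M ^ i * 1 \<le> M ^ 6 * n" using a n by (intro mult_le_mono) auto
    then show "M ^ i \<le> y" by (simp add: y_def)
  qed
  have m1: "1 \<le> y" "n \<le> y" "M * n \<le> y" using mon[of 0] mon[of 1] by simp_all
  have L2: "L \<le> 2 * n" using L by linarith
  have "M * (80 * \<beta> + 40) \<le> M * (80 * M + 40 * M)" using le M by (intro mult_le_mono2) linarith
  then have sc2: "sc + 10 \<le> 120 * M ^ 2 + 40 * n + 60" by (simp add: sc power2_eq_square)
  have "M * M * (M * M * (sc + 10) + 40) = M ^ 4 * (sc + 10) + 40 * M ^ 2"
    by (simp add: algebra_simps power2_eq_square power4_eq_xxxx)
  also have "\<dots> \<le> M ^ 4 * (120 * M ^ 2 + 40 * n + 60) + 40 * M ^ 2" using sc2 by simp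
  also have "\<dots> = 120 * M ^ 6 + 40 * (M ^ 4 * n) + 60 * M ^ 4 + 40 * M ^ 2"
    by (simp add: algebra_simps flip: power_add)
  also have "\<dots> \<le> 260 * y" using mon[of 6] mon[of 4] mon[of 2] by simp
  finally have A: "M * M * (M * M * (sc + 10) + 40) \<le> 260 * y" .
  have "M * L \<le> M * (2 * n)" using L2 by (rule mult_le_mono2)
  also have "\<dots> = 2 * (M * n)" by simp
  finally have "M * L \<le> 2 * y" using m1 by linarith
  then have S: "stc + 10 \<le> 1200 * y" unfolding stc using A L(3) L2 m1 by linarith
  define X where "X = M ^ 8 * L * n"
  have X1: "M ^ i * L \<le> X" "M ^ i * n \<le> X" "M ^ i \<le> X" if "i \<le> 8" for i
  proof -
    have a: "M ^ i \<le> M ^ 8" using that M by (intro power_increasing) auto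
    have "M ^ i * L * 1 \<le> M ^ 8 * L * n" "M ^ i * 1 * n \<le> M ^ 8 * L * n" "M ^ i * 1 * 1 \<le> M ^ 8 * L * n"
      using a L(1) n by (intro mult_le_mono; simp)+
    then show "M ^ i * L \<le> X" "M ^ i * n \<le> X" "M ^ i \<le> X" by (simp_all add: X_def)
  qed
  have "M * L * (stc + 10) \<le> M * L * (1200 * y)" using S by (rule mult_le_mono2)
  also have "\<dots> = 1200 * (M ^ Suc 6 * L * n)" by (simp only: y_def power_Suc mult_ac)
  also have "M ^ Suc 6 * L * n \<le> X" unfolding X_def using M by (intro mult_le_mono1 power_increasing) auto
  finally have B: "M * L * (stc + 10) \<le> 1200 * X" by simp
  have p: "M * M * (M * M) = M ^ 4" "M ^ 4 * M ^ 4 = M ^ 8"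
    by (simp only: power4_eq_xxxx mult.assoc) (simp flip: power_add)
  have "M \<le> X" "L \<le> X" "n \<le> X" "1 \<le> X" "M ^ 8 \<le> X" "M ^ 4 \<le> X"
    using X1[of 1] X1[of 0] X1[of 8] X1[of 4] by simp_all
  then show ?thesis using t B le L(3) unfolding p X_def[symmetric] by linarith
qed

text \<open>In \<open>big\<close>, the power \<open>G ^ 8\<close> pays for the addresses in the
  table of exclusive ors, as \<open>V * V = M ^ 8 \<le> 256 * G ^ 8\<close>, and
  \<open>n ^ 3\<close> for the total weight, which stays within
  \<open>2 ^ L * 4 ^ L \<le> 8 * n ^ 3\<close>.\<close>

lemma (in ram) run_build_splitter:
  assumes s: "s = init_state [n, k, l, p, q]" and lk: "2 \<le> l" "l \<le> k" "k \<le> n"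
    and pq: "q < p" "p < Z" and A: "A = q div (p - q) + 1"
    and G: "G = 10 * A * (2 * l) ^ k * (2 * l) ^ k * k * k"
    and big: "10000 * (G ^ 8 * n ^ 3) < Z"
  shows "run build_splitter s (\<lambda>t s'. \<exists>\<beta> K b L hs. l \<le> 2 ^ \<beta> \<and> \<beta> \<le> k \<and> K = (2 ^ \<beta>) ^ k \<and>
    10 * A * K * K * k * k \<le> 2 ^ b \<and> 2 ^ b \<le> 2 * G \<and> n < 2 ^ L \<and> 2 ^ L \<le> 2 * n \<and> good_code L (2 ^ b) hs \<and>
    outp s' = function_tables n (concat (map (block n (2 ^ b * 2 ^ b) \<beta> l) hs)) \<and>
    t \<le> 2000 * ((2 ^ b) ^ 8 * L * n))"
proof -
  have n2: "2 \<le> n" using lk by linarith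
  have A1: "1 \<le> A" by (simp add: A)
  have k1: "1 \<le> k" using lk by linarith
  have G10: "10 \<le> G" "l \<le> G" "k \<le> G"
  proof -
    have l2: "2 * l \<le> (2 * l) ^ k" using lk k1 by (intro self_le_power) auto
    then have "1 \<le> (2 * l) ^ k" using lk by linarith
    then have "10 * 1 * 1 * 1 * 1 * 1 \<le> G" "1 * 1 * (2 * l) ^ k * 1 * 1 * 1 \<le> G" "1 * 1 * 1 * 1 * k * 1 \<le> G"
      unfolding G using A1 k1 by (intro mult_le_mono; simp)+
    then show "10 \<le> G" "l \<le> G" "k \<le> G" using l2 by simp_all
  qed
  define Y where "Y = G ^ 8 * n ^ 3"
  have YZ: "10000 * Y < Z" using big by (simp add: Y_def)
  have Ymono: "G ^ i * n ^ j \<le> Y" if "i \<le> 8" "j \<le> 3" for i j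
    unfolding Y_def using that G10 n2 by (intro mult_le_mono power_increasing) auto
  have Ys: "G \<le> Y" "n \<le> Y" "1 \<le> Y" "G ^ 8 \<le> Y" "G ^ 4 \<le> Y" "n ^ 3 \<le> Y" "G * n \<le> Y"
    using Ymono[of 1 0] Ymono[of 0 1] Ymono[of 0 0] Ymono[of 8 0] Ymono[of 4 0] Ymono[of 0 3] Ymono[of 1 1] by simp_all
  have regs: "regs s rn = n" "regs s rk = k" "regs s rl = l" "regs s rp = p" "regs s rq = q"
    and arr0: "arr s j i = 0" and out0: "outp s = []" for i j
    by (simp_all add: s init_state_def arr_def)
  have Gbig: "16 * G * G * G * G + 20 < Z" "2 * n + 10 < Z"
  proof -
    have "16 * G * G * G * G = 16 * G ^ 4" by (simp add: power4_eq_xxxx)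
    then show "16 * G * G * G * G + 20 < Z" "2 * n + 10 < Z" using Ys YZ by linarith+
  qed
  show ?thesis
    unfolding build_splitter_def
  proof (rule run_seq[OF run_params[OF regs _ lk(2) pq A G Gbig]], goal_cases)
    case 1
    show ?case using lk by simp
  next
    case (2 t1 s1)
    obtain \<beta> K b L where P: "regs s1 r\<beta> = \<beta>" "l \<le> 2 ^ \<beta>" "2 ^ \<beta> < 2 * l" "K = (2 ^ \<beta>) ^ k"
      "regs s1 rM = 2 ^ b" "10 * A * K * K * k * k \<le> 2 ^ b" "2 ^ b < 2 * (10 * A * K * K * k * k)"
      "10 * A * K * K * k * k \<le> G" "regs s1 rW = 2 ^ b * 2 ^ b" "regs s1 rV = 2 ^ b * 2 ^ b * (2 ^ b * 2 ^ b)"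
      "regs s1 rL = L" "regs s1 rQ = 2 ^ L" "n < 2 ^ L" "2 ^ L < 2 * (n + 1)" "t1 \<le> 20 * (\<beta> + k + b + L) + 200"
      using 2(1) by blast
    note fr1 = 2(2)[unfolded params_frame]
    have a1: "regs s1 rn = n" "regs s1 rl = l" using frame_regs[OF fr1] regs by simp_all
    have z1: "arr s1 j i = 0" if "j < 8" for j i
      using frame_arr[OF fr1, of j] arr0 that by simp
    have out1: "outp s1 = []" using 2(3) params_frame out0 by simp
    define M where "M = (2::nat) ^ b"
    define W where "W = M * M"
    define V where "V = W * W"
    define r where "r = 2 * b"
    have MG: "M \<le> 2 * G" using P(7,8) by (simp add: M_def)
    have K1: "1 \<le> K" by (simp add: P(4))
    have Mlow: "10 * k \<le> M"
    proof -
      have "10 * 1 * 1 * 1 * k * 1 \<le> 10 * A * K * K * k * k" using A1 K1 k1 by (intro mult_le_mono; simp)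
      also note P(6)
      finally show ?thesis by (simp add: M_def)
    qed
    have b0: "0 < b"
    proof (rule gr0I)
      assume "b = 0" then show False using Mlow k1 by (simp add: M_def)
    qed
    have Wr: "W = 2 ^ r" by (simp add: W_def M_def r_def mult_2 power_add)
    have Vv: "V = 2 ^ (2 * r)" by (simp add: V_def Wr mult_2 power_add)
    have r0: "0 < r" using b0 by (simp add: r_def)
    have VV: "V * V = M ^ 8" by (simp add: V_def W_def eval_nat_numeral)
    have "M ^ 8 \<le> (2 * G) ^ 8" using MG by (rule power_mono) simp
    also have "\<dots> = 256 * G ^ 8" by (simp add: power_mult_distrib)
    also have "\<dots> \<le> 256 * Y" using Ys by simp
    finally have VVY: "V * V \<le> 256 * Y" unfolding VV .
    have big1: "16 * (V * V) + 16 < Z" "16 * (V * V) + 20 < Z" using VVY Ys YZ by linarith+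
    have L0: "0 < L" using P(13) n2 by (cases L) auto
    \<comment> \<open>For \<open>L > 0\<close> both \<open>2 ^ L\<close> and
      \<open>2 * (n + 1)\<close> are even, so the strict inequality gains 2.\<close>
    have Ln: "2 ^ L \<le> 2 * n" using P(14) L0 by (cases L) auto
    have \<beta>k: "\<beta> \<le> k"
    proof (rule ccontr)
      assume "\<not> \<beta> \<le> k"
      then have "(2::nat) ^ Suc k \<le> 2 ^ \<beta>" by (intro power_increasing) auto
      moreover have "k < 2 ^ k" by simp
      ultimately show False using P(3) lk by simp
    qed
    have MV: "M \<le> V"
    proof -
      have "M * 1 \<le> M * (M * W)" unfolding W_def M_def by (intro mult_le_mono2) simp
      then show ?thesis by (simp add: V_def W_def mult.assoc)
    qed
    have regs1: "regs s1 rV = V" "regs s1 rW = W" "regs s1 rM = M" using P by (simp_all add: V_def W_def M_def)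
    interpret C: construction w Z n l \<beta> M W V r b L
    proof unfold_locales
      have "2 ^ L * (4::nat) ^ L = (2 ^ 3) ^ L" by (simp flip: power_mult_distrib)
      also have "\<dots> = (2 ^ L) ^ 3" by (simp only: power_mult[symmetric] mult.commute)
      finally have q: "2 ^ L * (4::nat) ^ L = (2 ^ L) ^ 3" .
      have "(2 ^ L) ^ 3 \<le> (2 * n) ^ 3" using Ln by (rule power_mono) simp
      also have "\<dots> = 8 * n ^ 3" by (simp add: power_mult_distrib)
      finally show "2 * (2 ^ L * 4 ^ L) < Z" unfolding q using Ys YZ by linarith
      have "L < 2 ^ L" by simp
      then have "M * L \<le> 2 * G * (2 * n)" using MG Ln by (intro mult_le_mono) linarith+
      then have "M * L \<le> 4 * (G * n)" by simp
      then show "M * L + 1 < Z" using Ys YZ by linarith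
      show "2 ^ \<beta> < Z" "\<beta> + 20 < Z" "8 * M + 30 < Z" "l + 1 < Z" "8 * n + 40 < Z" "16 * 2 ^ L + 20 < Z"
        using P(3) \<beta>k G10 Ys YZ MG Ln by linarith+
    qed (use Wr V_def r0 lk big1 M_def MV P(13) in simp_all)
    have Lless: "L \<le> 2 ^ L" by (simp add: less_imp_le)
    show ?case
    proof (rule run_seq[OF run_xor_table[OF regs1(1) Vv _ _ big1(1)]], goal_cases)
      case (3 t2 s2)
      note fr2 = 3(2)[unfolded xor_table_frame]
      have a2: "regs s2 rW = W" "regs s2 rV = V" using frame_regs[OF fr2] regs1 by simp_all
      have z2: "arr s2 aC i = 0" "arr s2 aD i = 0" for i using frame_arr[OF fr2] z1 by simp_all
      have x2: "arr s2 aX (a * V + b) = a XOR b" if "a < V" "b < V" for a b using 3(1) that by blast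
      have out2: "outp s2 = []" using 3(3) xor_table_frame out1 by simp
      show ?case
      proof (rule run_seq[OF run_sieve[OF a2 V_def Wr r0 z2 x2 big1(1)]], goal_cases)
        case (3 t3 s3)
        note fr3 = 3(2)[unfolded sieve_frame]
        have q3: "regs s3 rQ = 2 ^ L" using frame_regs[OF fr3] frame_regs[OF fr2] P by simp
        have out3: "outp s3 = []" using 3(3) sieve_frame out2 by simp
        have "8 * 2 ^ L + 20 < Z" using C.bigL(1) by linarith
        show ?case
        proof (rule run_seq[OF run_init_weights[OF q3 \<open>8 * 2 ^ L + 20 < Z\<close>]], goal_cases)
          case (1 t4 s4)
          note fr4 = 1(2)[unfolded init_weights_frame]
          have out4: "outp s4 = []" using 1(3) init_weights_frame out3 by simp
          have rr: "regs s4 x = regs s1 x" if "x \<notin> {rx, rz}" for x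
            using frame_regs[OF fr4] frame_regs[OF fr3] frame_regs[OF fr2] that by simp
          have aa: "arr s4 aX = arr s2 aX" "arr s4 aD = arr s3 aD"
            using frame_arr[OF fr4] frame_arr[OF fr3] by simp_all
          have su: "C.set_up s4"
            unfolding C.set_up_def aa using rr P regs1 a1 x2 3(1) by simp
          have w4: "arr s4 aw x = 1" if "x < 2 ^ L" for x using 1(1) that by blast
          show ?case
          proof (rule run_mono[OF C.run_main_loop[OF su w4]], assumption)
            fix t5 s5
            assume *: "t5 \<le> M * L * (C.step_cost + 10) + 10 \<and>
              (\<exists>hs. good_code L M hs \<and> outp s5 = outp s4 @ function_tables n (concat (map (block n W \<beta> l) hs)))"
            then obtain hs where hs: "good_code L M hs" "outp s5 = function_tables n (concat (map (block n W \<beta> l) hs))"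
              using out4 by auto
            have "t1 + (t2 + (t3 + (t4 + t5))) \<le> 2000 * (M ^ 8 * L * n)"
            proof (rule total_cost_bound[OF _ _ Lless Ln _ _ _ C.state_cost_def])
              show "C.step_cost = 180 * 2 ^ L + 90 * (M * L) + 70 * L + 100 + M * M * (M * M * (C.state_cost + 10) + 40)"
                by (simp only: C.step_cost_def W_def[symmetric])
              show "\<beta> \<le> M" using \<beta>k Mlow by linarith
              have "b \<le> M" by (simp add: M_def less_imp_le)
              then show "\<beta> + k + b + L \<le> 3 * M + L" using \<beta>k Mlow by linarith
              show "t1 + (t2 + (t3 + (t4 + t5))) \<le> (20 * (\<beta> + k + b + L) + 200) + (50 * (M * M * (M * M) * (M * M * (M * M))) + 10)
                 + (100 * (M * M * (M * M)) + 10) + (30 * 2 ^ L + 10) + (M * L * (C.step_cost + 10) + 10) + 10"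
                using P(15) 1(1) 3(1) \<open>t2 \<le> _ \<and> _\<close> * unfolding V_def W_def by linarith
            qed (use L0 n2 in \<open>simp_all add: M_def\<close>)
            then show "\<exists>\<beta> K b L hs. l \<le> 2 ^ \<beta> \<and> \<beta> \<le> k \<and> K = (2 ^ \<beta>) ^ k \<and>
              10 * A * K * K * k * k \<le> 2 ^ b \<and> 2 ^ b \<le> 2 * G \<and> n < 2 ^ L \<and> 2 ^ L \<le> 2 * n \<and> good_code L (2 ^ b) hs \<and>
              outp s5 = function_tables n (concat (map (block n (2 ^ b * 2 ^ b) \<beta> l) hs)) \<and>
              t1 + (t2 + (t3 + (t4 + t5))) \<le> 2000 * ((2 ^ b) ^ 8 * L * n)"
              using P(2,4,6,13) \<beta>k MG Ln hs unfolding M_def W_def by blast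
          qed
        qed
      qed
    qed (use z1 r0 in simp_all)
  qed
qed

section \<open>The bounds\<close>

lemma expo_powr:
  assumes "1 \<le> l" "1 < \<delta>"
  shows "2 powr expo k l \<delta> = real l ^ k / (\<delta> - 1)"
proof -
  have "2 powr expo k l \<delta> = 2 powr (real k * log 2 (real l)) / 2 powr (log 2 (\<delta> - 1))"
    by (simp add: expo_def powr_diff)
  also have "2 powr (real k * log 2 (real l)) = (2 powr log 2 (real l)) powr real k"
    by (simp add: powr_powr mult.commute)
  finally show ?thesis using assms by (simp add: powr_realpow)
qed

text \<open>The integer \<open>A\<close> replaces \<open>1 / (\<delta> - 1)\<close>. It is large
  enough since \<open>p / q \<le> \<delta>\<close>. It is at most three times as large since the
  fraction determines \<open>\<delta> - 1\<close> up to a factor 2 and rounding adds at most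
  \<open>1 \<le> 1 / (\<delta> - 1)\<close>.\<close>

lemma precision_bounds:
  assumes pr: "presents p q \<delta>" and \<delta>: "1 < \<delta>" "\<delta> \<le> 2" and A: "A = q div (p - q) + 1"
  shows "q < p" "1 \<le> real A * (\<delta> - 1)" "real A \<le> 3 / (\<delta> - 1)"
proof -
  have q: "0 < q" "1 < real p / real q" "real p / real q \<le> \<delta>" "\<delta> - 1 \<le> 2 * (real p / real q - 1)"
    using pr by (auto simp: presents_def)
  show pq: "q < p" using q by (simp add: field_simps)
  define d where "d = p - q"
  have d: "0 < d" "real p = real q + real d" using pq by (simp_all add: d_def)
  have dq: "real p / real q - 1 = real d / real q" using d q by (simp add: field_simps)
  have "q < d * A"
    using dividend_less_div_times[OF d(1), of q] by (simp add: A d_def algebra_simps)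
  then have "real q \<le> real d * real A" by (metis less_imp_le of_nat_le_iff of_nat_mult)
  then have "1 \<le> real A * (real d / real q)" using q by (simp add: field_simps)
  also have "\<dots> \<le> real A * (\<delta> - 1)" using q dq by (intro mult_left_mono) auto
  finally show "1 \<le> real A * (\<delta> - 1)" .
  have "real (q div d) \<le> real q / real d" by (rule of_nat_div_le_of_nat)
  also have "\<dots> \<le> 2 / (\<delta> - 1)"
    using q(1,4) d(1) \<delta> unfolding dq by (simp add: field_simps)
  finally have "real A \<le> 2 / (\<delta> - 1) + 1" by (simp add: A d_def)
  also have "\<dots> \<le> 2 / (\<delta> - 1) + 1 / (\<delta> - 1)" using \<delta> by (intro add_left_mono) simp
  also have "\<dots> = 3 / (\<delta> - 1)" by (simp flip: add_divide_distrib)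
  finally show "real A \<le> 3 / (\<delta> - 1)" .
qed

text \<open>From \<open>l \<ge> 2\<close> follow \<open>k \<le> 2 ^ k \<le> l ^ k\<close> and
  \<open>(2 * l) ^ k \<le> (l ^ k) ^ 2\<close>, so all parameters are bounded by powers of
  \<open>E = 2 powr expo k l \<delta>\<close>. As \<open>E \<ge> 4\<close>, numerical factors can be
  absorbed into further powers.\<close>

lemma magnitude_bound:
  assumes l: "2 \<le> l" "l \<le> k" and \<delta>: "1 < \<delta>" "\<delta> \<le> 2" and A: "real A \<le> 3 / (\<delta> - 1)"
    and G: "G = 10 * A * (2 * l) ^ k * (2 * l) ^ k * k * k" and E: "E = real l ^ k / (\<delta> - 1)"
  shows "4 \<le> E" "real G \<le> 30 * E ^ 6" "2 * real G \<le> E ^ 9"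
proof -
  define x where "x = real l ^ k"
  define a where "a = 1 / (\<delta> - 1)"
  have a1: "1 \<le> a" using \<delta> by (simp add: a_def)
  have Exa: "E = x * a" by (simp add: E x_def a_def)
  have two: "2 ^ k \<le> x" unfolding x_def using l by (intro power_mono) auto
  have "(2::real) ^ 2 \<le> 2 ^ k" using l by (intro power_increasing) auto
  then have x4: "4 \<le> x" using two by simp
  then show E4: "4 \<le> E" unfolding Exa using mult_mono[of 4 x 1 a] a1 by simp
  have "real k \<le> 2 ^ k" using of_nat_less_two_power[of k, where 'a = real] by simp
  then have kx: "real k \<le> x" using two by linarith
  have "(2 * real l) ^ k \<le> (real l * real l) ^ k" using l by (intro power_mono mult_right_mono) auto
  then have lx: "(2 * real l) ^ k \<le> x * x" by (simp add: x_def power_mult_distrib)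
  have "real G = 10 * real A * ((2 * real l) ^ k * (2 * real l) ^ k) * (real k * real k)" by (simp add: G)
  also have "\<dots> \<le> 10 * (3 * a) * ((x * x) * (x * x)) * (x * x)"
    using A lx kx x4 a1 \<delta> by (intro mult_mono) (auto simp: a_def)
  also have "\<dots> = 30 * (x ^ 6 * a)" by (simp add: eval_nat_numeral)
  also have "\<dots> \<le> 30 * (x ^ 6 * a ^ 6)"
    using a1 x4 self_le_power[of a 6] by (intro mult_left_mono) auto
  finally show G30: "real G \<le> 30 * E ^ 6" by (simp add: Exa power_mult_distrib)
  \<comment> \<open>The exponent 9 is 6 + 3, as
    \<open>2 * 30 \<le> 4 ^ 3 \<le> E ^ 3\<close>.\<close>
  have "(4::real) ^ 3 \<le> E ^ 3" using E4 by (intro power_mono) auto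
  then have "64 * E ^ 6 \<le> E ^ 3 * E ^ 6" using E4 by (intro mult_right_mono) auto
  also have "\<dots> = E ^ 9" by (simp flip: power_add)
  finally have "64 * E ^ 6 \<le> E ^ 9" .
  moreover have "0 \<le> E ^ 6" using E4 by simp
  ultimately show "2 * real G \<le> E ^ 9" using G30 by linarith
qed

text \<open>Exponentiating the hypothesis on \<open>w\<close> gives room for a high power of each of
  2, \<open>E\<close> and \<open>n\<close>, from which the overflow conditions of the program
  follow.\<close>

lemma word_bound:
  assumes w: "4000 * (1 + expo k l \<delta> + log 2 (real n)) \<le> real w" and n: "1 \<le> n"
    and l: "1 \<le> l" and \<delta>: "1 < \<delta>" "\<delta> \<le> 2" and E: "E = real l ^ k / (\<delta> - 1)"
  shows "2 ^ 4000 * (E ^ 4000 * real n ^ 4000) \<le> real (2 ^ w)" "1 \<le> E"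
proof -
  have Ep: "2 powr expo k l \<delta> = E" using expo_powr[OF l \<delta>(1)] E by simp
  have "1 \<le> real l ^ k" using l by simp
  then have "1 \<le> real l ^ k / (\<delta> - 1)" using \<delta> by (simp add: field_simps)
  then show E1: "1 \<le> E" by (simp add: E)
  have "2 powr (4000 * (1 + expo k l \<delta> + log 2 (real n))) = (2 powr (1 + expo k l \<delta> + log 2 (real n))) powr 4000"
    by (simp add: powr_powr mult.commute)
  also have "2 powr (1 + expo k l \<delta> + log 2 (real n)) = 2 * E * real n"
    using n by (simp add: powr_add Ep)
  also have "(2 * E * real n) powr 4000 = (2 * E * real n) ^ 4000"
    using n E1 by (simp add: powr_numeral)
  also have "\<dots> = 2 ^ 4000 * (E ^ 4000 * real n ^ 4000)" by (simp only: power_mult_distrib mult.assoc)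
  finally have "2 ^ 4000 * (E ^ 4000 * real n ^ 4000) = 2 powr (4000 * (1 + expo k l \<delta> + log 2 (real n)))" by simp
  also have "\<dots> \<le> 2 powr real w" using w by (intro powr_mono) auto
  also have "\<dots> = real (2 ^ w)" by (simp add: powr_realpow)
  finally show "2 ^ 4000 * (E ^ 4000 * real n ^ 4000) \<le> real (2 ^ w)" .
qed

text \<open>There are \<open>M * L\<close> coordinates, at most \<open>M * M\<close> irreducible
  polynomials and \<open>M * M\<close> states.\<close>

lemma length_blocks:
  assumes "good_code L M hs"
  shows "length (concat (map (block n (M * M) \<beta> l) hs)) \<le> M ^ 5 * L"
proof -
  have "length (irred_nats (M * M)) \<le> length [M * M..<2 * (M * M)]"
    unfolding irred_nats_def by (rule length_filter_le)
  then have I: "length (irred_nats (M * M)) * (M * M) \<le> (M * M) * (M * M)" by (intro mult_le_mono1) simp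
  have "length (concat (map (block n (M * M) \<beta> l) xs)) = length xs * (length (irred_nats (M * M)) * (M * M))" for xs
    by (induction xs) (simp_all add: length_block)
  then have "length (concat (map (block n (M * M) \<beta> l) hs)) = M * L * (length (irred_nats (M * M)) * (M * M))"
    using assms by (simp add: good_code_def)
  also have "\<dots> \<le> M * L * ((M * M) * (M * M))" using I by (rule mult_le_mono2)
  also have "\<dots> = M ^ 5 * L" by (simp add: eval_nat_numeral)
  finally show ?thesis .
qed

lemma exponent_le_lg: "1 \<le> n \<Longrightarrow> 2 ^ L \<le> 2 * n \<Longrightarrow> real L \<le> 2 * lg n"
proof -
  assume n: "1 \<le> n" and L: "2 ^ L \<le> 2 * n"
  have "real (2 ^ L) \<le> real (2 * n)" using L by (simp only: of_nat_le_iff)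
  then have "log 2 (2 ^ L) \<le> log 2 (2 * real n)" using n by (subst log_le_cancel_iff) auto
  then have "real L \<le> 1 + log 2 (real n)" using n by (simp add: log_mult log_nat_power)
  then show ?thesis by (simp add: lg_def)
qed

lemma general_case:
  assumes l: "2 \<le> l" "l \<le> k" "k \<le> n" and \<delta>: "1 < \<delta>" "\<delta> \<le> 2" and pr: "presents p q \<delta>" and p: "p < 2 ^ w"
    and w: "4000 * (1 + expo k l \<delta> + log 2 (real n)) \<le> real w"
  shows "\<exists>t s hs. exec w splitter_prog (init_state [n, k, l, p, q]) t s \<and> outp s = function_tables n hs \<and>
    balanced_splitter \<delta> n k l (mset hs) \<and> real (length hs) \<le> 2 powr (4000 * expo k l \<delta>) * lg n \<and>
    real t \<le> 4000 * 2 powr (4000 * expo k l \<delta>) * real n * lg n"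
proof -
  define A where "A = q div (p - q) + 1"
  define G where "G = 10 * A * (2 * l) ^ k * (2 * l) ^ k * k * k"
  define E where "E = real l ^ k / (\<delta> - 1)"
  note A = precision_bounds[OF pr \<delta> A_def]
  note E = magnitude_bound[OF l(1,2) \<delta> A(3) G_def E_def]
  have n1: "1 \<le> n" "1 \<le> l" using l by linarith+
  note wb = word_bound[OF w n1(1) n1(2) \<delta> E_def]
  have EC: "2 powr (4000 * expo k l \<delta>) = E ^ 4000"
  proof -
    have "2 powr (4000 * expo k l \<delta>) = (2 powr expo k l \<delta>) powr 4000" by (simp add: powr_powr mult.commute)
    also have "2 powr expo k l \<delta> = E" using expo_powr[OF n1(2) \<delta>(1)] by (simp add: E_def)
    also have "E powr 4000 = E ^ 4000" using wb(2) by (simp add: powr_numeral)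
    finally show ?thesis .
  qed
  have lg1: "1 \<le> lg n" by (simp add: lg_def)
  have "10000 * (G ^ 8 * n ^ 3) < 2 ^ w"
  proof -
    have "real (10000 * (G ^ 8 * n ^ 3)) = 10000 * (real G ^ 8 * real n ^ 3)" by simp
    also have "\<dots> \<le> 10000 * ((30 * E ^ 6) ^ 8 * real n ^ 3)"
      using E(2) by (intro mult_left_mono mult_right_mono power_mono) auto
    also have "\<dots> = 10000 * 30 ^ 8 * (E ^ 48 * real n ^ 3)" by (simp add: power_mult_distrib flip: power_mult)
    also have "\<dots> < 2 ^ 4000 * (E ^ 48 * real n ^ 3)"
    proof (rule mult_strict_right_mono)
      have "(10000 * 30 ^ 8 :: real) < 2 ^ 100" by simp
      also have "(2 ^ 100 :: real) \<le> 2 ^ 4000" by (rule power_increasing) simp_all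
      finally show "(10000 * 30 ^ 8 :: real) < 2 ^ 4000" .
      show "0 < E ^ 48 * real n ^ 3" using wb(2) n1 by simp
    qed
    also have "\<dots> \<le> 2 ^ 4000 * (E ^ 4000 * real n ^ 4000)"
      using wb(2) n1 by (intro mult_left_mono mult_mono power_increasing) auto
    also have "\<dots> \<le> real (2 ^ w)" by (rule wb(1))
    finally show ?thesis by (simp only: of_nat_less_iff)
  qed
  note big = this
  interpret ram w "2 ^ w" by unfold_locales simp
  have "run build_splitter (init_state [n, k, l, p, q]) (\<lambda>t s'. \<exists>\<beta> K b L hs. l \<le> 2 ^ \<beta> \<and> \<beta> \<le> k \<and> K = (2 ^ \<beta>) ^ k \<and>
    10 * A * K * K * k * k \<le> 2 ^ b \<and> 2 ^ b \<le> 2 * G \<and> n < 2 ^ L \<and> 2 ^ L \<le> 2 * n \<and> good_code L (2 ^ b) hs \<and>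
    outp s' = function_tables n (concat (map (block n (2 ^ b * 2 ^ b) \<beta> l) hs)) \<and>
    t \<le> 2000 * ((2 ^ b) ^ 8 * L * n))"
    by (rule run_build_splitter[OF refl l A(1) p A_def G_def big])
  then obtain t s' \<beta> K b L hs where R: "exec w build_splitter (init_state [n, k, l, p, q]) t s'" "l \<le> 2 ^ \<beta>" "\<beta> \<le> k" "K = (2 ^ \<beta>) ^ k"
    "10 * A * K * K * k * k \<le> 2 ^ b" "2 ^ b \<le> 2 * G" "n < 2 ^ L" "2 ^ L \<le> 2 * n" "good_code L (2 ^ b) hs"
    "outp s' = function_tables n (concat (map (block n (2 ^ b * 2 ^ b) \<beta> l) hs))" "t \<le> 2000 * ((2 ^ b) ^ 8 * L * n)"
    unfolding run_def by blast
  define M where "M = (2::nat) ^ b"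
  define hs' where "hs' = concat (map (block n (M * M) \<beta> l) hs)"
  have M9: "real M \<le> E ^ 9"
  proof -
    have "real M \<le> real (2 * G)" using R(6) unfolding M_def by (simp only: of_nat_le_iff)
    then show ?thesis using E(3) by simp
  qed
  have MP: "real M ^ i \<le> E ^ (9 * i)" for i
    using power_mono[OF M9, of i] by (simp add: power_mult)
  have L2: "real L \<le> 2 * lg n" by (rule exponent_le_lg[OF n1(1) R(8)])
  have bal: "balanced_splitter \<delta> n k l (mset hs')"
    unfolding hs'_def
    by (rule balanced_blocks[OF l R(7) _ refl R(2,3,4) \<delta> A(2)]) (use R(5,9) in \<open>simp_all add: M_def\<close>)
  have len: "real (length hs') \<le> E ^ 4000 * lg n"
  proof -
    have "length hs' \<le> M ^ 5 * L" unfolding hs'_def using R(9) by (intro length_blocks) (simp add: M_def)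
    then have "real (length hs') \<le> real (M ^ 5 * L)" by (simp only: of_nat_le_iff)
    also have "\<dots> = real M ^ 5 * real L" by simp
    also have "\<dots> \<le> E ^ 45 * (2 * lg n)" using MP[of 5] L2 wb(2) by (intro mult_mono) auto
    also have "\<dots> = (2 * E ^ 45) * lg n" by simp
    \<comment> \<open>The bound on the size admits no constant factor, so the 2 is absorbed by
      \<open>E \<ge> 4\<close>.\<close>
    also have "\<dots> \<le> E * E ^ 45 * lg n"
      using E(1) lg1 by (intro mult_right_mono) simp_all
    also have "\<dots> = E ^ 46 * lg n" by (simp flip: power_Suc)
    also have "\<dots> \<le> E ^ 4000 * lg n" using wb(2) lg1 by (intro mult_right_mono power_increasing) auto
    finally show ?thesis .
  qed
  have f: "fits (2 ^ w) (init_state [n, k, l, p, q]) (Reg rl \<ominus> Const 1)"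
  proof -
    have "real (l + 1) \<le> 2 * real n" using l by simp
    also have "\<dots> \<le> 2 ^ 4000 * (1 * real n ^ 4000)"
    proof (rule mult_mono)
      have "(2::real) ^ 1 \<le> 2 ^ 4000" by (rule power_increasing) simp_all
      then show "(2::real) \<le> 2 ^ 4000" by (simp only: power_one_right)
      show "real n \<le> 1 * real n ^ 4000" using self_le_power[of "real n" 4000] n1 by simp
    qed simp_all
    also have "\<dots> \<le> 2 ^ 4000 * (E ^ 4000 * real n ^ 4000)" using wb(2) by (intro mult_left_mono mult_right_mono) simp_all
    also have "\<dots> \<le> real (2 ^ w)" by (rule wb(1))
    finally have "l + 1 \<le> 2 ^ w" by (simp only: of_nat_le_iff)
    then show ?thesis using l by (simp add: init_state_def)
  qed
  have "run build_splitter (init_state [n, k, l, p, q]) (\<lambda>t' s''. t' = t \<and> s'' = s')"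
    unfolding run_def using R(1) by blast
  then have "run splitter_prog (init_state [n, k, l, p, q]) (\<lambda>t' s''. t' = 4 + t \<and> s'' = s')"
    unfolding splitter_prog_def run_Cond using f l by (simp add: init_state_def)
  then have ex: "exec w splitter_prog (init_state [n, k, l, p, q]) (4 + t) s'" unfolding run_def by blast
  have time: "real (4 + t) \<le> 4000 * E ^ 4000 * real n * lg n"
  proof -
    have "real t \<le> real (2000 * (M ^ 8 * L * n))" using R(11) unfolding M_def by (simp only: of_nat_le_iff)
    also have "\<dots> = 2000 * (real M ^ 8 * real L * real n)" by simp
    also have "\<dots> \<le> 2000 * (E ^ 72 * (2 * lg n) * real n)"
      using MP[of 8] L2 wb(2) lg1 by (intro mult_left_mono mult_right_mono mult_mono) auto
    finally have t: "real t \<le> 4000 * (E ^ 72 * (real n * lg n))" by (simp add: mult_ac)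
    have nl: "1 \<le> real n * lg n" using mult_mono[of 1 "real n" 1 "lg n"] n1 lg1 by simp
    have "4 * 1 \<le> E ^ 72 * (real n * lg n) * 4"
      using nl wb(2) mult_mono[of 1 "E ^ 72" 1 "real n * lg n"] by simp
    with t have "real (4 + t) \<le> 4004 * (E ^ 72 * (real n * lg n))" by simp
    \<comment> \<open>The 4 steps of the initial test are absorbed by one more power of
      \<open>E\<close>.\<close>
    also have "\<dots> \<le> 4000 * (E ^ 73 * (real n * lg n))"
    proof -
      have "4004 * E ^ 72 \<le> 4000 * (E * E ^ 72)" using E(1) by simp
      then have "4004 * E ^ 72 * (real n * lg n) \<le> 4000 * (E * E ^ 72) * (real n * lg n)"
        using nl by (intro mult_right_mono) auto
      moreover have "E * E ^ 72 = E ^ 73" by (simp flip: power_Suc)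
      ultimately show ?thesis by (simp only: mult.assoc)
    qed
    also have "\<dots> \<le> 4000 * (E ^ 4000 * (real n * lg n))"
      using wb(2) nl by (intro mult_left_mono mult_right_mono power_increasing) auto
    finally show ?thesis by (simp only: mult.assoc)
  qed
  show ?thesis
    using ex R(10) bal len time unfolding EC hs'_def M_def by blast
qed

lemma one_part_case:
  assumes k: "1 \<le> k" "k \<le> n" and \<delta>: "1 < \<delta>" "\<delta> \<le> 2"
    and w: "4000 * (1 + expo k 1 \<delta> + log 2 (real n)) \<le> real w"
  shows "\<exists>t s hs. exec w splitter_prog (init_state [n, k, 1, p, q]) t s \<and> outp s = function_tables n hs \<and>
    balanced_splitter \<delta> n k 1 (mset hs) \<and> real (length hs) \<le> 2 powr (4000 * expo k 1 \<delta>) * lg n \<and>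
    real t \<le> 4000 * 2 powr (4000 * expo k 1 \<delta>) * real n * lg n"
proof -
  have n1: "1 \<le> n" using k by linarith
  note wb = word_bound[OF w n1 order_refl \<delta> refl]
  \<comment> \<open>With \<open>l = 1\<close> the exponent is \<open>- log 2 (\<delta> - 1)\<close>,
    which is nonnegative because \<open>\<delta> \<le> 2\<close>; the bounds are then at least
    1.\<close>
  have "0 \<le> expo k 1 \<delta>" using \<delta> by (simp add: expo_def)
  then have EC: "1 \<le> 2 powr (4000 * expo k 1 \<delta>)" by (intro ge_one_powr_ge_zero) auto
  have lg1: "1 \<le> lg n" by (simp add: lg_def)
  have nZ: "n + 5 < 2 ^ w"
  proof -
    have "real (n + 5) < 8 * real n" using n1 by simp
    also have "\<dots> \<le> 2 ^ 4000 * (1 * real n ^ 4000)"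
    proof (rule mult_mono)
      have "(2::real) ^ 3 \<le> 2 ^ 4000" by (rule power_increasing) simp_all
      moreover have "(2::real) ^ 3 = 8" by simp
      ultimately show "(8::real) \<le> 2 ^ 4000" by (simp only:)
      show "real n \<le> 1 * real n ^ 4000" using self_le_power[of "real n" 4000] n1 by simp
    qed simp_all
    also have "\<dots> \<le> 2 ^ 4000 * ((real 1 ^ k / (\<delta> - 1)) ^ 4000 * real n ^ 4000)"
      using wb(2) by (intro mult_left_mono mult_right_mono one_le_power) simp_all
    also have "\<dots> \<le> real (2 ^ w)" by (rule wb(1))
    finally show ?thesis by (simp only: of_nat_less_iff)
  qed
  interpret ram w "2 ^ w" by unfold_locales simp
  let ?s = "init_state [n, k, 1, p, q]"
  have "run write_ones ?s (\<lambda>t s'. t \<le> 20 * n + 10 \<and> outp s' = outp ?s @ function_tables n [\<lambda>x\<in>{1..n}. 1])"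
    by (rule run_write_ones[OF _ nZ]) (simp add: init_state_def)
  then have "run write_ones ?s (\<lambda>t s'. 4 + t \<le> 20 * n + 14 \<and> outp s' = function_tables n [\<lambda>x\<in>{1..n}. 1])"
    by (rule run_mono) (simp add: init_state_def)
  then have "run splitter_prog ?s (\<lambda>t s'. t \<le> 20 * n + 14 \<and> outp s' = function_tables n [\<lambda>x\<in>{1..n}. 1])"
    unfolding splitter_prog_def run_Cond using nZ by (simp add: init_state_def)
  then obtain t s' where ts: "exec w splitter_prog ?s t s'" "t \<le> 20 * n + 14" "outp s' = function_tables n [\<lambda>x\<in>{1..n}. 1]"
    unfolding run_def by blast
  have one: "1 * 1 \<le> 2 powr (4000 * expo k 1 \<delta>) * lg n" using EC lg1 by (intro mult_mono) auto
  have "real t \<le> real (20 * n + 14)" using ts(2) by (simp only: of_nat_le_iff)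
  also have "\<dots> \<le> 4000 * real n * 1" using n1 by simp
  also have "\<dots> \<le> 4000 * real n * (2 powr (4000 * expo k 1 \<delta>) * lg n)" using one by (intro mult_left_mono) auto
  finally have "real t \<le> 4000 * 2 powr (4000 * expo k 1 \<delta>) * real n * lg n" by (simp only: mult_ac)
  moreover have "balanced_splitter \<delta> n k 1 (mset [\<lambda>x\<in>{1..n}. 1])" using \<delta> k by (intro balanced_splitter_1) auto
  moreover have "real (length [\<lambda>x\<in>{1..n}. 1 :: nat]) \<le> 2 powr (4000 * expo k 1 \<delta>) * lg n" using one by simp
  ultimately show ?thesis using ts by blast
qed

text \<open>One constant serves as factor in the running time, as exponent and as multiple in the
  word length. Its value 4000 comes from the running time: \<open>2000 * (M ^ 8 * L * n)\<close>
  together with \<open>L \<le> 2 * lg n\<close>. As an exponent it is generous, since the estimates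
  of size and time end with \<open>E ^ 46\<close> and \<open>E ^ 73\<close>.\<close>

theorem theorem6:
  shows "\<exists>(P::prog) (C::real). C > 0 \<and>
    (\<forall>(n::nat) (k::nat) (l::nat) (\<delta>::real) (p::nat) (q::nat) (w::nat).
       1 \<le> l \<and> l \<le> k \<and> k \<le> n \<and> 1 < \<delta> \<and> \<delta> \<le> 2 \<and>
       presents p q \<delta> \<and> p < 2 ^ w \<and> q < 2 ^ w \<and>
       C * (1 + expo k l \<delta> + log 2 (real n)) \<le> real w \<longrightarrow>
       (\<exists>(t::nat) (s::state) (hs::(nat \<Rightarrow> nat) list).
          exec w P (init_state [n, k, l, p, q]) t s \<and>
          outp s = function_tables n hs \<and>
          balanced_splitter \<delta> n k l (mset hs) \<and>
          real (length hs) \<le> 2 powr (C * expo k l \<delta>) * lg n \<and>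
          real t \<le> C * 2 powr (C * expo k l \<delta>) * real n * lg n))"
proof (rule exI[of _ splitter_prog], rule exI[of _ 4000], intro conjI allI impI, goal_cases)
  case 1
  show ?case by simp
next
  case (2 n k l \<delta> p q w)
  show ?case
  proof (cases "l = 1")
    case True
    then show ?thesis using 2 one_part_case[of k n \<delta> w p q] by simp
  next
    case False
    then show ?thesis using 2 by (intro general_case) auto
  qed
qed

end
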